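(* Let $S,\Omega,\mathbf r,\gamma,\kappa$ be as in the context and let $\nu\in\mathcal P(S)$ be a solution of the recursive distributional equation $T(\nu)=\nu$. Then the following conditions are equivalent. (i) The recursive tree process corresponding to $\nu$ is endogenous. (ii) For every $n\ge1$ and every $\mu^{(n)}_0\in\mathcal P(S^n)_\nu$, the solution $(\mu^{(n)}_t)_{t\ge0}$ of the $n$-variate mean-field equation $$\tfrac{\partial}{\partial t}\mu^{(n)}_t=|\mathbf r|\{T^{(n)}(\mu^{(n)}_t)-\mu^{(n)}_t\}\qquad(t\ge0)$$ started in $\mu^{(n)}_0$ converges weakly to $\overline\nu^{(n)}$ as $t\to\infty$.
   Context: $S$ and $\Omega$ are Polish spaces, $\mathbf r$ is a nonzero finite measure on $\Omega$ with total mass $|\mathbf r|$, and $\gamma:\Omega\times S^{\mathbb N_+}\to S$ and $\kappa:\Omega\to\mathbb N=\{0,1,\dots\}$ are measurable such that $\gamma[\omega](x_1,x_2,\dots)=\gamma[\omega](x_1,\dots,x_{\kappa(\omega)})$ depends only on the first $\kappa(\omega)$ coordinates and $\int_\Omega\mathbf r(\mathrm d\omega)\kappa(\omega)<\infty$. $T(\mu)$ is the law of $\gamma[\boldsymbol\omega](X_1,\ldots,X_{\kappa(\boldsymbol\omega)})$ with $\boldsymbol\omega$ of law $|\mathbf r|^{-1}\mathbf r$ and $(X_i)$ i.i.d. of law $\mu\in\mathcal P(S)$, independent of $\boldsymbol\omega$. $n$-variate objects: for $g:S^k\to S$ let $g^{(n)}:(S^n)^k\to S^n$ apply $g$ separately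 to each of the $n$ components: $g^{(n)}(x_1,\ldots,x_k):=(g(x^1),\ldots,g(x^n))$, where $x_i=(x^1_i,\ldots,x^n_i)$ and $x^m=(x^m_1,\ldots,x^m_k)$. $T^{(n)}:\mathcal P(S^n)\to\mathcal P(S^n)$ is defined like $T$ with $S,\gamma[\omega]$ replaced by $S^n,\gamma^{(n)}[\omega]$. Solutions of the $n$-variate equation are understood weakly: for each bounded measurable $\phi:S^n\to\mathbb R$, $t\mapsto\int\phi\,\mathrm d\mu^{(n)}_t$ is continuously differentiable and the equation holds when integrated against $\phi$ (solutions exist and are unique). $\mathcal P(S^n)_\nu$ is the set of probability measures on $S^n$ all of whose one-dimensional marginals equal $\nu$, and $\overline\nu^{(n)}$ is the law of $(X,\ldots,X)\in S^n$ where $X$ has law $\nu$. Recursive tree process (RTP): fix $d\in\mathbb N_+\cup\{\infty\}$ with $\kappa\le d$; $\mathbb T$ is the set of finite words over $\{1,\ldots,d\}$ (over $\mathbb N_+$ if $d=\infty$), viewed as a tree with root the empty word $\varnothing$, where the children of $\mathbf i$ are $\mathbf i1,\mathbf i2,\ldots$. For a finite subtree $\mathbb U\ni\varnothing$, $\partial\mathbb U$ is the set of elements of $\mathbb T\setminus\mathbb U$ whose parent is in $\mathbb U$. If $T(\nu)=\nu$, the RTP corresponding to $\nu$ (and $\gamma$) is the collection $(\boldsymbol\omega_{\mathbf i},X_{\mathbf i})_{\mathbf i\in\mathbb T}$ whose joint law is uniquely determined by: (1) $(\boldsymbol\omega_{\mathbf i})_{\mathbf i\in\mathbb T}$ are i.i.d.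 with law $|\mathbf r|^{-1}\mathbf r$; (2) for each finite subtree $\mathbb U\subset\mathbb T$ containing the root, $(X_{\mathbf i})_{\mathbf i\in\partial\mathbb U}$ are i.i.d. with law $\nu$ and independent of $(\boldsymbol\omega_{\mathbf i})_{\mathbf i\in\mathbb U}$; (3) $X_{\mathbf i}=\gamma[\boldsymbol\omega_{\mathbf i}](X_{\mathbf i1},\ldots,X_{\mathbf i\kappa(\boldsymbol\omega_{\mathbf i})})$ for all $\mathbf i\in\mathbb T$. It is endogenous if $X_\varnothing$ is a.s. equal to a random variable measurable w.r.t. the $\sigma$-field generated by $(\boldsymbol\omega_{\mathbf i})_{\mathbf i\in\mathbb T}$. *)

theory Defs
  imports "HOL-Probability.Probability"
begin

text \<open>
  Coordinates of \<open>S\<^sup>\<nat>\<close> and letters of the words forming the tree are numbered from 0, so the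
  first \<open>k\<close> coordinates of \<open>x\<close> are \<open>x 0, \<dots>, x (k - 1)\<close>. The space \<open>S\<^sup>n\<close> is the set of
  extensional functions \<open>{..<n} \<rightarrow>\<^sub>E UNIV\<close>; for second countable \<open>S\<close> the product sigma algebra below
  is the Borel sigma algebra of the product topology.
\<close>

abbreviation power_space :: "nat \<Rightarrow> (nat \<Rightarrow> 's::polish_space) measure"
  where "power_space n \<equiv> (\<Pi>\<^sub>M m\<in>{..<n}. borel)"

definition normalized :: "'o measure \<Rightarrow> 'o measure"
  where "normalized r = scale_measure (inverse (emeasure r (space r))) r"

text \<open>
  \<open>T_map r M g \<mu>\<close> is the law on \<open>M\<close> of \<open>g[\<omega>](X\<^sub>1, X\<^sub>2, \<dots>)\<close>. It is applied to \<open>M = borel\<close> and \<open>\<gamma>\<close>,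
  giving \<open>T\<close>, and to \<open>M = S\<^sup>n\<close> and \<open>\<gamma>\<close> acting componentwise, giving \<open>T\<close> on \<open>S\<^sup>n\<close>.
\<close>

definition T_map ::
    "'o measure \<Rightarrow> 'b measure \<Rightarrow> ('o \<Rightarrow> (nat \<Rightarrow> 'b) \<Rightarrow> 'b) \<Rightarrow> 'b measure \<Rightarrow> 'b measure"
  where "T_map r M g \<mu> =
    distr (normalized r \<Otimes>\<^sub>M (\<Pi>\<^sub>M i\<in>(UNIV::nat set). \<mu>)) M (\<lambda>(\<omega>, x). g \<omega> x)"

definition nvariate ::
    "nat \<Rightarrow> ('o \<Rightarrow> (nat \<Rightarrow> 's) \<Rightarrow> 's) \<Rightarrow> 'o \<Rightarrow> (nat \<Rightarrow> (nat \<Rightarrow> 's)) \<Rightarrow> (nat \<Rightarrow> 's)"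
  where "nvariate n \<gamma> \<omega> x = (\<lambda>m\<in>{..<n}. \<gamma> \<omega> (\<lambda>i. x i m))"

definition Tn_map ::
    "'o measure \<Rightarrow> ('o \<Rightarrow> (nat \<Rightarrow> 's::polish_space) \<Rightarrow> 's) \<Rightarrow> nat
      \<Rightarrow> (nat \<Rightarrow> 's) measure \<Rightarrow> (nat \<Rightarrow> 's) measure"
  where "Tn_map r \<gamma> n = T_map r (power_space n) (nvariate n \<gamma>)"

definition probs_with_marginals ::
    "nat \<Rightarrow> 's::polish_space measure \<Rightarrow> (nat \<Rightarrow> 's) measure set"
  where "probs_with_marginals n \<nu> =
    {\<mu> \<in> space (prob_algebra (power_space n)). \<forall>m<n. distr \<mu> borel (\<lambda>x. x m) = \<nu>}"

definition diagonal_law :: "nat \<Rightarrow> 's::polish_space measure \<Rightarrow> (nat \<Rightarrow> 's) measure"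
  where "diagonal_law n \<nu> = distr \<nu> (power_space n) (\<lambda>x. \<lambda>m\<in>{..<n}. x)"

text \<open>Only the values of \<open>\<mu>\<close> at times \<open>t \<ge> 0\<close> matter.\<close>

definition mean_field_solution ::
    "'o measure \<Rightarrow> ('o \<Rightarrow> (nat \<Rightarrow> 's::polish_space) \<Rightarrow> 's) \<Rightarrow> nat
      \<Rightarrow> (real \<Rightarrow> (nat \<Rightarrow> 's) measure) \<Rightarrow> bool"
  where "mean_field_solution r \<gamma> n \<mu> \<longleftrightarrow>
    (\<forall>t\<ge>0. \<mu> t \<in> space (prob_algebra (power_space n))) \<and>
    (\<forall>\<phi>::(nat \<Rightarrow> 's) \<Rightarrow> real.
      \<phi> \<in> borel_measurable (power_space n) \<and> bounded (\<phi> ` space (power_space n)) \<longrightarrow>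
      (\<exists>D. continuous_on {0..} D \<and>
        (\<forall>t\<ge>0. ((\<lambda>s. \<integral>x. \<phi> x \<partial>\<mu> s) has_real_derivative D t) (at t within {0..}) \<and>
          D t = measure r (space r) *
            ((\<integral>x. \<phi> x \<partial>Tn_map r \<gamma> n (\<mu> t)) - (\<integral>x. \<phi> x \<partial>\<mu> t)))))"

definition weakly_converges ::
    "nat \<Rightarrow> (real \<Rightarrow> (nat \<Rightarrow> 's::polish_space) measure) \<Rightarrow> (nat \<Rightarrow> 's) measure \<Rightarrow> bool"
  where "weakly_converges n \<mu> \<mu>' \<longleftrightarrow>
    (\<forall>f. continuous_map (product_topology (\<lambda>_. euclidean) {..<n}) euclideanreal f \<and>
         bounded (f ` space (power_space n)) \<longrightarrow>
         ((\<lambda>t. \<integral>x. f x \<partial>\<mu> t) \<longlongrightarrow> (\<integral>x. f x \<partial>\<mu>')) at_top)"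

text \<open>The child \<open>\<^bold>i j\<close> of the word \<open>\<^bold>i\<close> is \<open>i @ [j]\<close>.\<close>

definition tree :: "enat \<Rightarrow> nat list set"
  where "tree d = {i. \<forall>j\<in>set i. enat j < d}"

definition finite_rooted_subtree :: "enat \<Rightarrow> nat list set \<Rightarrow> bool"
  where "finite_rooted_subtree d U \<longleftrightarrow>
    finite U \<and> U \<subseteq> tree d \<and> [] \<in> U \<and> (\<forall>i j. i @ [j] \<in> U \<longrightarrow> i \<in> U)"

definition tree_boundary :: "enat \<Rightarrow> nat list set \<Rightarrow> nat list set"
  where "tree_boundary d U = {i \<in> tree d - U. i \<noteq> [] \<and> butlast i \<in> U}"

text \<open>
  The sigma algebra on the sample space generated by the family of random variables
  \<open>Y i\<close>, \<open>i \<in> I\<close>.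
\<close>

definition generated_by ::
    "'p measure \<Rightarrow> 'i set \<Rightarrow> ('i \<Rightarrow> 'p \<Rightarrow> 'b::topological_space) \<Rightarrow> 'p measure"
  where "generated_by M I Y =
    vimage_algebra (space M) (\<lambda>p. \<lambda>i\<in>I. Y i p) (\<Pi>\<^sub>M i\<in>I. borel)"

text \<open>
  \<open>W\<close> and \<open>X\<close>, defined on the probability space \<open>M\<close>, form a recursive tree process. Since this is a
  condition on the joint law, the recursion is required almost surely. In the recursion, \<open>\<gamma> \<omega>\<close>
  looks only at coordinates below \<open>\<kappa> \<omega> \<le> d\<close>, hence only at words in the tree.
\<close>

definition recursive_tree_process ::
    "'o::polish_space measure \<Rightarrow> ('o \<Rightarrow> (nat \<Rightarrow> 's::polish_space) \<Rightarrow> 's) \<Rightarrow> 's measure \<Rightarrow> enat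
      \<Rightarrow> 'p measure \<Rightarrow> (nat list \<Rightarrow> 'p \<Rightarrow> 'o) \<Rightarrow> (nat list \<Rightarrow> 'p \<Rightarrow> 's) \<Rightarrow> bool"
  where "recursive_tree_process r \<gamma> \<nu> d M W X \<longleftrightarrow>
    prob_space M \<and>
    (\<forall>i\<in>tree d. W i \<in> borel_measurable M \<and> X i \<in> borel_measurable M) \<and>
    prob_space.indep_vars M (\<lambda>_. borel) W (tree d) \<and>
    (\<forall>i\<in>tree d. distr M borel (W i) = normalized r) \<and>
    (\<forall>U. finite_rooted_subtree d U \<longrightarrow>
      prob_space.indep_vars M (\<lambda>_. borel) X (tree_boundary d U) \<and>
      (\<forall>i\<in>tree_boundary d U. distr M borel (X i) = \<nu>) \<and>
      prob_space.indep_set M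
        (sets (generated_by M (tree_boundary d U) X)) (sets (generated_by M U W))) \<and>
    (AE p in M. \<forall>i\<in>tree d. X i p = \<gamma> (W i p) (\<lambda>j. X (i @ [j]) p))"

definition endogenous ::
    "enat \<Rightarrow> 'p measure \<Rightarrow> (nat list \<Rightarrow> 'p \<Rightarrow> 'o::polish_space)
      \<Rightarrow> (nat list \<Rightarrow> 'p \<Rightarrow> 's::polish_space) \<Rightarrow> bool"
  where "endogenous d M W X \<longleftrightarrow>
    (\<exists>Z \<in> borel_measurable (generated_by M (tree d) W). AE p in M. X [] p = Z p)"

end

theory Submission
  imports Defs
begin

text \<open>
  For a bounded function \<open>h\<close> let \<open>explained k h\<close> be the second moment of the conditional mean of
  \<open>h (X\<^sub>\<emptyset>)\<close> given the marks of the first \<open>k\<close> generations. Both conditions are equivalent to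
  \<open>explained k 1\<^sub>A \<rightarrow> \<nu> A\<close> for all Borel sets \<open>A\<close>, that is, to \<open>1\<^sub>A (X\<^sub>\<emptyset>)\<close> being an \<open>L\<^sup>2\<close> limit of
  functions of finitely many generations of marks.

  For the convergence of the mean-field equation, say that a bivariate law \<open>\<mu>\<close> dominates depth \<open>k\<close> if
  \<open>\<integral> (f x + g y)\<^sup>2 \<mu>(dx, dy) \<ge> explained k (f + g)\<close> for all \<open>f, g\<close>. All laws with marginals \<open>\<nu>\<close>
  dominate depth 0, the map \<open>T\<close> on bivariate laws raises the depth by one, and a Gronwall argument turns this
  into: solutions eventually almost dominate every depth. With \<open>f = g = 1\<^sub>A\<close> this forces all coordinates
  to agree in the limit.

  Conversely, the laws of two copies of the root value that share \<open>k\<close> generations of marks and are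
  otherwise independent converge on rectangles as \<open>k \<rightarrow> \<infinity>\<close>. The limit is a fixed point of the map on
  bivariate laws, hence a constant solution; if it is carried by the diagonal, then
  \<open>explained k 1\<^sub>A \<rightarrow> \<nu> A\<close>.
\<close>

section \<open>Products of independent copies\<close>

text \<open>The map \<gamma> is only measurable in its arguments, so the map on bivariate laws need
  not respect weak limits. Limits are therefore taken on all measurable rectangles, and they come
  from monotonicity: from k = 1 on, \<open>explained k h\<close> increases with k because more marks
  can only improve the best mean square prediction, and polarization extends this to pairs of sets.
  The link with endogeny is Pythagoras: predicting \<open>1_A\<close> of the root from k generations
  of marks has least mean square error \<nu> A - \<open>explained k 1_A\<close>. Depth rises
  because, once the root mark \<omega> is fixed, the root value is a function of \<kappa> \<omega>
  independent subtrees, and a domination estimate survives exchanging these one at a time, at a cost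
  of one \<epsilon> each. Hence errors are multiplied by the mean of \<kappa>. It may exceed 1,
  which is harmless since the tolerance is chosen anew at every depth. All this presupposes that
  solutions keep the marginals \<nu>, a uniqueness statement for the one-variate equation that is
  proved on short time intervals.\<close>

lemma integrable_bounded_real:
  fixes f :: "'a \<Rightarrow> real"
  assumes "prob_space M" "f \<in> borel_measurable M" "\<And>x. x \<in> space M \<Longrightarrow> \<bar>f x\<bar> \<le> C"
  shows "integrable M f"
proof -
  interpret prob_space M by fact
  show ?thesis using assms(2,3) by (intro integrable_const_bound[of _ C]) auto
qed

lemma abs_integral_le_bound:
  fixes f :: "'a \<Rightarrow> real"
  assumes "prob_space M" "\<And>x. x \<in> space M \<Longrightarrow> \<bar>f x\<bar> \<le> C" "0 \<le> C"
  shows "\<bar>\<integral>x. f x \<partial>M\<bar> \<le> C"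
proof (cases "integrable M f")
  case True
  interpret prob_space M by fact
  have "\<bar>\<integral>x. f x \<partial>M\<bar> \<le> (\<integral>x. \<bar>f x\<bar> \<partial>M)" using integral_abs_bound[of M f] by simp
  also have "\<dots> \<le> (\<integral>x. C \<partial>M)" using True assms by (intro integral_mono) auto
  finally show ?thesis by (simp add: prob_space)
qed (use assms in \<open>simp add: not_integrable_integral_eq\<close>)

lemma integral_le_bound:
  fixes f :: "'a \<Rightarrow> real"
  assumes "prob_space M" "\<And>x. x \<in> space M \<Longrightarrow> f x \<le> C" "0 \<le> C"
  shows "(\<integral>x. f x \<partial>M) \<le> C"
proof (cases "integrable M f")
  case True
  interpret prob_space M by fact
  have "(\<integral>x. f x \<partial>M) \<le> (\<integral>x. C \<partial>M)" using True assms by (intro integral_mono) auto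
  then show ?thesis by (simp add: prob_space)
qed (use assms in \<open>simp add: not_integrable_integral_eq\<close>)

lemma square_integral_le_integral_square:
  fixes f :: "'a \<Rightarrow> real"
  assumes M: "prob_space M" and f: "f \<in> borel_measurable M" "\<And>x. x \<in> space M \<Longrightarrow> \<bar>f x\<bar> \<le> C"
  shows "(\<integral>x. f x \<partial>M)\<^sup>2 \<le> (\<integral>x. (f x)\<^sup>2 \<partial>M)"
proof -
  interpret prob_space M by fact
  note [measurable] = f(1)
  have "integrable M (\<lambda>x. (f x)\<^sup>2)"
    by (rule integrable_bounded_real[OF M, of _ "C\<^sup>2"])
       (auto intro!: power2_le_iff_abs_le[THEN iffD2] f(2) order.trans[OF abs_ge_zero f(2)])
  moreover have "integrable M f" using integrable_bounded_real[OF M f] .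
  ultimately show ?thesis using variance_positive[of f] by (simp add: variance_eq)
qed

lemma
  fixes F :: "'a \<times> 'b \<Rightarrow> real"
  assumes M: "prob_space M" and N: "prob_space N" and F: "F \<in> borel_measurable (M \<Otimes>\<^sub>M N)"
    and b: "\<And>x y. x \<in> space M \<Longrightarrow> y \<in> space N \<Longrightarrow> \<bar>F (x, y)\<bar> \<le> C"
  shows integral_pair_bounded_fst: "(\<integral>z. F z \<partial>(M \<Otimes>\<^sub>M N)) = (\<integral>x. \<integral>y. F (x, y) \<partial>N \<partial>M)"
    and integral_pair_bounded_snd: "(\<integral>z. F z \<partial>(M \<Otimes>\<^sub>M N)) = (\<integral>y. \<integral>x. F (x, y) \<partial>M \<partial>N)"
proof -
  interpret M: prob_space M by fact
  interpret N: prob_space N by fact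
  interpret P: pair_prob_space M N ..
  have *: "integrable (M \<Otimes>\<^sub>M N) F"
    using F b by (intro integrable_bounded_real[where C=C] P.prob_space_axioms)
      (auto simp: space_pair_measure)
  show "(\<integral>z. F z \<partial>(M \<Otimes>\<^sub>M N)) = (\<integral>x. \<integral>y. F (x, y) \<partial>N \<partial>M)"
    using P.integral_fst'[OF *] by simp
  show "(\<integral>z. F z \<partial>(M \<Otimes>\<^sub>M N)) = (\<integral>y. \<integral>x. F (x, y) \<partial>M \<partial>N)"
    using P.integral_snd[of "\<lambda>x y. F (x, y)"] * by simp
qed

abbreviation "iid N \<equiv> \<Pi>\<^sub>M i\<in>(UNIV::nat set). N"

lemma
  fixes F :: "(nat \<Rightarrow> 'a) \<Rightarrow> real"
  assumes M: "prob_space M" and F: "F \<in> borel_measurable (\<Pi>\<^sub>M i\<in>UNIV. M)"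
    and b: "\<And>x. x \<in> space (\<Pi>\<^sub>M i\<in>UNIV. M) \<Longrightarrow> \<bar>F x\<bar> \<le> C"
  shows integral_PiM_nat_fst:
      "(\<integral>x. F x \<partial>(\<Pi>\<^sub>M i\<in>UNIV. M)) = (\<integral>s. \<integral>w. F (case_nat s w) \<partial>(\<Pi>\<^sub>M i\<in>UNIV. M) \<partial>M)"
    and integral_PiM_nat_snd:
      "(\<integral>x. F x \<partial>(\<Pi>\<^sub>M i\<in>UNIV. M)) = (\<integral>w. \<integral>s. F (case_nat s w) \<partial>M \<partial>(\<Pi>\<^sub>M i\<in>UNIV. M))"
proof -
  interpret M: prob_space M by fact
  interpret product_prob_space "\<lambda>i::nat. M" UNIV ..
  interpret S: sequence_space M ..
  have cn: "case_nat s w \<in> space (\<Pi>\<^sub>M i\<in>UNIV. M)" if "s \<in> space M" "w \<in> space (iid M)" for s w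
    using that by (auto simp: space_PiM PiE_iff split: nat.split)
  have m: "(\<lambda>(s, w). case_nat s w) \<in> measurable (M \<Otimes>\<^sub>M (\<Pi>\<^sub>M i\<in>UNIV. M)) (\<Pi>\<^sub>M i\<in>UNIV. M)"
    by measurable
  have "(\<integral>x. F x \<partial>(\<Pi>\<^sub>M i\<in>UNIV. M)) = (\<integral>x. F x \<partial>distr (M \<Otimes>\<^sub>M (\<Pi>\<^sub>M i\<in>UNIV. M)) (\<Pi>\<^sub>M i\<in>UNIV. M) (\<lambda>(s, w). case_nat s w))"
    by (simp add: S.PiM_iter)
  also have "\<dots> = (\<integral>z. F (case z of (s, w) \<Rightarrow> case_nat s w) \<partial>(M \<Otimes>\<^sub>M (\<Pi>\<^sub>M i\<in>UNIV. M)))"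
    using m F by (rule integral_distr)
  finally have *: "(\<integral>x. F x \<partial>(\<Pi>\<^sub>M i\<in>UNIV. M)) = \<dots>" .
  have mF: "(\<lambda>z. F (case z of (s, w) \<Rightarrow> case_nat s w)) \<in> borel_measurable (M \<Otimes>\<^sub>M (\<Pi>\<^sub>M i\<in>UNIV. M))"
    using measurable_compose[OF m F] .
  show "(\<integral>x. F x \<partial>(\<Pi>\<^sub>M i\<in>UNIV. M)) = (\<integral>s. \<integral>w. F (case_nat s w) \<partial>(\<Pi>\<^sub>M i\<in>UNIV. M) \<partial>M)"
    unfolding * by (subst integral_pair_bounded_fst[OF M P.prob_space_axioms mF, of C]) (auto intro!: b cn)
  show "(\<integral>x. F x \<partial>(\<Pi>\<^sub>M i\<in>UNIV. M)) = (\<integral>w. \<integral>s. F (case_nat s w) \<partial>M \<partial>(\<Pi>\<^sub>M i\<in>UNIV. M))"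
    unfolding * by (subst integral_pair_bounded_snd[OF M P.prob_space_axioms mF, of C]) (auto intro!: b cn)
qed

text \<open>Arguments stay infinite sequences so that one product measure serves all marks; the
  number \<kappa> \<omega> of coordinates that \<gamma> reads enters only as the parameter j of
  inductions.\<close>

definition depends_on_first :: "nat \<Rightarrow> ((nat \<Rightarrow> 'a) \<Rightarrow> 'b) \<Rightarrow> bool"
  where "depends_on_first j f \<longleftrightarrow> (\<forall>x y. (\<forall>i<j. x i = y i) \<longrightarrow> f x = f y)"

lemma depends_on_first_case_nat:
  "depends_on_first (Suc j) f \<Longrightarrow> depends_on_first j (\<lambda>w. f (case_nat s w))"
  unfolding depends_on_first_def
proof (intro allI impI)
  fix x y :: "nat \<Rightarrow> 'a"
  assume f: "\<forall>x y. (\<forall>i<Suc j. x i = y i) \<longrightarrow> f x = f y" and e: "\<forall>i<j. x i = y i"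
  have "\<forall>i<Suc j. case_nat s x i = case_nat s y i" using e by (auto split: nat.split)
  with f show "f (case_nat s x) = f (case_nat s y)" by blast
qed

lemma depends_on_first_0: "depends_on_first 0 f \<Longrightarrow> f x = f y"
  by (simp add: depends_on_first_def)

lemma abs_add_le_2: "\<bar>a\<bar> \<le> 1 \<Longrightarrow> \<bar>b\<bar> \<le> 1 \<Longrightarrow> \<bar>a + b\<bar> \<le> (2::real)"
  by simp

lemma power2_le_4: "\<bar>a\<bar> \<le> 2 \<Longrightarrow> a\<^sup>2 \<le> (4::real)"
  using power2_le_iff_abs_le[of 2 a] by simp

lemma abs_diff_le_2: "\<bar>a\<bar> \<le> 1 \<Longrightarrow> \<bar>b\<bar> \<le> 1 \<Longrightarrow> \<bar>a - b\<bar> \<le> (2::real)"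
  by simp

lemma power2_le_1: "\<bar>a\<bar> \<le> 1 \<Longrightarrow> a\<^sup>2 \<le> (1::real)"
  by (simp add: abs_square_le_1)

lemma lessThan_2_ball: "(\<forall>i\<in>{..<2::nat}. P i) \<longleftrightarrow> P 0 \<and> P 1"
  by (auto simp: less_2_cases_iff)

lemma power2_sum_le_4:
  fixes a b :: real
  assumes "\<bar>a\<bar> \<le> 1" "\<bar>b\<bar> \<le> 1"
  shows "(a + b)\<^sup>2 \<le> 4"
  using power2_le_iff_abs_le[of 2 "a + b"] assms by simp

lemma measurable_componentwise:
  assumes [measurable]: "G \<in> borel_measurable (L \<Otimes>\<^sub>M B)"
    "T \<in> measurable N (iid L)" "b \<in> measurable N (iid B)"
  shows "(\<lambda>x. (\<lambda>i. G (T x i, b x i))) \<in> measurable N (iid borel)"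
  by (rule measurable_PiM_single') (auto simp: space_PiM)

text \<open>Coordinates are exchanged one at a time, each at cost \<epsilon>. Freezing the first
  coordinate of a sample turns f and g into functions with the different frozen values
  \<open>p s\<close> and \<open>q s\<close>; this is why the statement is about pairs of functions,
  even where the application has f = g. Averaging out the other coordinates leaves the same kind of
  quadratic form in the first one, to which \<open>bound\<close> applies.\<close>

lemma iid_product_lower_bound:
  fixes L :: "'l measure" and B :: "'b measure" and G :: "'l \<times> 'b \<Rightarrow> 's::topological_space"
    and \<mu> :: "'m measure" and p q :: "'m \<Rightarrow> 's"
  assumes L: "prob_space L" and B: "prob_space B" and \<mu>: "prob_space \<mu>"
    and G[measurable]: "G \<in> borel_measurable (L \<Otimes>\<^sub>M B)"
    and pq[measurable]: "p \<in> borel_measurable \<mu>" "q \<in> borel_measurable \<mu>"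
    and bound: "\<And>f g. f \<in> borel_measurable borel \<Longrightarrow> g \<in> borel_measurable borel \<Longrightarrow>
      (\<And>x. \<bar>f x\<bar> \<le> 1) \<Longrightarrow> (\<And>x. \<bar>g x\<bar> \<le> 1) \<Longrightarrow>
      (\<integral>x. (f (p x) + g (q x))\<^sup>2 \<partial>\<mu>) \<ge> (\<integral>l. (\<integral>b. f (G (l, b)) + g (G (l, b)) \<partial>B)\<^sup>2 \<partial>L) - \<epsilon>"
  assumes "f \<in> borel_measurable (iid borel)" "g \<in> borel_measurable (iid borel)"
    and "\<And>x. \<bar>f x\<bar> \<le> (1::real)" "\<And>x. \<bar>g x\<bar> \<le> (1::real)"
    and "depends_on_first j f" "depends_on_first j g"
  shows "(\<integral>x. (f (\<lambda>i. p (x i)) + g (\<lambda>i. q (x i)))\<^sup>2 \<partial>(iid \<mu>)) \<ge>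
    (\<integral>l. (\<integral>b. f (\<lambda>i. G (l i, b i)) + g (\<lambda>i. G (l i, b i)) \<partial>(\<Pi>\<^sub>M i\<in>UNIV. B))\<^sup>2 \<partial>(\<Pi>\<^sub>M i\<in>UNIV. L)) - real j * \<epsilon>"
  using assms(8-)
proof (induction j arbitrary: f g)
  case 0
  interpret SM: prob_space "iid \<mu>" using \<mu> by (intro prob_space_PiM)
  interpret SL: prob_space "iid L" using L by (intro prob_space_PiM)
  interpret SB: prob_space "iid B" using B by (intro prob_space_PiM)
  have *: "f = (\<lambda>_. f undefined)" "g = (\<lambda>_. g undefined)"
    using depends_on_first_0[OF 0(5)] depends_on_first_0[OF 0(6)] by blast+
  show ?case by (subst (1 2) *(1), subst (1 2) *(2)) (simp add: SM.prob_space SL.prob_space SB.prob_space)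
next
  case (Suc j)
  note [measurable] = Suc.prems(1,2)
  note bnd = Suc.prems(3,4)
  let ?SM = "iid \<mu>" and ?SL = "iid L"
    and ?SB = "iid B"
  interpret B: prob_space B by fact
  interpret L: prob_space L by fact
  interpret SM: prob_space ?SM using \<mu> by (intro prob_space_PiM)
  interpret SL: prob_space ?SL using L by (intro prob_space_PiM)
  interpret SB: prob_space ?SB using B by (intro prob_space_PiM)
  define V where "V T b = (\<lambda>i::nat. G (T i, b i))" for T b
  define P where "P x = (\<lambda>i::nat. p (x i))" for x
  define Q where "Q x = (\<lambda>i::nat. q (x i))" for x
  have mV[measurable]: "(\<lambda>(T, b). V T b) \<in> measurable (?SL \<Otimes>\<^sub>M ?SB) (iid borel)"
    unfolding V_def split_beta' by (rule measurable_componentwise[OF G]) measurable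
  have [measurable]: "P \<in> measurable ?SM (iid borel)" "Q \<in> measurable ?SM (iid borel)"
    unfolding P_def Q_def by (rule measurable_PiM_single'; simp add: space_PiM)+
  \<comment> \<open>\<open>A T\<close> and \<open>C T\<close> are f and g with first coordinate z,
    averaged over the leaves of the other coordinates while their marks T are frozen. As functions
    of z they are the test functions for \<open>bound\<close>.\<close>
  define A where "A T z = (\<integral>b. f (case_nat z (V T b)) \<partial>?SB)" for T z
  define C where "C T z = (\<integral>b. g (case_nat z (V T b)) \<partial>?SB)" for T z
  have mA[measurable]: "(\<lambda>(T, z). A T z) \<in> borel_measurable (?SL \<Otimes>\<^sub>M borel)"
    unfolding A_def by measurable
  have mC[measurable]: "(\<lambda>(T, z). C T z) \<in> borel_measurable (?SL \<Otimes>\<^sub>M borel)"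
    unfolding C_def by measurable
  have bA: "\<bar>A T z\<bar> \<le> 1" and bC: "\<bar>C T z\<bar> \<le> 1" for T z
    unfolding A_def C_def by (auto intro!: abs_integral_le_bound SB.prob_space_axioms bnd)
  have AC: "(\<integral>b. f (case_nat z (V T b)) + g (case_nat z' (V T b)) \<partial>?SB) = A T z + C T z'"
    if T: "T \<in> space ?SL" for T z z'
    unfolding A_def C_def
  proof (intro Bochner_Integration.integral_add integrable_bounded_real[OF SB.prob_space_axioms, of _ 1] bnd)
    have [measurable]: "V T \<in> measurable ?SB (iid borel)"
      using measurable_compose[OF measurable_Pair1'[OF T] mV] by simp
    show "(\<lambda>b. f (case_nat z (V T b))) \<in> borel_measurable ?SB" 
      "(\<lambda>b. g (case_nat z' (V T b))) \<in> borel_measurable ?SB"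
      by measurable
  qed
  \<comment> \<open>The induction hypothesis exchanges the j later coordinates for a fixed first
    sample s.\<close>
  have 1: "(\<integral>w. (f (P (case_nat s w)) + g (Q (case_nat s w)))\<^sup>2 \<partial>?SM)
    \<ge> (\<integral>T. (A T (p s) + C T (q s))\<^sup>2 \<partial>?SL) - real j * \<epsilon>" if s: "s \<in> space \<mu>" for s
  proof -
    have "(\<integral>w. (f (P (case_nat s w)) + g (Q (case_nat s w)))\<^sup>2 \<partial>?SM)
      = (\<integral>w. (f (case_nat (p s) (P w)) + g (case_nat (q s) (Q w)))\<^sup>2 \<partial>?SM)"
      by (intro Bochner_Integration.integral_cong refl arg_cong2[where f="\<lambda>a b. (a + b)\<^sup>2"]
          arg_cong[where f=f] arg_cong[where f=g]) (auto simp: P_def Q_def split: nat.split)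
    also have "\<dots> \<ge> (\<integral>T. (\<integral>b. f (case_nat (p s) (V T b)) + g (case_nat (q s) (V T b)) \<partial>?SB)\<^sup>2 \<partial>?SL) - real j * \<epsilon>"
      unfolding V_def P_def Q_def
      by (intro Suc.IH) (use bnd in \<open>auto intro!: depends_on_first_case_nat Suc.prems\<close>)
    also have "(\<integral>T. (\<integral>b. f (case_nat (p s) (V T b)) + g (case_nat (q s) (V T b)) \<partial>?SB)\<^sup>2 \<partial>?SL)
      = (\<integral>T. (A T (p s) + C T (q s))\<^sup>2 \<partial>?SL)"
      by (intro Bochner_Integration.integral_cong refl) (simp add: AC)
    finally show ?thesis .
  qed
  have "(\<integral>l. (\<integral>b. f (V l b) + g (V l b) \<partial>?SB)\<^sup>2 \<partial>?SL) - real (Suc j) * \<epsilon>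
    = (\<integral>T. \<integral>t. (\<integral>b. f (V (case_nat t T) b) + g (V (case_nat t T) b) \<partial>?SB)\<^sup>2 \<partial>L \<partial>?SL) - real (Suc j) * \<epsilon>"
    by (subst integral_PiM_nat_snd[OF L, of _ 4])
      (auto intro!: power2_le_4 abs_integral_le_bound SB.prob_space_axioms
        abs_add_le_2 bnd)
  also have "\<dots> = (\<integral>T. \<integral>t. (\<integral>b. A T (G (t, b)) + C T (G (t, b)) \<partial>B)\<^sup>2 \<partial>L \<partial>?SL) - real (Suc j) * \<epsilon>"
  proof (intro arg_cong2[where f="(-)"] Bochner_Integration.integral_cong refl arg_cong[where f="\<lambda>x. x\<^sup>2"])
    fix T t assume T: "T \<in> space ?SL" and t: "t \<in> space L"
    have "case_nat t T \<in> space ?SL"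
      using T t by (auto simp: space_PiM PiE_iff split: nat.split)
    then have [measurable]: "V (case_nat t T) \<in> measurable ?SB (iid borel)"
      using measurable_compose[OF measurable_Pair1' mV] by simp
    have "(\<integral>b. f (V (case_nat t T) b) + g (V (case_nat t T) b) \<partial>?SB)
      = (\<integral>b. \<integral>b'. f (V (case_nat t T) (case_nat b b')) + g (V (case_nat t T) (case_nat b b')) \<partial>?SB \<partial>B)"
      by (subst integral_PiM_nat_fst[OF B, of _ 2])
        (auto intro!: abs_add_le_2 bnd)
    also have "\<dots> = (\<integral>b. A T (G (t, b)) + C T (G (t, b)) \<partial>B)"
    proof (intro Bochner_Integration.integral_cong refl)
      fix b
      have e: "(V (case_nat t T) (case_nat b b')) = case_nat (G (t, b)) (V T b')" for b'
        by (auto simp: V_def split: nat.split)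
      show "(\<integral>b'. f (V (case_nat t T) (case_nat b b')) + g (V (case_nat t T) (case_nat b b')) \<partial>?SB) = A T (G (t, b)) + C T (G (t, b))"
        unfolding e using AC[OF T] .
    qed
    finally show "(\<integral>b. f (V (case_nat t T) b) + g (V (case_nat t T) b) \<partial>?SB) = \<dots>" .
  qed
  \<comment> \<open>One of the j + 1 copies of \<epsilon> moves inside the integral over T, where it
    pays for exchanging the first coordinate at fixed T.\<close>
  also have "\<dots> = (\<integral>T. (\<integral>t. (\<integral>b. A T (G (t, b)) + C T (G (t, b)) \<partial>B)\<^sup>2 \<partial>L) - \<epsilon> \<partial>?SL) - real j * \<epsilon>"
    apply (subst Bochner_Integration.integral_diff)
    subgoal
      by (rule integrable_bounded_real[OF SL.prob_space_axioms, of _ 4])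
       (auto intro!: integral_le_bound[OF L] power2_le_4
        abs_integral_le_bound[OF B] abs_add_le_2 bA bC)
    by (simp_all add: SL.prob_space algebra_simps)
  also have "\<dots> \<le> (\<integral>T. (\<integral>s. (A T (p s) + C T (q s))\<^sup>2 \<partial>\<mu>) \<partial>?SL) - real j * \<epsilon>"
  proof (intro diff_right_mono integral_mono)
    show "integrable ?SL (\<lambda>T. (\<integral>t. (\<integral>b. A T (G (t, b)) + C T (G (t, b)) \<partial>B)\<^sup>2 \<partial>L) - \<epsilon>)"
      by (rule Bochner_Integration.integrable_diff[OF integrable_bounded_real[OF SL.prob_space_axioms, of _ 4] SL.integrable_const])
       (auto intro!: integral_le_bound[OF L] power2_le_4
        abs_integral_le_bound[OF B] abs_add_le_2 bA bC)
    show "integrable ?SL (\<lambda>T. \<integral>s. (A T (p s) + C T (q s))\<^sup>2 \<partial>\<mu>)"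
    proof -
      interpret \<mu>: prob_space \<mu> by fact
      show ?thesis
      by (intro integrable_bounded_real[OF SL.prob_space_axioms, of _ 4])
       (auto intro!: integral_le_bound[OF \<mu>] power2_sum_le_4 bA bC)
    qed
    fix T assume T[measurable]: "T \<in> space ?SL"
    show "(\<integral>t. (\<integral>b. A T (G (t, b)) + C T (G (t, b)) \<partial>B)\<^sup>2 \<partial>L) - \<epsilon> \<le> (\<integral>s. (A T (p s) + C T (q s))\<^sup>2 \<partial>\<mu>)"
      by (intro bound bA bC) measurable
  qed
  \<comment> \<open>Fubini puts the integral over the first sample s outside, so that
    \<open>1\<close> applies for each s.\<close>
  also have "(\<integral>T. (\<integral>s. (A T (p s) + C T (q s))\<^sup>2 \<partial>\<mu>) \<partial>?SL) = (\<integral>s. (\<integral>T. (A T (p s) + C T (q s))\<^sup>2 \<partial>?SL) \<partial>\<mu>)"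
    using integral_pair_bounded_fst[OF SL.prob_space_axioms \<mu>, of "\<lambda>(T, s). (A T (p s) + C T (q s))\<^sup>2" 4]
      integral_pair_bounded_snd[OF SL.prob_space_axioms \<mu>, of "\<lambda>(T, s). (A T (p s) + C T (q s))\<^sup>2" 4]
    by (simp add: power2_sum_le_4 bA bC)
  also have "\<dots> - real j * \<epsilon> = (\<integral>s. (\<integral>T. (A T (p s) + C T (q s))\<^sup>2 \<partial>?SL) - real j * \<epsilon> \<partial>\<mu>)"
  proof -
    interpret \<mu>: prob_space \<mu> by fact
    show ?thesis
      apply (subst Bochner_Integration.integral_diff)
      subgoal
        by (intro integrable_bounded_real[OF \<mu>, of _ 4])
         (auto intro!: integral_le_bound[OF SL.prob_space_axioms] power2_sum_le_4 bA bC)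
      by (simp_all add: \<mu>.prob_space)
  qed
  also have "\<dots> \<le> (\<integral>s. \<integral>w. (f (P (case_nat s w)) + g (Q (case_nat s w)))\<^sup>2 \<partial>?SM \<partial>\<mu>)"
  proof (intro integral_mono 1)
    interpret \<mu>: prob_space \<mu> by fact
    show "integrable \<mu> (\<lambda>s. (\<integral>T. (A T (p s) + C T (q s))\<^sup>2 \<partial>?SL) - real j * \<epsilon>)"
      by (rule Bochner_Integration.integrable_diff[OF integrable_bounded_real[OF \<mu>, of _ 4] \<mu>.integrable_const])
         (auto intro!: integral_le_bound[OF SL.prob_space_axioms] power2_sum_le_4 bA bC)
    show "integrable \<mu> (\<lambda>s. \<integral>w. (f (P (case_nat s w)) + g (Q (case_nat s w)))\<^sup>2 \<partial>?SM)"
      by (intro integrable_bounded_real[OF \<mu>, of _ 4])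
         (auto intro!: integral_le_bound[OF SM.prob_space_axioms] power2_sum_le_4 bnd)
  qed
  also have "\<dots> = (\<integral>x. (f (P x) + g (Q x))\<^sup>2 \<partial>?SM)"
    by (subst integral_PiM_nat_fst[OF \<mu>, of _ 4]) (auto intro!: power2_sum_le_4 bnd)
  finally show ?case unfolding V_def P_def Q_def .
qed

section \<open>Trees of marks\<close>

text \<open>A child is formed by appending a letter, whereas the subtree below the child j of the
  root consists of the words with first letter j. Splitting at the first letter gives the root mark
  and countably many independent trees of the same kind.\<close>

definition tree_join :: "'a \<Rightarrow> (nat \<Rightarrow> nat list \<Rightarrow> 'a) \<Rightarrow> nat list \<Rightarrow> 'a"
  where "tree_join a T i = (case i of [] \<Rightarrow> a | j # i' \<Rightarrow> T j i')"

lemma tree_join_simps [simp]: "tree_join a T [] = a" "tree_join a T (j # i) = T j i"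
  by (simp_all add: tree_join_def)

lemma measurable_tree_join:
  "(\<lambda>(a, T). tree_join a T) \<in> measurable (N \<Otimes>\<^sub>M (\<Pi>\<^sub>M j\<in>(UNIV::nat set). \<Pi>\<^sub>M i\<in>(UNIV::nat list set). N)) (\<Pi>\<^sub>M i\<in>UNIV. N)"
proof (rule measurable_PiM_single')
  fix i :: "nat list"
  show "(\<lambda>x. (case x of (a, T) \<Rightarrow> tree_join a T) i) \<in> measurable (N \<Otimes>\<^sub>M (\<Pi>\<^sub>M j\<in>(UNIV::nat set). \<Pi>\<^sub>M i\<in>(UNIV::nat list set). N)) N"
  proof (cases i)
    case (Cons j i')
    have "(\<lambda>T. T j) \<in> measurable (\<Pi>\<^sub>M j\<in>(UNIV::nat set). \<Pi>\<^sub>M i\<in>(UNIV::nat list set). N) (\<Pi>\<^sub>M i\<in>(UNIV::nat list set). N)"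
      by (rule measurable_component_singleton) simp
    from measurable_compose[OF measurable_snd this]
    have "(\<lambda>x. snd x j) \<in> measurable (N \<Otimes>\<^sub>M (\<Pi>\<^sub>M j\<in>(UNIV::nat set). \<Pi>\<^sub>M i\<in>(UNIV::nat list set). N)) (\<Pi>\<^sub>M i\<in>(UNIV::nat list set). N)" .
    from measurable_compose[OF this measurable_component_singleton[of i' UNIV]]
    have "(\<lambda>x. snd x j i') \<in> measurable (N \<Otimes>\<^sub>M (\<Pi>\<^sub>M j\<in>(UNIV::nat set). \<Pi>\<^sub>M i\<in>(UNIV::nat list set). N)) N"
      by simp
    then show ?thesis by (simp add: Cons split_beta')
  qed (simp add: split_beta')
qed (auto simp: space_pair_measure space_PiM PiE_iff tree_join_def split: list.split)

text \<open>A product measure is determined by its values on cylinders. A finite set of words splits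
  into the root, if present, and finitely many finite sets of words below the children, and the
  product over words regroups accordingly.\<close>

lemma distr_tree_join:
  assumes "prob_space N"
  shows "distr (N \<Otimes>\<^sub>M (\<Pi>\<^sub>M j\<in>(UNIV::nat set). \<Pi>\<^sub>M i\<in>(UNIV::nat list set). N)) (\<Pi>\<^sub>M i\<in>UNIV. N)
    (\<lambda>(a, T). tree_join a T) = (\<Pi>\<^sub>M i\<in>UNIV. N)"
proof -
  interpret N: prob_space N by fact
  let ?P = "\<Pi>\<^sub>M i\<in>(UNIV::nat list set). N"
  interpret P: product_prob_space "\<lambda>_. N" "UNIV :: nat list set" ..
  interpret Q: product_prob_space "\<lambda>_. ?P" "UNIV :: nat set" ..
  interpret NQ: pair_prob_space N "\<Pi>\<^sub>M j\<in>(UNIV::nat set). ?P" ..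
  show ?thesis
  proof (rule P.PiM_eq)
    fix J :: "nat list set" and F assume J: "finite J" "\<And>j. j \<in> J \<Longrightarrow> F j \<in> sets N"
    define J1 where "J1 = {j. \<exists>i. j # i \<in> J}"
    define J2 where "J2 j = {i. j # i \<in> J}" for j
    let ?E = "if [] \<in> J then F [] else space N"
    let ?C = "\<lambda>j. prod_emb UNIV (\<lambda>_. N) (J2 j) (\<Pi>\<^sub>E i\<in>J2 j. F (j # i))"
    let ?D = "prod_emb UNIV (\<lambda>_. ?P) J1 (\<Pi>\<^sub>E j\<in>J1. ?C j)"
    have fin: "finite J1" "finite (J2 j)" for j
      using finite_subset[of J1 "hd ` J"] finite_subset[of "J2 j" "tl ` J"] J(1)
      unfolding J1_def J2_def by (force simp: image_iff)+
    have C: "?C j \<in> sets ?P" for j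
      using fin J(2) by (intro sets_PiM_I) (auto simp: J2_def)
    have D: "?D \<in> sets (iid ?P)" using fin C by (intro sets_PiM_I) auto
    have sub: "x \<in> space N" if "x \<in> F j" "j \<in> J" for x j
      using that J(2) sets.sets_into_space by blast
    have eq: "(\<lambda>(a, T). tree_join a T) -` prod_emb UNIV (\<lambda>_. N) J (Pi\<^sub>E J F) \<inter> space (N \<Otimes>\<^sub>M (iid ?P)) = ?E \<times> ?D"
    proof (rule set_eqI)
      fix z :: "'a \<times> (nat \<Rightarrow> nat list \<Rightarrow> 'a)"
      obtain a T where z: "z = (a, T)" by (cases z)
      have "z \<in> (\<lambda>(a, T). tree_join a T) -` prod_emb UNIV (\<lambda>_. N) J (Pi\<^sub>E J F) \<inter> space (N \<Otimes>\<^sub>M (iid ?P))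
        \<longleftrightarrow> a \<in> space N \<and> (\<forall>j i. T j i \<in> space N) \<and> (\<forall>i\<in>J. tree_join a T i \<in> F i)"
        by (auto simp: z prod_emb_def space_pair_measure space_PiM PiE_iff restrict_def extensional_def tree_join_def split: list.split)
      also have "(\<forall>i\<in>J. tree_join a T i \<in> F i) \<longleftrightarrow> ([] \<in> J \<longrightarrow> a \<in> F []) \<and> (\<forall>j i. j # i \<in> J \<longrightarrow> T j i \<in> F (j # i))"
        (is "?l \<longleftrightarrow> ?r")
      proof
        assume ?r
        show ?l
        proof
          fix i assume "i \<in> J" with \<open>?r\<close> show "tree_join a T i \<in> F i" by (cases i) auto
        qed
      qed (force dest: bspec)
      also have "(a \<in> space N \<and> (\<forall>j i. T j i \<in> space N) \<and> ([] \<in> J \<longrightarrow> a \<in> F []) \<and> (\<forall>j i. j # i \<in> J \<longrightarrow> T j i \<in> F (j # i)))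
        \<longleftrightarrow> z \<in> ?E \<times> ?D"
        using sub by (auto simp: z prod_emb_def space_PiM PiE_iff J1_def J2_def)
      finally show "z \<in> (\<lambda>(a, T). tree_join a T) -` prod_emb UNIV (\<lambda>_. N) J (Pi\<^sub>E J F) \<inter> space (N \<Otimes>\<^sub>M (iid ?P))
        \<longleftrightarrow> z \<in> ?E \<times> ?D" .
    qed
    have "emeasure (distr (N \<Otimes>\<^sub>M (iid ?P)) ?P (\<lambda>(a, T). tree_join a T)) (prod_emb UNIV (\<lambda>_. N) J (Pi\<^sub>E J F))
      = emeasure (N \<Otimes>\<^sub>M (iid ?P)) (?E \<times> ?D)"
      using J by (subst emeasure_distr[OF measurable_tree_join]) (auto intro!: sets_PiM_I simp: eq)
    also have "\<dots> = emeasure N ?E * emeasure (iid ?P) ?D"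
      using J D by (intro Q.P.emeasure_pair_measure_Times) auto
    also have "emeasure N ?E = (\<Prod>j\<in>J \<inter> {[]}. emeasure N (F j))"
      by (auto simp: N.emeasure_space_1)
    also have "emeasure (iid ?P) ?D = (\<Prod>j\<in>J1. emeasure ?P (?C j))"
      using fin C by (intro Q.emeasure_PiM_emb) auto
    also have "\<dots> = (\<Prod>j\<in>J1. \<Prod>i\<in>J2 j. emeasure N (F (j # i)))"
      using fin J by (intro prod.cong refl P.emeasure_PiM_emb) (auto simp: J2_def)
    also have "\<dots> = (\<Prod>(j, i)\<in>Sigma J1 J2. emeasure N (F (j # i)))"
      using fin by (simp add: prod.Sigma)
    also have "\<dots> = (\<Prod>i\<in>J - {[]}. emeasure N (F i))"
      by (rule prod.reindex_bij_witness[of _ "\<lambda>i. (hd i, tl i)" "\<lambda>(j, i). j # i"])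
        (auto simp: J1_def J2_def neq_Nil_conv)
    also have "(\<Prod>j\<in>J \<inter> {[]}. emeasure N (F j)) * \<dots> = (\<Prod>j\<in>J. emeasure N (F j))"
      using J(1) by (subst prod.union_disjoint[symmetric]) (auto intro!: prod.cong)
    finally show "emeasure (distr (N \<Otimes>\<^sub>M (iid ?P)) ?P (\<lambda>(a, T). tree_join a T)) (prod_emb UNIV (\<lambda>_. N) J (Pi\<^sub>E J F))
      = (\<Prod>j\<in>J. emeasure N (F j))" .
  qed simp
qed

lemma integral_PiM_tree:
  fixes F :: "(nat list \<Rightarrow> 'a) \<Rightarrow> real"
  assumes N: "prob_space N" and F: "F \<in> borel_measurable (\<Pi>\<^sub>M i\<in>UNIV. N)"
    and b: "\<And>x. x \<in> space (\<Pi>\<^sub>M i\<in>UNIV. N) \<Longrightarrow> \<bar>F x\<bar> \<le> C"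
  shows "(\<integral>x. F x \<partial>(\<Pi>\<^sub>M i\<in>UNIV. N))
    = (\<integral>a. \<integral>T. F (tree_join a T) \<partial>(\<Pi>\<^sub>M j\<in>(UNIV::nat set). \<Pi>\<^sub>M i\<in>(UNIV::nat list set). N) \<partial>N)"
proof -
  let ?Q = "\<Pi>\<^sub>M j\<in>(UNIV::nat set). \<Pi>\<^sub>M i\<in>(UNIV::nat list set). N"
  interpret Q: prob_space ?Q using N by (intro prob_space_PiM)
  have "(\<integral>x. F x \<partial>(\<Pi>\<^sub>M i\<in>UNIV. N)) = (\<integral>x. F x \<partial>distr (N \<Otimes>\<^sub>M ?Q) (\<Pi>\<^sub>M i\<in>UNIV. N) (\<lambda>(a, T). tree_join a T))"
    by (simp add: distr_tree_join[OF N])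
  also have "\<dots> = (\<integral>z. F (case z of (a, T) \<Rightarrow> tree_join a T) \<partial>(N \<Otimes>\<^sub>M ?Q))"
    using measurable_tree_join F by (rule integral_distr)
  also have "\<dots> = (\<integral>a. \<integral>T. F (tree_join a T) \<partial>?Q \<partial>N)"
    by (subst integral_pair_bounded_fst[OF N Q.prob_space_axioms measurable_compose[OF measurable_tree_join F], of C])
      (auto intro!: b simp: space_PiM PiE_iff tree_join_def split: list.split)
  finally show ?thesis .
qed

lemma measurable_subtree:
  "(\<lambda>\<theta> i. \<theta> (j # i)) \<in> measurable (\<Pi>\<^sub>M i\<in>(UNIV::nat list set). N) (\<Pi>\<^sub>M i\<in>(UNIV::nat list set). N)"
  by (rule measurable_PiM_single') (auto simp: space_PiM PiE_iff)

lemma distr_restrict_PiM: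
  assumes "prob_space N" "sets N = sets N'"
  shows "distr (\<Pi>\<^sub>M i\<in>(UNIV :: nat list set). N) (\<Pi>\<^sub>M i\<in>I. N') (\<lambda>x. restrict x I) = (\<Pi>\<^sub>M i\<in>I. N)"
proof -
  have "distr (\<Pi>\<^sub>M i\<in>(UNIV :: nat list set). N) (\<Pi>\<^sub>M i\<in>I. N) (\<lambda>x. \<lambda>n\<in>I. x n) = (\<Pi>\<^sub>M i\<in>I. N)"
    using distr_PiM_reindex[of UNIV "\<lambda>_. N" "\<lambda>i. i" I] assms by simp
  moreover have "distr (\<Pi>\<^sub>M i\<in>(UNIV :: nat list set). N) (\<Pi>\<^sub>M i\<in>I. N) (\<lambda>x. \<lambda>n\<in>I. x n)
    = distr (\<Pi>\<^sub>M i\<in>(UNIV :: nat list set). N) (\<Pi>\<^sub>M i\<in>I. N') (\<lambda>x. restrict x I)"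
    using assms(2) by (intro distr_cong sets_PiM_cong) auto
  ultimately show ?thesis by simp
qed

text \<open>Outside I an extensional function has the constant value \<open>undefined\<close>, so a
  family known only on part of the tree can be fed to functions of all words.\<close>

lemma measurable_extend:
  assumes "sets N = sets N'" "space N = UNIV"
  shows "(\<lambda>x. x) \<in> measurable (\<Pi>\<^sub>M i\<in>I. N') (\<Pi>\<^sub>M i\<in>(UNIV :: nat list set). N)"
proof (rule measurable_PiM_single')
  fix i :: "nat list"
  show "(\<lambda>x. x i) \<in> measurable (\<Pi>\<^sub>M i\<in>I. N') N"
  proof (cases "i \<in> I")
    case True
    then have "(\<lambda>x. x i) \<in> measurable (\<Pi>\<^sub>M i\<in>I. N') N'" by (rule measurable_component_singleton)
    then show ?thesis using measurable_cong_sets[OF refl assms(1)] by blast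
  next
    case False
    have "(\<lambda>x. undefined) \<in> measurable (\<Pi>\<^sub>M i\<in>I. N') N" using assms(2) by simp
    also have "?this \<longleftrightarrow> ?thesis"
      using False by (intro measurable_cong) (auto simp: space_PiM PiE_iff extensional_def)
    finally show ?thesis .
  qed
qed (use assms(2) in auto)

lemma coordinate_measurable:
  "m < n \<Longrightarrow> sets \<mu> = sets (power_space n) \<Longrightarrow> (\<lambda>x. x m) \<in> borel_measurable \<mu>"
  using measurable_component_singleton[of m "{..<n}" "\<lambda>_. borel"] measurable_cong_sets[of \<mu> "power_space n", OF _ refl]
  by blast

section \<open>Evaluation of finite trees and domination of bivariate laws\<close>

locale rde =
  fixes r :: "'o::polish_space measure"
    and \<gamma> :: "'o \<Rightarrow> (nat \<Rightarrow> 's::polish_space) \<Rightarrow> 's"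
    and \<kappa> :: "'o \<Rightarrow> nat"
    and \<nu> :: "'s measure"
  assumes sets_r: "sets r = sets borel" and finite_r: "finite_measure r"
    and r_nonzero: "emeasure r (space r) \<noteq> 0"
    and \<gamma>_borel: "(\<lambda>(\<omega>, x). \<gamma> \<omega> x) \<in> borel_measurable (borel \<Otimes>\<^sub>M (iid borel))"
    and \<kappa>_borel: "\<kappa> \<in> measurable borel (count_space UNIV)"
    and \<gamma>_cong: "\<And>\<omega> x y. (\<And>i. i < \<kappa> \<omega> \<Longrightarrow> x i = y i) \<Longrightarrow> \<gamma> \<omega> x = \<gamma> \<omega> y"
    and \<kappa>_finite: "(\<integral>\<^sup>+\<omega>. of_nat (\<kappa> \<omega>) \<partial>r) < \<infinity>"
    and \<nu>_prob_algebra: "\<nu> \<in> space (prob_algebra borel)"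
    and T_\<nu>: "T_map r borel \<gamma> \<nu> = \<nu>"
begin

abbreviation "R \<equiv> normalized r"
abbreviation "tree_mark \<equiv> \<Pi>\<^sub>M i\<in>(UNIV::nat list set). R"
abbreviation "tree_leaf \<equiv> \<Pi>\<^sub>M i\<in>(UNIV::nat list set). \<nu>"

lemma \<nu>_prob: "prob_space \<nu>" and sets_\<nu> [measurable_cong, simp]: "sets \<nu> = sets borel"
  using \<nu>_prob_algebra by (auto simp: space_prob_algebra)

lemma space_\<nu> [simp]: "space \<nu> = UNIV"
  using sets_eq_imp_space_eq[OF sets_\<nu>] by simp

lemma measurable_\<nu> [simp]: "measurable \<nu> N = measurable borel N"
  by (intro measurable_cong_sets) simp_all

lemma sets_R [measurable_cong, simp]: "sets R = sets borel"
  by (simp add: normalized_def sets_r)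

lemma space_R [simp]: "space R = UNIV"
  using sets_eq_imp_space_eq[OF sets_R] by simp

lemma R_prob: "prob_space R"
proof
  have "emeasure r (space r) \<noteq> \<infinity>" using finite_measure.emeasure_finite[OF finite_r] by simp
  then have "inverse (emeasure r (space r)) * emeasure r (space r) = 1"
    using r_nonzero by (simp add: mult.commute ennreal_divide_self less_top zero_less_iff_neq_zero flip: divide_ennreal_def)
  then show "emeasure R (space R) = 1"
    by (simp add: normalized_def space_scale_measure)
qed

sublocale R: prob_space R by (rule R_prob)
sublocale \<nu>: prob_space \<nu> by (rule \<nu>_prob)
sublocale tree_mark: prob_space tree_mark by (intro prob_space_PiM R_prob)
sublocale tree_leaf: prob_space tree_leaf by (intro prob_space_PiM \<nu>_prob)

lemma \<kappa>_measurable [measurable]: "\<kappa> \<in> measurable R (count_space UNIV)"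
  using \<kappa>_borel by simp

lemma \<gamma>_measurable [measurable]:
  "(\<lambda>(\<omega>, x). \<gamma> \<omega> x) \<in> borel_measurable (R \<Otimes>\<^sub>M (iid borel))"
proof -
  have "sets (R \<Otimes>\<^sub>M (iid borel)) = sets (borel \<Otimes>\<^sub>M (\<Pi>\<^sub>M i\<in>(UNIV::nat set). (borel::'s measure)))"
    by (intro sets_pair_measure_cong) auto
  then show ?thesis using \<gamma>_borel measurable_cong_sets by blast
qed

lemma integrable_\<kappa>: "integrable R (\<lambda>\<omega>. real (\<kappa> \<omega>))"
proof (rule integrableI_nonneg)
  have "(\<integral>\<^sup>+ x. ennreal (real (\<kappa> x)) \<partial>R) = inverse (emeasure r (space r)) * (\<integral>\<^sup>+\<omega>. of_nat (\<kappa> \<omega>) \<partial>r)"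
    unfolding normalized_def
    by (subst nn_integral_scale_measure) (use \<kappa>_borel sets_r in \<open>auto simp: ennreal_of_nat_eq_real_of_nat cong: measurable_cong_sets\<close>)
  also have "\<dots> < \<infinity>"
    using \<kappa>_finite r_nonzero by (simp add: ennreal_mult_less_top less_top[symmetric] ennreal_mult_eq_top_iff ennreal_inverse_eq_top_iff zero_less_iff_neq_zero)
  finally show "(\<integral>\<^sup>+ x. ennreal (real (\<kappa> x)) \<partial>R) < \<infinity>" .
qed auto

text \<open>Marks and leaves are indexed by all words over the naturals, so that every subtree is
  again an object of the same type; \<open>tree_eval_cong\<close> later confines attention to the
  words of \<open>tree d\<close>.\<close>

primrec tree_eval :: "nat \<Rightarrow> (nat list \<Rightarrow> 'o) \<Rightarrow> (nat list \<Rightarrow> 's) \<Rightarrow> 's" where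
  "tree_eval 0 \<theta> b = b []"
| "tree_eval (Suc k) \<theta> b = \<gamma> (\<theta> []) (\<lambda>j. tree_eval k (\<lambda>i. \<theta> (j # i)) (\<lambda>i. b (j # i)))"

lemma measurable_tree_eval [measurable]:
  "(\<lambda>(\<theta>, b). tree_eval k \<theta> b) \<in> borel_measurable (tree_mark \<Otimes>\<^sub>M tree_leaf)"
proof (induction k)
  case 0
  show ?case by simp
next
  case (Suc k)
  have s: "(\<lambda>z. (\<lambda>i. fst z (j # i), \<lambda>i. snd z (j # i))) \<in> measurable (tree_mark \<Otimes>\<^sub>M tree_leaf) (tree_mark \<Otimes>\<^sub>M tree_leaf)" for j
    by (intro measurable_Pair measurable_compose[OF measurable_fst measurable_subtree]
        measurable_compose[OF measurable_snd measurable_subtree])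
  have [measurable]: "(\<lambda>z j. tree_eval k (\<lambda>i. fst z (j # i)) (\<lambda>i. snd z (j # i))) \<in> measurable (tree_mark \<Otimes>\<^sub>M tree_leaf) (iid borel)"
    using measurable_compose[OF s Suc] by (intro measurable_PiM_single') auto
  have "(\<lambda>z. (fst z [], \<lambda>j. tree_eval k (\<lambda>i. fst z (j # i)) (\<lambda>i. snd z (j # i)))) \<in> measurable (tree_mark \<Otimes>\<^sub>M tree_leaf) (R \<Otimes>\<^sub>M (iid borel))"
    by measurable
  from measurable_compose[OF this \<gamma>_measurable] show ?case by (simp add: split_beta')
qed

text \<open>In a recursive tree process the values at depth k are i.i.d. of law \<nu> and
  independent of the marks above them, so integrating out the leaves yields the conditional mean
  given those marks.\<close>

definition cond_mean :: "nat \<Rightarrow> ('s \<Rightarrow> real) \<Rightarrow> (nat list \<Rightarrow> 'o) \<Rightarrow> real"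
  where "cond_mean k h \<theta> = (\<integral>b. h (tree_eval k \<theta> b) \<partial>tree_leaf)"

definition explained :: "nat \<Rightarrow> ('s \<Rightarrow> real) \<Rightarrow> real"
  where "explained k h = (\<integral>\<theta>. (cond_mean k h \<theta>)\<^sup>2 \<partial>tree_mark)"

lemma measurable_cond_mean [measurable]:
  assumes [measurable]: "h \<in> borel_measurable borel"
  shows "cond_mean k h \<in> borel_measurable tree_mark"
  unfolding cond_mean_def by measurable

lemma cond_mean_bound:
  assumes "\<And>x. \<bar>h x\<bar> \<le> C"
  shows "\<bar>cond_mean k h \<theta>\<bar> \<le> C"
  unfolding cond_mean_def
  using assms order.trans[OF abs_ge_zero assms] by (intro abs_integral_le_bound tree_leaf.prob_space_axioms)

abbreviation "marks \<equiv> \<Pi>\<^sub>M j\<in>(UNIV::nat set). tree_mark"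
abbreviation "leaves \<equiv> \<Pi>\<^sub>M j\<in>(UNIV::nat set). tree_leaf"

sublocale marks: prob_space marks by (intro prob_space_PiM tree_mark.prob_space_axioms)
sublocale leaves: prob_space leaves by (intro prob_space_PiM tree_leaf.prob_space_axioms)

lemma measurable_tree_evals [measurable]:
  "(\<lambda>(\<Theta>, b). (\<lambda>j. tree_eval k (\<Theta> j) (b j))) \<in> measurable (marks \<Otimes>\<^sub>M leaves) (iid borel)"
  using measurable_componentwise[OF measurable_tree_eval, of fst "marks \<Otimes>\<^sub>M leaves" snd k]
  by (simp add: split_beta')

lemma \<gamma>_measurable_snd [measurable]: "\<gamma> \<omega> \<in> borel_measurable (iid borel)"
  using measurable_compose[OF measurable_Pair1' \<gamma>_measurable, of \<omega>] by simp

lemma depends_on_first_\<gamma>: "depends_on_first (\<kappa> \<omega>) (\<lambda>x. h (\<gamma> \<omega> x))"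
  unfolding depends_on_first_def using \<gamma>_cong by metis

lemma cond_mean_Suc:
  assumes [measurable]: "h \<in> borel_measurable borel" and b: "\<And>x. \<bar>h x\<bar> \<le> C"
    and \<Theta>: "\<Theta> \<in> space marks"
  shows "cond_mean (Suc k) h (tree_join \<omega> \<Theta>)
    = (\<integral>b. h (\<gamma> \<omega> (\<lambda>j. tree_eval k (\<Theta> j) (b j))) \<partial>leaves)"
proof -
  have "tree_join \<omega> \<Theta> \<in> space tree_mark"
    using \<Theta> by (auto simp: space_PiM PiE_iff tree_join_def split: list.split)
  from measurable_compose[OF measurable_Pair1'[OF this] measurable_tree_eval[of "Suc k"]]
  have [measurable]: "tree_eval (Suc k) (tree_join \<omega> \<Theta>) \<in> borel_measurable tree_leaf"
    by (simp only: prod.case)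
  have "cond_mean (Suc k) h (tree_join \<omega> \<Theta>)
    = (\<integral>s. \<integral>b. h (tree_eval (Suc k) (tree_join \<omega> \<Theta>) (tree_join s b)) \<partial>leaves \<partial>\<nu>)"
    unfolding cond_mean_def
    by (rule integral_PiM_tree[OF \<nu>_prob, of _ C]) (use b in \<open>simp_all del: tree_eval.simps\<close>)
  \<comment> \<open>At depth \<open>Suc k\<close> the leaf at the root is never read, so its
    integral is trivial.\<close>
  then show ?thesis using \<nu>.prob_space by simp
qed

lemma explained_Suc:
  assumes [measurable]: "h \<in> borel_measurable borel" and b: "\<And>x. \<bar>h x\<bar> \<le> C"
  shows "explained (Suc k) h
    = (\<integral>\<omega>. \<integral>\<Theta>. (\<integral>b. h (\<gamma> \<omega> (\<lambda>j. tree_eval k (\<Theta> j) (b j))) \<partial>leaves)\<^sup>2 \<partial>marks \<partial>R)"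
proof -
  have "explained (Suc k) h = (\<integral>\<omega>. \<integral>\<Theta>. (cond_mean (Suc k) h (tree_join \<omega> \<Theta>))\<^sup>2 \<partial>marks \<partial>R)"
    unfolding explained_def
    by (rule integral_PiM_tree[OF R_prob, of _ "C\<^sup>2"])
      (use cond_mean_bound[OF b] in \<open>auto intro!: power2_le_iff_abs_le[THEN iffD2] order.trans[OF abs_ge_zero b]\<close>)
  also have "\<dots> = (\<integral>\<omega>. \<integral>\<Theta>. (\<integral>b. h (\<gamma> \<omega> (\<lambda>j. tree_eval k (\<Theta> j) (b j))) \<partial>leaves)\<^sup>2 \<partial>marks \<partial>R)"
    by (intro Bochner_Integration.integral_cong refl) (simp add: cond_mean_Suc[OF assms])
  finally show ?thesis .
qed

lemma nvariate_measurable: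
  assumes s: "sets \<mu> = sets (power_space n)"
  shows "(\<lambda>(\<omega>, x). nvariate n \<gamma> \<omega> x) \<in> measurable (R \<Otimes>\<^sub>M (iid \<mu>)) (power_space n)"
  unfolding nvariate_def split_beta'
proof (rule measurable_restrict)
  fix m assume m: "m \<in> {..<n}"
  have [measurable]: "(\<lambda>y. y m) \<in> borel_measurable \<mu>"
    using m s by (intro coordinate_measurable) auto
  have [measurable]: "(\<lambda>x. (\<lambda>i. snd x i m)) \<in> measurable (R \<Otimes>\<^sub>M (iid \<mu>)) (iid borel)"
    by (rule measurable_PiM_single') auto
  show "(\<lambda>x. \<gamma> (fst x) (\<lambda>i. snd x i m)) \<in> borel_measurable (R \<Otimes>\<^sub>M (iid \<mu>))"
    by measurable
qed

lemma integral_Tn_map: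
  fixes \<phi> :: "(nat \<Rightarrow> 's) \<Rightarrow> real"
  assumes \<mu>: "\<mu> \<in> space (prob_algebra (power_space n))"
    and \<phi>: "\<phi> \<in> borel_measurable (power_space n)" and b: "\<And>x. \<bar>\<phi> x\<bar> \<le> C"
  shows "(\<integral>x. \<phi> x \<partial>Tn_map r \<gamma> n \<mu>)
    = (\<integral>\<omega>. \<integral>x. \<phi> (nvariate n \<gamma> \<omega> x) \<partial>(iid \<mu>) \<partial>R)"
proof -
  have s: "sets \<mu> = sets (power_space n)" and p: "prob_space \<mu>" using \<mu> by (auto simp: space_prob_algebra)
  have "(\<integral>x. \<phi> x \<partial>Tn_map r \<gamma> n \<mu>) = (\<integral>z. \<phi> (case z of (\<omega>, x) \<Rightarrow> nvariate n \<gamma> \<omega> x) \<partial>(R \<Otimes>\<^sub>M (iid \<mu>)))"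
    unfolding Tn_map_def T_map_def by (rule integral_distr[OF nvariate_measurable[OF s] \<phi>])
  also have "\<dots> = (\<integral>\<omega>. \<integral>x. \<phi> (nvariate n \<gamma> \<omega> x) \<partial>(iid \<mu>) \<partial>R)"
    by (subst integral_pair_bounded_fst[OF R_prob prob_space_PiM
          measurable_compose[OF nvariate_measurable[OF s] \<phi>], of C]) (use b p in auto)
  finally show ?thesis .
qed

text \<open>
  Quadratic forms in a pair of functions, rather than \<open>\<integral> f x * f y \<mu>(dx, dy)\<close>, make domination stable
  under products without assuming that \<open>\<mu>\<close> is symmetric or positive definite.
\<close>

definition dominates :: "nat \<Rightarrow> real \<Rightarrow> (nat \<Rightarrow> 's) measure \<Rightarrow> nat \<Rightarrow> nat \<Rightarrow> bool"
  where "dominates k \<epsilon> \<mu> m m' \<longleftrightarrow>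
    (\<forall>f\<in>borel_measurable borel. \<forall>g\<in>borel_measurable borel.
      (\<forall>x. \<bar>f x\<bar> \<le> 1) \<longrightarrow> (\<forall>x. \<bar>g x\<bar> \<le> 1) \<longrightarrow>
      (\<integral>x. (f (x m) + g (x m'))\<^sup>2 \<partial>\<mu>) \<ge> explained k (\<lambda>x. f x + g x) - \<epsilon>)"

text \<open>Jensen's inequality. No marks are seen at depth 0, so \<open>explained 0 h\<close> is
  the squared mean of h under \<nu>, and the mean of \<open>f (x m) + g (x m')\<close> involves the
  two marginals only.\<close>

lemma dominates_0:
  assumes \<mu>: "\<mu> \<in> probs_with_marginals n \<nu>" and m: "m < n" "m' < n"
  shows "dominates 0 0 \<mu> m m'"
  unfolding dominates_def
proof (intro ballI impI)
  fix f g :: "'s \<Rightarrow> real"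
  assume [measurable]: "f \<in> borel_measurable borel" "g \<in> borel_measurable borel"
    and b: "\<forall>x. \<bar>f x\<bar> \<le> 1" "\<forall>x. \<bar>g x\<bar> \<le> 1"
  have p: "prob_space \<mu>" and s[measurable_cong]: "sets \<mu> = sets (power_space n)"
    and marg: "distr \<mu> borel (\<lambda>x. x m) = \<nu>" "distr \<mu> borel (\<lambda>x. x m') = \<nu>"
    using \<mu> m by (auto simp: probs_with_marginals_def space_prob_algebra)
  have [measurable]: "(\<lambda>x. x m) \<in> borel_measurable \<mu>" "(\<lambda>x. x m') \<in> borel_measurable \<mu>"
    using m s by (auto intro: coordinate_measurable)
  have c: "cond_mean 0 h \<theta> = (\<integral>x. h x \<partial>\<nu>)" if [measurable]: "h \<in> borel_measurable borel" for h \<theta>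
  proof -
    interpret product_prob_space "\<lambda>_. \<nu>" "UNIV :: nat list set" ..
    have "(\<integral>x. h x \<partial>\<nu>) = (\<integral>x. h x \<partial>distr tree_leaf \<nu> (\<lambda>x. x []))"
      by (subst PiM_component) auto
    also have "\<dots> = cond_mean 0 h \<theta>"
      unfolding cond_mean_def by (subst integral_distr) auto
    finally show ?thesis by simp
  qed
  have i: "integrable \<mu> (\<lambda>x. f (x m))" "integrable \<mu> (\<lambda>x. g (x m'))"
    "integrable \<nu> f" "integrable \<nu> g"
    using b p by (auto intro!: integrable_bounded_real[of _ _ 1] \<nu>_prob)
  have "explained 0 (\<lambda>x. f x + g x) = (\<integral>x. f x + g x \<partial>\<nu>)\<^sup>2"
    by (simp add: explained_def c tree_mark.prob_space)
  also have "(\<integral>x. f x + g x \<partial>\<nu>) = (\<integral>x. f x \<partial>\<nu>) + (\<integral>x. g x \<partial>\<nu>)"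
    using i by simp
  also have "(\<integral>x. f x \<partial>\<nu>) = (\<integral>x. f (x m) \<partial>\<mu>)"
    by (subst marg(1)[symmetric], subst integral_distr) auto
  also have "(\<integral>x. g x \<partial>\<nu>) = (\<integral>x. g (x m') \<partial>\<mu>)"
    by (subst marg(2)[symmetric], subst integral_distr) auto
  also have "(\<integral>x. f (x m) \<partial>\<mu>) + (\<integral>x. g (x m') \<partial>\<mu>) = (\<integral>x. f (x m) + g (x m') \<partial>\<mu>)"
    using i by simp
  also have "\<dots>\<^sup>2 \<le> (\<integral>x. (f (x m) + g (x m'))\<^sup>2 \<partial>\<mu>)"
    using b by (intro square_integral_le_integral_square[OF p, of _ 2]) (auto intro!: abs_add_le_2)
  finally show "explained 0 (\<lambda>x. f x + g x) - 0 \<le> (\<integral>x. (f (x m) + g (x m'))\<^sup>2 \<partial>\<mu>)" by simp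
qed

text \<open>For fixed \<omega> the product bound applies to f and g composed with
  \<open>\<gamma> \<omega>\<close>, the shared part being the marks of the child subtrees and the
  averaged part their leaves. Its error is \<kappa> \<omega> times \<epsilon>; integrating over
  \<omega> gives the mean.\<close>

lemma dominates_Tn_map:
  assumes \<mu>: "\<mu> \<in> space (prob_algebra (power_space n))" and m: "m < n" "m' < n"
    and d: "dominates k \<epsilon> \<mu> m m'"
  shows "dominates (Suc k) ((\<integral>\<omega>. real (\<kappa> \<omega>) \<partial>R) * \<epsilon>) (Tn_map r \<gamma> n \<mu>) m m'"
  unfolding dominates_def
proof (intro ballI impI)
  fix f g :: "'s \<Rightarrow> real"
  assume [measurable]: "f \<in> borel_measurable borel" "g \<in> borel_measurable borel"
    and b: "\<forall>x. \<bar>f x\<bar> \<le> 1" "\<forall>x. \<bar>g x\<bar> \<le> 1"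
  have p: "prob_space \<mu>" and s[measurable_cong]: "sets \<mu> = sets (power_space n)"
    using \<mu> by (auto simp: space_prob_algebra)
  interpret S: prob_space "iid \<mu>" using p by (intro prob_space_PiM)
  have [measurable]: "(\<lambda>x. x m) \<in> borel_measurable \<mu>" "(\<lambda>x. x m') \<in> borel_measurable \<mu>"
    using m s by (auto intro: coordinate_measurable)
  let ?L = "\<lambda>\<omega>. \<integral>\<Theta>. (\<integral>b. f (\<gamma> \<omega> (\<lambda>j. tree_eval k (\<Theta> j) (b j))) + g (\<gamma> \<omega> (\<lambda>j. tree_eval k (\<Theta> j) (b j))) \<partial>leaves)\<^sup>2 \<partial>marks"
  let ?U = "\<lambda>\<omega>. \<integral>x. (f (\<gamma> \<omega> (\<lambda>i. x i m)) + g (\<gamma> \<omega> (\<lambda>i. x i m')))\<^sup>2 \<partial>(iid \<mu>)"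
  have le: "?L \<omega> - real (\<kappa> \<omega>) * \<epsilon> \<le> ?U \<omega>" for \<omega>
    using iid_product_lower_bound[OF tree_mark.prob_space_axioms tree_leaf.prob_space_axioms p,
        where G="\<lambda>(\<theta>, b). tree_eval k \<theta> b" and p="\<lambda>x. x m" and q="\<lambda>x. x m'" and \<epsilon>=\<epsilon>
          and f="\<lambda>x. f (\<gamma> \<omega> x)" and g="\<lambda>x. g (\<gamma> \<omega> x)" and j="\<kappa> \<omega>"] b d
    by (simp add: depends_on_first_\<gamma> dominates_def explained_def cond_mean_def)
  have "explained (Suc k) (\<lambda>x. f x + g x) = (\<integral>\<omega>. ?L \<omega> \<partial>R)"
    using b by (intro explained_Suc[of _ 2]) (auto intro!: abs_add_le_2)
  moreover have "integrable R ?L"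
    using b by (intro integrable_bounded_real[OF R_prob, of _ 4])
      (auto intro!: integral_le_bound[OF marks.prob_space_axioms] power2_le_4
        abs_integral_le_bound[OF leaves.prob_space_axioms] abs_add_le_2)
  ultimately have "explained (Suc k) (\<lambda>x. f x + g x) - (\<integral>\<omega>. real (\<kappa> \<omega>) \<partial>R) * \<epsilon>
      = (\<integral>\<omega>. ?L \<omega> - real (\<kappa> \<omega>) * \<epsilon> \<partial>R)"
    using integrable_\<kappa> by simp
  also have "\<dots> \<le> (\<integral>\<omega>. ?U \<omega> \<partial>R)"
  proof (intro integral_mono le)
    show "integrable R (\<lambda>\<omega>. ?L \<omega> - real (\<kappa> \<omega>) * \<epsilon>)"
      using \<open>integrable R ?L\<close> integrable_\<kappa> by simp
    have [measurable]: "(\<lambda>x. (\<lambda>i. snd x i l)) \<in> measurable (R \<Otimes>\<^sub>M (iid \<mu>)) (iid borel)"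
      if "(\<lambda>x. x l) \<in> borel_measurable \<mu>" for l
      using that by (intro measurable_PiM_single') auto
    show "integrable R ?U"
      using b by (intro integrable_bounded_real[OF R_prob, of _ 4])
        (auto intro!: integral_le_bound[OF S.prob_space_axioms] power2_sum_le_4)
  qed
  also have "\<dots> = (\<integral>x. (f (x m) + g (x m'))\<^sup>2 \<partial>Tn_map r \<gamma> n \<mu>)"
    using b m by (subst integral_Tn_map[OF \<mu>, of _ 4]) (auto intro!: power2_sum_le_4 simp: nvariate_def)
  finally show "explained (Suc k) (\<lambda>x. f x + g x) - (\<integral>\<omega>. real (\<kappa> \<omega>) \<partial>R) * \<epsilon>
    \<le> (\<integral>x. (f (x m) + g (x m'))\<^sup>2 \<partial>Tn_map r \<gamma> n \<mu>)" .
qed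

end

section \<open>The mean-field equation\<close>

text \<open>The linear counterpart of \<open>iid_product_lower_bound\<close>, again by exchanging
  one coordinate at a time. A one-sided bound is enough because f may be replaced by - f; with
  \<epsilon> = 0 it identifies integrals.\<close>

lemma iid_product_marginal_bound:
  fixes \<nu> :: "'s::topological_space measure" and \<mu> :: "'m measure"
  assumes \<nu>: "prob_space \<nu>" and s[measurable_cong]: "sets \<nu> = sets borel" and \<mu>: "prob_space \<mu>"
    and p[measurable]: "p \<in> borel_measurable \<mu>"
    and bound: "\<And>f. f \<in> borel_measurable borel \<Longrightarrow> (\<And>x. \<bar>f x\<bar> \<le> 1) \<Longrightarrow> (\<integral>x. f x \<partial>\<nu>) - (\<integral>x. f (p x) \<partial>\<mu>) \<le> \<epsilon>"
  assumes "f \<in> borel_measurable (iid borel)" "\<And>x. \<bar>f x\<bar> \<le> (1::real)" "depends_on_first j f"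
  shows "(\<integral>x. f x \<partial>(\<Pi>\<^sub>M i\<in>UNIV. \<nu>)) - (\<integral>x. f (\<lambda>i. p (x i)) \<partial>(iid \<mu>)) \<le> real j * \<epsilon>"
  using assms(6-)
proof (induction j arbitrary: f)
  case 0
  interpret SM: prob_space "iid \<mu>" using \<mu> by (intro prob_space_PiM)
  interpret SN: prob_space "iid \<nu>" using \<nu> by (intro prob_space_PiM)
  have *: "f = (\<lambda>_. f undefined)"
    using depends_on_first_0[OF 0(3)] by blast
  show ?case by (subst (1 2) *) (simp add: SM.prob_space SN.prob_space)
next
  case (Suc j)
  note [measurable] = Suc.prems(1)
  note b = Suc.prems(2)
  let ?SM = "iid \<mu>" and ?SN = "iid \<nu>"
  interpret \<mu>: prob_space \<mu> by fact
  interpret SM: prob_space ?SM using \<mu> by (intro prob_space_PiM)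
  interpret SN: prob_space ?SN using \<nu> by (intro prob_space_PiM)
  define P where "P x = (\<lambda>i::nat. p (x i))" for x
  have [measurable]: "P \<in> measurable ?SM (iid borel)"
    unfolding P_def by (rule measurable_PiM_single'; simp add: space_PiM)
  have P_cn: "P (case_nat a w) = case_nat (p a) (P w)" for a w
    by (auto simp: P_def split: nat.split)
  define A where "A a = (\<integral>w. f (case_nat a w) \<partial>?SN)" for a
  have [measurable]: "A \<in> borel_measurable borel"
    unfolding A_def by measurable
  have bA: "\<bar>A a\<bar> \<le> 1" for a
    unfolding A_def by (intro abs_integral_le_bound SN.prob_space_axioms b) simp
  have IH: "A (p a) - real j * \<epsilon> \<le> (\<integral>w. f (P (case_nat a w)) \<partial>?SM)" for a
    using Suc.IH[of "\<lambda>w. f (case_nat (p a) w)"] b depends_on_first_case_nat[OF Suc.prems(3)]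
    unfolding P_cn unfolding A_def P_def by simp
  have "(\<integral>x. f x \<partial>?SN) - \<epsilon> - real j * \<epsilon> = (\<integral>a. A a \<partial>\<nu>) - \<epsilon> - real j * \<epsilon>"
    unfolding A_def by (subst integral_PiM_nat_fst[OF \<nu>, of _ 1]) (auto simp: b)
  also have "\<dots> \<le> (\<integral>a. A (p a) \<partial>\<mu>) - real j * \<epsilon>"
    using bound[of A] bA by simp
  also have "\<dots> = (\<integral>a. A (p a) - real j * \<epsilon> \<partial>\<mu>)"
    using integrable_bounded_real[OF \<mu>, of "\<lambda>a. A (p a)" 1] bA by (simp add: \<mu>.prob_space)
  also have "\<dots> \<le> (\<integral>a. \<integral>w. f (P (case_nat a w)) \<partial>?SM \<partial>\<mu>)"
  proof (intro integral_mono IH)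
    show "integrable \<mu> (\<lambda>a. A (p a) - real j * \<epsilon>)"
      using integrable_bounded_real[OF \<mu>, of "\<lambda>a. A (p a)" 1] bA by simp
    show "integrable \<mu> (\<lambda>a. \<integral>w. f (P (case_nat a w)) \<partial>?SM)"
      by (intro integrable_bounded_real[OF \<mu>, of _ 1]) (auto intro!: abs_integral_le_bound[OF SM.prob_space_axioms] b)
  qed
  also have "\<dots> = (\<integral>x. f (P x) \<partial>?SM)"
    by (subst integral_PiM_nat_fst[OF \<mu>, of _ 1]) (auto simp: b)
  finally show ?case unfolding P_def by (simp add: algebra_simps)
qed

text \<open>Gronwall: \<open>exp (c * s) * (a s - l)\<close> has derivative
  \<open>c * exp (c * s) * (b s - l)\<close>, which is nonnegative as long as b stays above
  l.\<close>

lemma relaxation_lower_bound: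
  fixes a b :: "real \<Rightarrow> real"
  assumes d: "\<And>t. t \<ge> 0 \<Longrightarrow> (a has_real_derivative c * (b t - a t)) (at t within {0..})"
    and c: "c \<ge> 0" and t: "0 \<le> t0" "t0 \<le> t" and l: "\<And>s. t0 \<le> s \<Longrightarrow> s \<le> t \<Longrightarrow> l \<le> b s"
  shows "l - exp (- (c * (t - t0))) * (l - a t0) \<le> a t"
proof -
  define e where "e s = exp (c * s) * (a s - l)" for s
  have de: "(e has_real_derivative (c * exp (c * s) * (b s - l))) (at s within {0..})" if "s \<ge> 0" for s
  proof -
    have "((\<lambda>s. exp (c * s)) has_real_derivative exp (c * s) * c) (at s within {0..})"
      by (auto intro!: derivative_eq_intros)
    from DERIV_mult[OF this DERIV_diff[OF d[OF that] DERIV_const[of l]]]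
    show ?thesis unfolding e_def by (simp add: algebra_simps)
  qed
  have "e t0 \<le> e t"
  proof (rule DERIV_nonneg_imp_increasing_open[OF t(2)])
    fix s assume s: "t0 < s" "s < t"
    then have "at s within {0..} = at s" using t by (intro at_within_interior) auto
    then have "(e has_real_derivative (c * exp (c * s) * (b s - l))) (at s)" using de[of s] s t by simp
    moreover have "0 \<le> c * exp (c * s) * (b s - l)" using c l[of s] s by simp
    ultimately show "\<exists>y. (e has_real_derivative y) (at s) \<and> 0 \<le> y" by blast
  next
    have "continuous_on {0..} e"
      using de DERIV_continuous_on[of "{0..}" e "\<lambda>s. c * exp (c * s) * (b s - l)"] by simp
    then show "continuous_on {t0..t} e" using t by (auto intro: continuous_on_subset)
  qed
  then have "exp (- (c * t)) * e t0 \<le> exp (- (c * t)) * e t" by (simp add: mult_left_mono)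
  moreover have "exp (- (c * t)) * e t = a t - l"
  proof -
    have "exp (- (c * t)) * exp (c * t) = 1" by (simp flip: exp_add)
    then show ?thesis by (simp add: e_def flip: mult.assoc)
  qed
  moreover have "exp (- (c * t)) * e t0 = exp (- (c * (t - t0))) * (a t0 - l)"
  proof -
    have "exp (- (c * t)) * exp (c * t0) = exp (- (c * (t - t0)))"
      by (simp add: right_diff_distrib flip: exp_add)
    then show ?thesis by (simp add: e_def flip: mult.assoc)
  qed
  ultimately have "exp (- (c * (t - t0))) * (a t0 - l) \<le> a t - l" by simp
  then show ?thesis by (simp only: right_diff_distrib)
qed

context rde
begin

abbreviation "rate \<equiv> measure r (space r)"
definition "mean_\<kappa> = (\<integral>\<omega>. real (\<kappa> \<omega>) \<partial>R)"

lemma rate_pos: "rate > 0"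
  using r_nonzero finite_measure.emeasure_eq_measure[OF finite_r, of "space r"]
  by (auto simp: order_less_le)

lemma mean_\<kappa>_nonneg: "mean_\<kappa> \<ge> 0"
  by (simp add: mean_\<kappa>_def)

lemma mean_field_derivative:
  assumes sol: "mean_field_solution r \<gamma> n \<mu>" and \<phi>: "\<phi> \<in> borel_measurable (power_space n)"
    and b: "\<And>x. \<bar>\<phi> x\<bar> \<le> C" and t: "t \<ge> 0"
  shows "((\<lambda>s. \<integral>x. \<phi> x \<partial>\<mu> s) has_real_derivative
    rate * ((\<integral>x. \<phi> x \<partial>Tn_map r \<gamma> n (\<mu> t)) - (\<integral>x. \<phi> x \<partial>\<mu> t))) (at t within {0..})"
proof -
  have "bounded (\<phi> ` space (power_space n))" using b by (auto simp: bounded_iff)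
  then show ?thesis using sol \<phi> t unfolding mean_field_solution_def by fastforce
qed

lemma integral_\<nu>_eq:
  assumes [measurable]: "f \<in> borel_measurable borel" and b: "\<And>x. \<bar>f x\<bar> \<le> (C::real)"
  shows "(\<integral>x. f x \<partial>\<nu>) = (\<integral>\<omega>. \<integral>x. f (\<gamma> \<omega> x) \<partial>(iid \<nu>) \<partial>R)"
proof -
  let ?S = "iid \<nu>"
  have g: "(\<lambda>(\<omega>, x). \<gamma> \<omega> x) \<in> borel_measurable (R \<Otimes>\<^sub>M ?S)"
    using \<gamma>_measurable
    by (subst measurable_cong_sets[OF sets_pair_measure_cong[OF refl sets_PiM_cong] refl]) auto
  have "(\<integral>x. f x \<partial>\<nu>) = (\<integral>x. f x \<partial>T_map r borel \<gamma> \<nu>)" by (simp add: T_\<nu>)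
  also have "\<dots> = (\<integral>z. f (case z of (\<omega>, x) \<Rightarrow> \<gamma> \<omega> x) \<partial>(R \<Otimes>\<^sub>M ?S))"
    unfolding T_map_def by (rule integral_distr[OF g]) simp
  also have "\<dots> = (\<integral>\<omega>. \<integral>x. f (\<gamma> \<omega> x) \<partial>?S \<partial>R)"
    using b by (subst integral_pair_bounded_fst[OF R_prob prob_space_PiM[OF \<nu>_prob] measurable_compose[OF g assms(1)], of C]) auto
  finally show ?thesis .
qed

text \<open>Both integrals become averages over \<omega>, the first because \<nu> is a fixed point;
  for fixed \<omega> only the law of the \<kappa> \<omega> arguments read by \<gamma>
  differs.\<close>

lemma Tn_map_marginal_bound:
  assumes \<mu>: "\<mu> \<in> space (prob_algebra (power_space n))" and m: "m < n"
    and bound: "\<And>f. f \<in> borel_measurable borel \<Longrightarrow> (\<And>x. \<bar>f x\<bar> \<le> 1) \<Longrightarrow> (\<integral>x. f x \<partial>\<nu>) - (\<integral>x. f (x m) \<partial>\<mu>) \<le> \<epsilon>"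
    and f[measurable]: "f \<in> borel_measurable borel" and b: "\<And>x. \<bar>f x\<bar> \<le> 1"
  shows "(\<integral>x. f x \<partial>\<nu>) - (\<integral>x. f (x m) \<partial>Tn_map r \<gamma> n \<mu>) \<le> mean_\<kappa> * \<epsilon>"
proof -
  have p: "prob_space \<mu>" and s[measurable_cong]: "sets \<mu> = sets (power_space n)"
    using \<mu> by (auto simp: space_prob_algebra)
  let ?SM = "iid \<mu>" and ?SN = "iid \<nu>"
  interpret SM: prob_space ?SM using p by (intro prob_space_PiM)
  interpret SN: prob_space ?SN using \<nu>_prob by (intro prob_space_PiM)
  have [measurable]: "(\<lambda>x. x m) \<in> borel_measurable \<mu>"
    using m s by (auto intro: coordinate_measurable)
  let ?L = "\<lambda>\<omega>. \<integral>x. f (\<gamma> \<omega> x) \<partial>?SN"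
  let ?U = "\<lambda>\<omega>. \<integral>x. f (\<gamma> \<omega> (\<lambda>i. x i m)) \<partial>?SM"
  have le: "?L \<omega> - ?U \<omega> \<le> real (\<kappa> \<omega>) * \<epsilon>" for \<omega>
    using b by (intro iid_product_marginal_bound[OF \<nu>_prob _ p, where f="\<lambda>x. f (\<gamma> \<omega> x)"])
      (auto simp: depends_on_first_\<gamma> bound)
  have [measurable]: "(\<lambda>x. (\<lambda>i. snd x i m)) \<in> measurable (R \<Otimes>\<^sub>M ?SM) (iid borel)"
    by (intro measurable_PiM_single') auto
  have i: "integrable R ?L" "integrable R ?U"
    using b by (auto intro!: integrable_bounded_real[OF R_prob, of _ 1]
        abs_integral_le_bound[OF SN.prob_space_axioms] abs_integral_le_bound[OF SM.prob_space_axioms])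
  have "(\<integral>x. f x \<partial>\<nu>) - (\<integral>x. f (x m) \<partial>Tn_map r \<gamma> n \<mu>) = (\<integral>\<omega>. ?L \<omega> \<partial>R) - (\<integral>\<omega>. ?U \<omega> \<partial>R)"
    using b m by (subst integral_Tn_map[OF \<mu>, of _ 1], simp, simp, subst integral_\<nu>_eq[of f 1]) (auto simp: nvariate_def)
  also have "\<dots> = (\<integral>\<omega>. ?L \<omega> - ?U \<omega> \<partial>R)" using i by simp
  also have "\<dots> \<le> (\<integral>\<omega>. real (\<kappa> \<omega>) * \<epsilon> \<partial>R)"
    using i integrable_\<kappa> by (intro integral_mono le) auto
  finally show ?thesis using integrable_\<kappa> by (simp add: mean_\<kappa>_def)
qed

text \<open>The marginal solves the one-variate equation, of which \<nu> is a constant solution. On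
  an interval short enough for the equation to contract, any bound on the error that is uniform in f
  and s can be halved, so the error vanishes.\<close>

lemma mean_field_marginal_step:
  assumes sol: "mean_field_solution r \<gamma> n \<mu>" and m: "m < n" and t0: "t0 \<ge> 0"
    and marg: "distr (\<mu> t0) borel (\<lambda>x. x m) = \<nu>"
    and t: "t0 \<le> t" "2 * rate * (mean_\<kappa> + 1) * (t - t0) \<le> 1"
  shows "distr (\<mu> t) borel (\<lambda>x. x m) = \<nu>"
proof -
  \<comment> \<open>If the error is at most E up to time s, the equation improves this to
    \<open>mean_\<kappa> * E * rate * (s - t0)\<close>, which is at most E / 2 under this condition.
    The summand 1 prevents a division by zero in the step length chosen later.\<close>
  let ?ok = "\<lambda>s. t0 \<le> s \<and> 2 * rate * (mean_\<kappa> + 1) * (s - t0) \<le> 1"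
  have \<mu>: "\<mu> s \<in> space (prob_algebra (power_space n))" if "s \<ge> 0" for s
    using sol that by (auto simp: mean_field_solution_def)
  have p: "prob_space (\<mu> s)" and [measurable_cong]: "sets (\<mu> s) = sets (power_space n)" if "s \<ge> 0" for s
    using \<mu>[OF that] by (auto simp: space_prob_algebra)
  have [measurable]: "(\<lambda>x. x m) \<in> borel_measurable (\<mu> s)" if "s \<ge> 0" for s
    using m that \<mu> by (auto intro!: coordinate_measurable simp: space_prob_algebra)
  have [measurable]: "(\<lambda>x. x m) \<in> borel_measurable (power_space n)"
    using m by (intro coordinate_measurable) auto
  have halving: "(\<integral>x. f x \<partial>\<nu>) - (\<integral>x. f (x m) \<partial>\<mu> s) \<le> 2 * (1 / 2) ^ i"
    if "f \<in> borel_measurable borel" "\<And>x. \<bar>f x\<bar> \<le> 1" "?ok s" for i s and f :: "'s \<Rightarrow> real"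
    using that
  proof (induction i arbitrary: f s)
    case 0
    have "\<bar>\<integral>x. f x \<partial>\<nu>\<bar> \<le> 1"
      by (rule abs_integral_le_bound[OF \<nu>_prob]) (use 0 in auto)
    moreover have "\<bar>\<integral>x. f (x m) \<partial>\<mu> s\<bar> \<le> 1"
      by (rule abs_integral_le_bound[OF p]) (use 0 t0 in auto)
    ultimately show ?case by (simp add: abs_le_iff)
  next
    case (Suc i)
    note [measurable] = Suc.prems(1)
    let ?E = "2 * (1 / 2 :: real) ^ i"
    let ?x = "rate * (s - t0)"
    have "(\<integral>x. f x \<partial>\<nu>) - mean_\<kappa> * ?E - exp (- (rate * (s - t0))) * ((\<integral>x. f x \<partial>\<nu>) - mean_\<kappa> * ?E - (\<integral>x. f (x m) \<partial>\<mu> t0)) \<le> (\<integral>x. f (x m) \<partial>\<mu> s)"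
    proof (rule relaxation_lower_bound[where b="\<lambda>s. \<integral>x. f (x m) \<partial>Tn_map r \<gamma> n (\<mu> s)"])
      show "((\<lambda>s. \<integral>x. f (x m) \<partial>\<mu> s) has_real_derivative
         rate * ((\<integral>x. f (x m) \<partial>Tn_map r \<gamma> n (\<mu> t)) - (\<integral>x. f (x m) \<partial>\<mu> t))) (at t within {0..})" if "0 \<le> t" for t
        using Suc.prems that by (intro mean_field_derivative[OF sol, of _ 1]) auto
      fix u assume u: "t0 \<le> u" "u \<le> s"
      then have "2 * rate * (mean_\<kappa> + 1) * (u - t0) \<le> 2 * rate * (mean_\<kappa> + 1) * (s - t0)"
        using rate_pos mean_\<kappa>_nonneg by (intro mult_left_mono) auto
      then have "?ok u" using u Suc.prems(3) by simp
      then have "(\<integral>x. f x \<partial>\<nu>) - (\<integral>x. f (x m) \<partial>Tn_map r \<gamma> n (\<mu> u)) \<le> mean_\<kappa> * ?E"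
        using t0 u by (intro Tn_map_marginal_bound[OF \<mu> m Suc.IH Suc.prems(1,2)]) auto
      then show "(\<integral>x. f x \<partial>\<nu>) - mean_\<kappa> * ?E \<le> (\<integral>x. f (x m) \<partial>Tn_map r \<gamma> n (\<mu> u))"
        by simp
    qed (use rate_pos t0 Suc.prems in auto)
    \<comment> \<open>At time t0 the marginal is exactly \<nu>, so the damped initial gap cancels
      against the error except for the factor 1 - exp (- x).\<close>
    also have "(\<integral>x. f (x m) \<partial>\<mu> t0) = (\<integral>x. f x \<partial>\<nu>)"
      using t0 by (subst marg[symmetric], subst integral_distr) auto
    finally have "(\<integral>x. f x \<partial>\<nu>) - (\<integral>x. f (x m) \<partial>\<mu> s) \<le> mean_\<kappa> * ?E * (1 - exp (- ?x))"
      by (simp add: algebra_simps)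
    also have "\<dots> \<le> mean_\<kappa> * ?E * ?x"
      using exp_ge_add_one_self[of "- ?x"] mean_\<kappa>_nonneg by (intro mult_left_mono) auto
    also have "\<dots> \<le> ?E * (1 / 2)"
    proof -
      have "mean_\<kappa> * ?x \<le> (mean_\<kappa> + 1) * ?x"
        using rate_pos Suc.prems(3) by (intro mult_right_mono) auto
      also have "\<dots> \<le> 1 / 2" using Suc.prems(3) by (simp add: algebra_simps)
      finally have "?E * (mean_\<kappa> * ?x) \<le> ?E * (1 / 2)" by (intro mult_left_mono) auto
      then show ?thesis by (simp only: mult_ac)
    qed
    finally show ?case by simp
  qed
  have le0: "(\<integral>x. f x \<partial>\<nu>) - (\<integral>x. f (x m) \<partial>\<mu> t) \<le> 0"
    if f: "f \<in> borel_measurable borel" "\<And>x. \<bar>f x\<bar> \<le> 1" for f :: "'s \<Rightarrow> real"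
  proof (rule LIMSEQ_le_const)
    show "(\<lambda>i. 2 * (1 / 2 :: real) ^ i) \<longlonglongrightarrow> 0"
      using tendsto_mult_right[OF LIMSEQ_power_zero[of "1/2 :: real"], of 2] by simp
  qed (use halving[OF f] t in blast)
  show ?thesis
  proof (rule measure_eqI)
    fix A assume "A \<in> sets (distr (\<mu> t) borel (\<lambda>x. x m))"
    then have A[measurable]: "A \<in> sets borel" by simp
    interpret \<mu>t: prob_space "\<mu> t" using p t t0 by auto
    have "\<mu>t.prob {x \<in> space (\<mu> t). x m \<in> A} = (\<integral>x. indicator {x \<in> space (\<mu> t). x m \<in> A} x \<partial>\<mu> t)"
      by (simp add: Int_absorb2)
    also have "\<dots> = (\<integral>x. indicator A (x m) \<partial>\<mu> t)"
      by (intro Bochner_Integration.integral_cong) (auto simp: indicator_def)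
    \<comment> \<open>The one-sided bound for the indicator and for its negative gives
      equality.\<close>
    also have "\<dots> = (\<integral>x. indicator A x \<partial>\<nu>)"
      using le0[of "indicator A"] le0[of "\<lambda>x. - indicator A x"] by (auto simp: indicator_def[abs_def])
    also have "\<dots> = measure \<nu> A" by simp
    finally show "emeasure (distr (\<mu> t) borel (\<lambda>x. x m)) A = emeasure \<nu> A"
      using t t0 by (subst emeasure_distr) (auto simp: \<nu>.emeasure_eq_measure \<mu>t.emeasure_eq_measure vimage_def Int_def conj_commute)
  qed simp
qed

lemma mean_field_marginals:
  assumes sol: "mean_field_solution r \<gamma> n \<mu>" and \<mu>0: "\<mu> 0 \<in> probs_with_marginals n \<nu>" and t: "t \<ge> 0"
  shows "\<mu> t \<in> probs_with_marginals n \<nu>"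
proof -
  \<comment> \<open>The admissible step length does not depend on where the step starts, so finitely
    many steps reach any t.\<close>
  define h where "h = 1 / (2 * rate * (mean_\<kappa> + 1))"
  have h: "h > 0" unfolding h_def using rate_pos mean_\<kappa>_nonneg by (intro divide_pos_pos mult_pos_pos) auto
  have "distr (\<mu> t) borel (\<lambda>x. x m) = \<nu>" if m: "m < n" for m
  proof -
    have "distr (\<mu> s) borel (\<lambda>x. x m) = \<nu>" if "0 \<le> s" "s \<le> real i * h" for i s
      using that
    proof (induction i arbitrary: s)
      case 0
      then show ?case using \<mu>0 m by (simp add: probs_with_marginals_def)
    next
      case (Suc i)
      show ?case
      proof (cases "s \<le> real i * h")
        case False
        then have "s - real i * h \<le> h" using Suc.prems by (simp add: algebra_simps)
        then have "2 * rate * (mean_\<kappa> + 1) * (s - real i * h) \<le> 2 * rate * (mean_\<kappa> + 1) * h"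
          using rate_pos mean_\<kappa>_nonneg by (intro mult_left_mono) auto
        also have "\<dots> = 1" using rate_pos mean_\<kappa>_nonneg by (simp add: h_def add_nonneg_eq_0_iff)
        finally show ?thesis
          using h False by (intro mean_field_marginal_step[OF sol m _ Suc.IH[of "real i * h"]]) auto
      qed (use Suc in auto)
    qed
    moreover obtain i where "t / h \<le> real i" using real_arch_simple by blast
    ultimately show ?thesis using t h by (simp add: pos_divide_le_eq)
  qed
  then show ?thesis using sol t by (auto simp: probs_with_marginals_def mean_field_solution_def)
qed

text \<open>Once the solution dominates depth k, its image under \<open>Tn_map\<close> dominates
  depth \<open>Suc k\<close>, and the solution relaxes towards that image exponentially fast. The
  waiting time is uniform in f and g because the quantities to be compared are bounded by constants
  independent of them.\<close>

lemma eventually_dominates: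
  assumes sol: "mean_field_solution r \<gamma> n \<mu>" and \<mu>0: "\<mu> 0 \<in> probs_with_marginals n \<nu>"
    and m: "m < n" "m' < n" and \<epsilon>: "\<epsilon> > 0"
  shows "\<forall>\<^sub>F t in at_top. dominates k \<epsilon> (\<mu> t) m m'"
proof -
  have "\<exists>t0\<ge>0. \<forall>t\<ge>t0. dominates k \<epsilon> (\<mu> t) m m'"
    using \<epsilon>
  proof (induction k arbitrary: \<epsilon>)
    case 0
    have "dominates 0 \<epsilon> (\<mu> t) m m'" if "t \<ge> 0" for t
      using dominates_0[OF mean_field_marginals[OF sol \<mu>0 that] m] 0
      unfolding dominates_def by fastforce
    then show ?case by auto
  next
    case (Suc k)
    \<comment> \<open>Half of \<epsilon> is reserved for the error inherited from depth k, the other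
      half for the decaying gap left at time t0.\<close>
    define \<delta> where "\<delta> = \<epsilon> / (2 * (mean_\<kappa> + 1))"
    have "\<delta> > 0" using Suc.prems mean_\<kappa>_nonneg by (simp add: \<delta>_def)
    from Suc.IH[OF this] obtain t0 where t0: "t0 \<ge> 0" "\<And>t. t \<ge> t0 \<Longrightarrow> dominates k \<delta> (\<mu> t) m m'" by blast
    have "mean_\<kappa> * \<delta> = \<epsilon> / 2 * (mean_\<kappa> / (mean_\<kappa> + 1))"
      by (simp add: \<delta>_def)
    also have "\<dots> \<le> \<epsilon> / 2 * 1"
      using mean_\<kappa>_nonneg Suc.prems by (intro mult_left_mono) (auto simp: divide_le_eq_1)
    finally have \<delta>: "mean_\<kappa> * \<delta> \<le> \<epsilon> / 2" by simp
    \<comment> \<open>At t1 the damping factor is \<open>1 / (8 / \<epsilon> + 1)\<close>, so a gap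
      of at most 4 has shrunk to at most \<epsilon> / 2.\<close>
    define t1 where "t1 = t0 + ln (8 / \<epsilon> + 1) / rate"
    have t01: "t0 \<le> t1" using rate_pos Suc.prems by (simp add: t1_def)
    have "dominates (Suc k) \<epsilon> (\<mu> t) m m'" if t: "t \<ge> t1" for t
      unfolding dominates_def
    proof (intro ballI impI)
      fix f g :: "'s \<Rightarrow> real"
      assume f[measurable]: "f \<in> borel_measurable borel" and g[measurable]: "g \<in> borel_measurable borel"
        and b: "\<forall>x. \<bar>f x\<bar> \<le> 1" "\<forall>x. \<bar>g x\<bar> \<le> 1"
      let ?\<phi> = "\<lambda>x. (f (x m) + g (x m'))\<^sup>2"
      let ?l = "explained (Suc k) (\<lambda>x. f x + g x) - mean_\<kappa> * \<delta>"
      have [measurable]: "(\<lambda>x. x m) \<in> borel_measurable (power_space n)" "(\<lambda>x. x m') \<in> borel_measurable (power_space n)"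
        using m by (auto intro!: coordinate_measurable)
      have "?l - exp (- (rate * (t - t0))) * (?l - (\<integral>x. ?\<phi> x \<partial>\<mu> t0)) \<le> (\<integral>x. ?\<phi> x \<partial>\<mu> t)"
      proof (rule relaxation_lower_bound[where b="\<lambda>s. \<integral>x. ?\<phi> x \<partial>Tn_map r \<gamma> n (\<mu> s)"])
        show "((\<lambda>s. \<integral>x. ?\<phi> x \<partial>\<mu> s) has_real_derivative
           rate * ((\<integral>x. ?\<phi> x \<partial>Tn_map r \<gamma> n (\<mu> s)) - (\<integral>x. ?\<phi> x \<partial>\<mu> s))) (at s within {0..})" if "0 \<le> s" for s
          using b that by (intro mean_field_derivative[OF sol, of _ 4]) (auto intro!: power2_sum_le_4)
        fix s assume s: "t0 \<le> s" "s \<le> t"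
        then have "\<mu> s \<in> space (prob_algebra (power_space n))"
          using sol t0 by (auto simp: mean_field_solution_def)
        from dominates_Tn_map[OF this m t0(2)[OF s(1)]] f g b
        show "?l \<le> (\<integral>x. ?\<phi> x \<partial>Tn_map r \<gamma> n (\<mu> s))"
          unfolding dominates_def mean_\<kappa>_def by simp
      qed (use rate_pos t0 t t01 in auto)
      moreover have "exp (- (rate * (t - t0))) * (?l - (\<integral>x. ?\<phi> x \<partial>\<mu> t0)) \<le> \<epsilon> / 2"
      proof -
        have "explained (Suc k) (\<lambda>x. f x + g x) \<le> 4"
          unfolding explained_def using b
          by (intro integral_le_bound[OF tree_mark.prob_space_axioms] power2_le_4 cond_mean_bound) (auto intro!: abs_add_le_2)
        moreover have "0 \<le> mean_\<kappa> * \<delta>" "0 \<le> (\<integral>x. ?\<phi> x \<partial>\<mu> t0)"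
          using \<open>\<delta> > 0\<close> mean_\<kappa>_nonneg by simp_all
        ultimately have "?l - (\<integral>x. ?\<phi> x \<partial>\<mu> t0) \<le> 4"
          by linarith
        then have "exp (- (rate * (t - t0))) * (?l - (\<integral>x. ?\<phi> x \<partial>\<mu> t0)) \<le> exp (- (rate * (t - t0))) * 4"
          by (intro mult_left_mono) auto
        also have "\<dots> \<le> exp (- ln (8 / \<epsilon> + 1)) * 4"
          using t rate_pos by (simp add: t1_def field_simps)
        also have "\<dots> = 4 / (8 / \<epsilon> + 1)"
          using Suc.prems by (simp add: exp_minus inverse_eq_divide add_pos_pos)
        also have "\<dots> \<le> \<epsilon> / 2" using Suc.prems by (simp add: field_simps)
        finally show ?thesis .
      qed
      ultimately show "explained (Suc k) (\<lambda>x. f x + g x) - \<epsilon> \<le> (\<integral>x. ?\<phi> x \<partial>\<mu> t)"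
        using \<delta> by simp
    qed
    then show ?case using t01 t0(1) by (intro exI[of _ t1]) auto
  qed
  then show ?thesis unfolding eventually_at_top_linorder by blast
qed

end

section \<open>Concentration near the diagonal and weak convergence\<close>

lemma (in prob_space) integral_indicator_combination:
  assumes "A \<in> events" "B \<in> events" "C \<in> events"
  shows "(\<integral>x. indicator A x + indicator B x + 2 * indicator C x \<partial>M) = prob A + prob B + 2 * prob C"
  using assms by (simp add: sets.Int_space_eq2 emeasure_eq_measure)

text \<open>Composed with restriction, h is continuous on all sequences, where the product sigma
  algebra is the Borel one by second countability. A point of \<open>power_space n\<close> is padded
  with \<open>undefined\<close> to reach that space.\<close>

lemma continuous_map_power_space_measurable:
  fixes h :: "(nat \<Rightarrow> 's::polish_space) \<Rightarrow> real"
  assumes h: "continuous_map (product_topology (\<lambda>_. euclidean) {..<n}) euclideanreal h"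
  shows "h \<in> borel_measurable (power_space n)"
proof -
  have "continuous_map (product_topology (\<lambda>_. euclidean) UNIV) (product_topology (\<lambda>_. euclidean) {..<n})
      (\<lambda>x :: nat \<Rightarrow> 's. restrict x {..<n})"
    by (auto simp: continuous_map_componentwise intro!: continuous_map_product_projection)
  from continuous_map_compose[OF this h]
  have "continuous_on UNIV (\<lambda>x. h (restrict x {..<n}))"
    by (simp add: euclidean_product_topology comp_def)
  then have *: "(\<lambda>x. h (restrict x {..<n})) \<in> borel_measurable (iid borel)"
    using borel_measurable_continuous_onI measurable_cong_sets[OF sets_PiM_equal_borel refl] by blast
  have "(\<lambda>x i. if i < n then x i else undefined) \<in> measurable (power_space n) (\<Pi>\<^sub>M i\<in>UNIV. (borel :: 's measure))"
  proof (rule measurable_PiM_single')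
    fix i show "(\<lambda>x. if i < n then x i else undefined) \<in> borel_measurable (power_space n)"
      by (cases "i < n") auto
  qed auto
  from measurable_compose[OF this *]
  have "(\<lambda>x. h (restrict (\<lambda>i. if i < n then x i else undefined) {..<n})) \<in> borel_measurable (power_space n)" .
  also have "?this \<longleftrightarrow> ?thesis"
    by (intro measurable_cong arg_cong[where f=h]) (auto simp: space_PiM PiE_iff extensional_def restrict_def fun_eq_iff)
  finally show ?thesis .
qed

text \<open>Continuity gives an open box around the diagonal point; intersecting its finitely many
  sides gives one open set for all coordinates.\<close>

lemma continuous_map_near_diagonal:
  fixes h :: "(nat \<Rightarrow> 's::polish_space) \<Rightarrow> real"
  assumes h: "continuous_map (product_topology (\<lambda>_. euclidean) {..<n}) euclideanreal h" and \<epsilon>: "\<epsilon> > 0"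
  shows "\<exists>B. open B \<and> s \<in> B \<and> (\<forall>x\<in>space (power_space n). (\<forall>m<n. x m \<in> B) \<longrightarrow> \<bar>h x - h (\<lambda>m\<in>{..<n}. s)\<bar> < \<epsilon>)"
proof -
  let ?d = "\<lambda>m\<in>{..<n}. s"
  let ?T = "product_topology (\<lambda>_. euclidean :: 's topology) {..<n}"
  let ?U = "{x \<in> topspace ?T. h x \<in> ball (h ?d) \<epsilon>}"
  have "openin ?T ?U"
    by (rule openin_continuous_map_preimage[OF h]) simp
  moreover have "?d \<in> ?U" using \<epsilon> by simp
  ultimately obtain V where V: "?d \<in> (\<Pi>\<^sub>E i\<in>{..<n}. V i)" "\<And>i. open (V i)" "(\<Pi>\<^sub>E i\<in>{..<n}. V i) \<subseteq> ?U"
    using product_topology_open_contains_basis[of "\<lambda>_. euclidean" "{..<n}" ?U ?d] by auto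
  show ?thesis
  proof (intro exI conjI ballI impI)
    show "open (\<Inter>m<n. V m)" using V(2) by auto
    show "s \<in> (\<Inter>m<n. V m)" using V(1) by (auto simp: PiE_iff)
    fix x assume "x \<in> space (power_space n)" "\<forall>m<n. x m \<in> (\<Inter>m<n. V m)"
    then have "x \<in> (\<Pi>\<^sub>E i\<in>{..<n}. V i)" by (auto simp: space_PiM PiE_iff)
    then have "h x \<in> ball (h ?d) \<epsilon>" using V(3) by blast
    then show "\<bar>h x - h ?d\<bar> < \<epsilon>" by (simp add: dist_real_def abs_minus_commute)
  qed
qed

context rde
begin

lemma explained_scale: "explained k (\<lambda>x. c * h x) = c\<^sup>2 * explained k h"
  by (simp add: explained_def cond_mean_def power_mult_distrib)

text \<open>With f = g = \<open>1_A\<close> the quadratic form is 2 \<nu> A plus twice the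
  probability that both coordinates lie in A, while domination bounds it below by almost 4 \<nu> A.
  The upper bound is the marginal condition.\<close>

lemma mean_field_pair_concentrates:
  assumes sol: "mean_field_solution r \<gamma> n \<mu>" and \<mu>0: "\<mu> 0 \<in> probs_with_marginals n \<nu>"
    and m: "m < n" "m' < n" and A[measurable]: "A \<in> sets borel"
    and lim: "(\<lambda>k. explained k (indicator A)) \<longlonglongrightarrow> measure \<nu> A"
  shows "((\<lambda>t. measure (\<mu> t) {x \<in> space (power_space n). x m \<in> A \<and> x m' \<in> A}) \<longlongrightarrow> measure \<nu> A) at_top"
proof (rule order_tendstoI)
  let ?f = "indicator A :: 's \<Rightarrow> real"
  let ?E = "{x \<in> space (power_space n). x m \<in> A \<and> x m' \<in> A}"
  have cm[measurable]: "(\<lambda>x. x m) \<in> borel_measurable (power_space n)" "(\<lambda>x. x m') \<in> borel_measurable (power_space n)"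
    using m by (auto intro!: coordinate_measurable)
  have E[measurable]: "?E \<in> sets (power_space n)" by measurable
  have F: "measure (\<mu> t) {x \<in> space (power_space n). x l \<in> A} = measure \<nu> A"
    "prob_space (\<mu> t)" "sets (\<mu> t) = sets (power_space n)" "space (\<mu> t) = space (power_space n)"
    if t: "t \<ge> 0" and l: "l < n" for t l
  proof -
    have marg: "distr (\<mu> t) borel (\<lambda>x. x l) = \<nu>"
      and p: "prob_space (\<mu> t)" and s: "sets (\<mu> t) = sets (power_space n)"
      using mean_field_marginals[OF sol \<mu>0 t] l by (auto simp: probs_with_marginals_def space_prob_algebra)
    show "prob_space (\<mu> t)" "sets (\<mu> t) = sets (power_space n)" by fact+
    show sp: "space (\<mu> t) = space (power_space n)" using sets_eq_imp_space_eq[OF s] .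
    have "measure \<nu> A = measure (distr (\<mu> t) borel (\<lambda>x. x l)) A" by (simp add: marg)
    also have "\<dots> = measure (\<mu> t) {x \<in> space (power_space n). x l \<in> A}"
      using l s by (subst measure_distr) (auto intro!: coordinate_measurable arg_cong[where f="measure (\<mu> t)"] simp: sp)
    finally show "measure (\<mu> t) {x \<in> space (power_space n). x l \<in> A} = measure \<nu> A" by simp
  qed
  {
    fix a assume a: "measure \<nu> A < a"
    have "measure (\<mu> t) ?E < a" if "t \<ge> 0" for t
    proof -
      interpret \<mu>t: prob_space "\<mu> t" using F(2)[OF that m(1)] .
      have "measure (\<mu> t) ?E \<le> measure (\<mu> t) {x \<in> space (power_space n). x m \<in> A}"
        by (rule \<mu>t.finite_measure_mono) (auto simp: F(3)[OF that m(1)])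
      then show ?thesis using F(1)[OF that m(1)] a by simp
    qed
    then show "\<forall>\<^sub>F t in at_top. measure (\<mu> t) ?E < a"
      unfolding eventually_at_top_linorder by blast
  next
    fix a assume a: "a < measure \<nu> A"
    \<comment> \<open>The choice of k loses 4 e and domination another e; halving leaves a
      probability of at least \<nu> A - 5 e / 2, which exceeds a = \<nu> A - 4 e.\<close>
    define e where "e = (measure \<nu> A - a) / 4"
    have e: "e > 0" using a by (simp add: e_def)
    obtain k where k: "explained k ?f > measure \<nu> A - e"
      using order_tendstoD(1)[OF lim, of "measure \<nu> A - e"] e by (auto simp: eventually_sequentially)
    have "a < measure (\<mu> t) ?E" if t: "t \<ge> 0" and d: "dominates k e (\<mu> t) m m'" for t
    proof -
      interpret \<mu>t: prob_space "\<mu> t" using F(2)[OF t m(1)] .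
      note [measurable_cong] = F(3)[OF t m(1)]
      let ?I = "\<lambda>l. indicator {x \<in> space (power_space n). x l \<in> A} :: (nat \<Rightarrow> 's) \<Rightarrow> real"
      have "4 * (measure \<nu> A - e) - e \<le> explained k (\<lambda>x. ?f x + ?f x) - e"
        using k explained_scale[of k 2 ?f] by simp
      also have "\<dots> \<le> (\<integral>x. (?f (x m) + ?f (x m'))\<^sup>2 \<partial>\<mu> t)"
        by (rule d[unfolded dominates_def, rule_format]) (simp_all add: indicator_le_1)
      also have "\<dots> = (\<integral>x. ?I m x + ?I m' x + 2 * indicator ?E x \<partial>\<mu> t)"
        by (intro Bochner_Integration.integral_cong) (auto simp: indicator_def F(4)[OF t m(1)])
      also have "\<dots> = measure \<nu> A + measure \<nu> A + 2 * measure (\<mu> t) ?E"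
        unfolding F(1)[OF t m(1), symmetric] F(1)[OF t m(2), symmetric]
        by (subst \<mu>t.integral_indicator_combination) (auto simp: F(1)[OF t m(1)] F(1)[OF t m(2)])
      finally show ?thesis using e by (simp add: e_def field_simps)
    qed
    note claim = this
    show "\<forall>\<^sub>F t in at_top. a < measure (\<mu> t) ?E"
      using eventually_dominates[OF sol \<mu>0 m e, of k] eventually_ge_at_top[of "0::real"]
      by eventually_elim (rule claim)
  }
qed

text \<open>A union bound over the pairs (0, m): given that coordinate 0 is in A, each coordinate
  leaves A with small probability. The tolerance e / (n + 1) keeps the sum of n errors strictly
  below e.\<close>

lemma mean_field_all_concentrate:
  assumes sol: "mean_field_solution r \<gamma> n \<mu>" and \<mu>0: "\<mu> 0 \<in> probs_with_marginals n \<nu>"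
    and n: "n \<ge> 1" and A[measurable]: "A \<in> sets borel"
    and lim: "(\<lambda>k. explained k (indicator A)) \<longlonglongrightarrow> measure \<nu> A" and e: "e > 0"
  shows "\<forall>\<^sub>F t in at_top. measure \<nu> A - e < measure (\<mu> t) {x \<in> space (power_space n). \<forall>m<n. x m \<in> A}"
proof -
  let ?P = "\<lambda>m. {x \<in> space (power_space n). x 0 \<in> A \<and> x m \<in> A}"
  let ?Q = "{x \<in> space (power_space n). \<forall>m<n. x m \<in> A}"
  have 0: "0 < n" using n by simp
  have cm[measurable]: "m < n \<Longrightarrow> (\<lambda>x. x m) \<in> borel_measurable (power_space n)" for m
    by (auto intro!: coordinate_measurable)
  have P[measurable]: "m < n \<Longrightarrow> ?P m \<in> sets (power_space n)" for m
    using cm[OF 0] cm by measurable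
  have Q[measurable]: "?Q \<in> sets (power_space n)"
  proof -
    have "?Q = (\<Inter>m\<in>{..<n}. ?P m)" using 0 by fastforce
    also have "\<dots> \<in> sets (power_space n)" using 0 by (intro sets.finite_INT) (auto intro!: P simp: lessThan_empty_iff)
    finally show ?thesis .
  qed
  have "\<forall>\<^sub>F t in at_top. \<forall>m\<in>{..<n}. measure \<nu> A - e / real (n + 1) < measure (\<mu> t) (?P m)"
    using n e by (subst eventually_ball_finite_distrib)
      (auto intro!: order_tendstoD(1)[OF mean_field_pair_concentrates[OF sol \<mu>0 _ _ A lim]])
  moreover have "\<forall>\<^sub>F t in at_top. (0::real) \<le> t" by (rule eventually_ge_at_top)
  ultimately show ?thesis
  proof eventually_elim
    case (elim t)
    have p: "prob_space (\<mu> t)" and s[measurable_cong]: "sets (\<mu> t) = sets (power_space n)"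
      and marg: "distr (\<mu> t) borel (\<lambda>x. x 0) = \<nu>"
      using mean_field_marginals[OF sol \<mu>0 elim(2)] n by (auto simp: probs_with_marginals_def space_prob_algebra)
    interpret \<mu>t: prob_space "\<mu> t" by fact
    have sp: "space (\<mu> t) = space (power_space n)" using sets_eq_imp_space_eq[OF s] .
    let ?A = "{x \<in> space (power_space n). x 0 \<in> A}"
    have A0: "?A \<in> sets (\<mu> t)" using cm[OF 0] by measurable
    have "measure \<nu> A = measure (distr (\<mu> t) borel (\<lambda>x. x 0)) A" by (simp add: marg)
    also have "\<dots> = measure (\<mu> t) ?A"
      using coordinate_measurable[OF 0 s] by (subst measure_distr) (auto intro!: arg_cong[where f="measure (\<mu> t)"] simp: sp)
    finally have \<nu>A: "measure (\<mu> t) ?A = measure \<nu> A" by simp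
    have "measure \<nu> A - measure (\<mu> t) ?Q = measure (\<mu> t) (?A - ?Q)"
      using n A0 by (subst \<mu>t.finite_measure_Diff) (auto simp: \<nu>A s)
    also have "?A - ?Q = (\<Union>m\<in>{..<n}. ?A - ?P m)" by auto
    also have "measure (\<mu> t) \<dots> \<le> (\<Sum>m\<in>{..<n}. measure (\<mu> t) (?A - ?P m))"
      using A0 P by (intro \<mu>t.finite_measure_subadditive_finite) (auto simp: s)
    also have "\<dots> = (\<Sum>m\<in>{..<n}. measure \<nu> A - measure (\<mu> t) (?P m))"
      using A0 P by (intro sum.cong refl) (subst \<mu>t.finite_measure_Diff, auto simp: \<nu>A s)
    also have "\<dots> \<le> (\<Sum>m\<in>{..<n}. e / real (n + 1))"
      using elim(1) by (intro sum_mono) (auto simp: less_imp_le algebra_simps)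
    also have "\<dots> = e * (real n / real (n + 1))" by simp
    also have "\<dots> < e * 1" using e by (intro mult_strict_left_mono) auto
    finally show ?case by simp
  qed
qed

text \<open>Coordinate 0 has law \<nu> at all times, so the limit integral is also the integral
  under \<open>\<mu> t\<close> of h at the diagonal point over \<open>x 0\<close>. It remains to
  compare h with this value pointwise, on a set of large mass where all coordinates share one small
  piece of a partition of S.\<close>

lemma mean_field_converges_to_diagonal:
  assumes sol: "mean_field_solution r \<gamma> n \<mu>" and \<mu>0: "\<mu> 0 \<in> probs_with_marginals n \<nu>" and n: "n \<ge> 1"
    and lim: "\<And>A. A \<in> sets borel \<Longrightarrow> (\<lambda>k. explained k (indicator A)) \<longlonglongrightarrow> measure \<nu> A"
  shows "weakly_converges n \<mu> (diagonal_law n \<nu>)"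
  unfolding weakly_converges_def
proof (intro allI impI; elim conjE)
  fix h :: "(nat \<Rightarrow> 's) \<Rightarrow> real"
  assume h: "continuous_map (product_topology (\<lambda>_. euclidean) {..<n}) euclideanreal h"
    and "bounded (h ` space (power_space n))"
  then obtain C where C: "\<And>x. x \<in> space (power_space n) \<Longrightarrow> \<bar>h x\<bar> \<le> C" by (auto simp: bounded_iff)
  let ?d = "\<lambda>s :: 's. \<lambda>m\<in>{..<n}. s"
  have d: "?d s \<in> space (power_space n)" for s by (auto simp: space_PiM)
  have d_meas[measurable]: "?d \<in> measurable borel (power_space n)" by (rule measurable_restrict) simp
  have C0: "0 \<le> C" using order.trans[OF abs_ge_zero C[OF d]] .
  note [measurable] = continuous_map_power_space_measurable[OF h]
  have 0: "0 < n" using n by simp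
  have c0[measurable]: "(\<lambda>x. x 0) \<in> borel_measurable (power_space n)" using 0 by (intro coordinate_measurable) auto
  \<comment> \<open>Off an exceptional set of mass at most 2 e the two integrands differ by at most
    2 e, and on it by at most 2 C.\<close>
  have close: "\<forall>\<^sub>F t in at_top. \<bar>(\<integral>x. h x \<partial>\<mu> t) - (\<integral>x. h x \<partial>diagonal_law n \<nu>)\<bar> \<le> 2 * e + 2 * C * (2 * e)" if e: "e > 0" for e
  proof -
    obtain B where B: "\<And>s. open (B s)" "\<And>s. s \<in> B s"
      "\<And>s x. x \<in> space (power_space n) \<Longrightarrow> (\<And>m. m < n \<Longrightarrow> x m \<in> B s) \<Longrightarrow> \<bar>h x - h (?d s)\<bar> < e"
      using continuous_map_near_diagonal[OF h e] by metis
    \<comment> \<open>The Lindelof property makes the cover countable, and disjointing it yields a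
      Borel partition, finitely many pieces of which carry \<nu>-mass above 1 - e.\<close>
    obtain F where F: "F \<subseteq> range B" "countable F" "\<Union>F = \<Union>(range B)"
      using Lindelof[of "range B"] B(1) by blast
    have "\<Union>F = UNIV" using B(2) F(3) by blast
    then have "F \<noteq> {}" by auto
    define b where "b = from_nat_into F"
    have rb: "range b = F" using F(2) \<open>F \<noteq> {}\<close> by (simp add: b_def range_from_nat_into)
    then have "\<exists>s. b i = B s" for i using F(1) by blast
    then obtain c where c: "\<And>i. b i = B (c i)" by metis
    have b_open: "open (b i)" for i by (simp add: c B)
    have b_cover: "(\<Union>i. b i) = UNIV" using rb \<open>\<Union>F = UNIV\<close> by simp
    have dis: "disjoint_family (disjointed b)" by (rule disjoint_family_disjointed)
    have dm[measurable]: "disjointed b i \<in> sets borel" for i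
      using b_open by (auto simp: disjointed_def intro!: sets.Diff)
    have "(\<lambda>i. measure \<nu> (disjointed b i)) sums measure \<nu> (\<Union>i. disjointed b i)"
      using dis by (intro \<nu>.finite_measure_UNION) auto
    then have "(\<lambda>N. \<Sum>i<N. measure \<nu> (disjointed b i)) \<longlonglongrightarrow> 1"
      using \<nu>.prob_space by (simp add: sums_def UN_disjointed_eq b_cover)
    from order_tendstoD(1)[OF this, of "1 - e"] e obtain N where N: "1 - e < (\<Sum>i<N. measure \<nu> (disjointed b i))"
      by (auto simp: eventually_sequentially)
    let ?Q = "\<lambda>i. {x \<in> space (power_space n). \<forall>m<n. x m \<in> disjointed b i}"
    have Q[measurable]: "?Q i \<in> sets (power_space n)" for i
    proof -
      have "?Q i = (\<Inter>m\<in>{..<n}. (\<lambda>x. x m) -` disjointed b i \<inter> space (power_space n))" using 0 by fastforce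
      also have "\<dots> \<in> sets (power_space n)"
        using 0 by (intro sets.finite_INT) (auto intro!: measurable_sets[OF coordinate_measurable] simp: lessThan_empty_iff)
      finally show ?thesis .
    qed
    \<comment> \<open>The N tolerances add up to at most e; with the e lost outside the first N
      pieces, a mass of at least 1 - 2 e remains.\<close>
    have "\<forall>\<^sub>F t in at_top. \<forall>i\<in>{..<N}. measure \<nu> (disjointed b i) - e / real (N + 1) < measure (\<mu> t) (?Q i)"
      using e by (subst eventually_ball_finite_distrib)
        (auto intro!: mean_field_all_concentrate[OF sol \<mu>0 n _ lim])
    moreover have "\<forall>\<^sub>F t in at_top. (0::real) \<le> t" by (rule eventually_ge_at_top)
    ultimately show ?thesis
    proof eventually_elim
      case (elim t)
      have p: "prob_space (\<mu> t)" and s[measurable_cong]: "sets (\<mu> t) = sets (power_space n)"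
        and marg: "distr (\<mu> t) borel (\<lambda>x. x 0) = \<nu>"
        using mean_field_marginals[OF sol \<mu>0 elim(2)] n by (auto simp: probs_with_marginals_def space_prob_algebra)
      interpret \<mu>t: prob_space "\<mu> t" by fact
      have sp: "space (\<mu> t) = space (power_space n)" using sets_eq_imp_space_eq[OF s] .
      define G where "G = (\<Union>i<N. ?Q i)"
      have "1 - 2 * e \<le> (\<Sum>i<N. measure \<nu> (disjointed b i)) - e * (real N / real (N + 1))"
      proof -
        have "e * (real N / real (N + 1)) \<le> e * 1" using e by (intro mult_left_mono) auto
        then show ?thesis using N by simp
      qed
      also have "\<dots> = (\<Sum>i<N. measure \<nu> (disjointed b i) - e / real (N + 1))"
        by (simp add: sum_subtractf)
      also have "\<dots> \<le> (\<Sum>i<N. measure (\<mu> t) (?Q i))"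
        using elim(1) by (intro sum_mono) (auto simp: less_imp_le)
      also have "\<dots> = measure (\<mu> t) G"
        unfolding G_def
      proof (rule \<mu>t.finite_measure_finite_Union[symmetric])
        show "disjoint_family_on ?Q {..<N}"
          using dis 0 unfolding disjoint_family_on_def by blast
      qed (auto simp: s)
      finally have GN: "1 - 2 * e \<le> measure (\<mu> t) G" .
      have G'[measurable]: "G \<in> sets (\<mu> t)" using s by (auto simp: G_def)
      define I where "I = (indicator G :: _ \<Rightarrow> real)"
      have I: "integrable (\<mu> t) I" "(\<integral>x. I x \<partial>\<mu> t) = measure (\<mu> t) G"
        using G' by (simp_all add: I_def sets.Int_space_eq2 \<mu>t.emeasure_eq_measure)
      have hd: "(\<integral>x. h x \<partial>diagonal_law n \<nu>) = (\<integral>x. h (?d (x 0)) \<partial>\<mu> t)"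
        unfolding diagonal_law_def
        by (subst integral_distr, simp, simp, subst marg[symmetric], subst integral_distr) auto
      have i: "integrable (\<mu> t) h" "integrable (\<mu> t) (\<lambda>x. h (?d (x 0)))"
        using C d by (auto intro!: integrable_bounded_real[OF p, of _ C] simp: sp)
      have pt: "\<bar>h x - h (?d (x 0))\<bar> \<le> 2 * e + 2 * C * (1 - I x)" if x: "x \<in> space (\<mu> t)" for x
      proof (cases "x \<in> G")
        case True
        then obtain i where i: "\<And>m. m < n \<Longrightarrow> x m \<in> disjointed b i" unfolding G_def by blast
        \<comment> \<open>Both x and the diagonal point over \<open>x 0\<close> are compared with
          the diagonal point over the common centre \<open>c i\<close>.\<close>
        have xm: "x m \<in> B (c i)" if "m < n" for m
          using i[OF that] disjointed_subset[of b i] c[of i] by blast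
        have "\<bar>h x - h (?d (c i))\<bar> < e" by (rule B(3)[OF x[unfolded sp] xm])
        moreover have "\<bar>h (?d (x 0)) - h (?d (c i))\<bar> < e" by (rule B(3)[OF d]) (use xm[OF 0] in simp)
        moreover have "I x = 1" unfolding I_def by (rule indicator_simps(1)[OF True])
        ultimately show ?thesis by simp
      next
        case False
        have "I x = 0" unfolding I_def by (rule indicator_simps(2)[OF False])
        moreover have "\<bar>h x\<bar> \<le> C" "\<bar>h (?d (x 0))\<bar> \<le> C" using C d x sp by blast+
        ultimately show ?thesis using e by (simp add: abs_le_iff)
      qed
      have "\<bar>(\<integral>x. h x \<partial>\<mu> t) - (\<integral>x. h x \<partial>diagonal_law n \<nu>)\<bar> = \<bar>\<integral>x. h x - h (?d (x 0)) \<partial>\<mu> t\<bar>"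
        using i by (simp add: hd)
      also have "\<dots> \<le> (\<integral>x. \<bar>h x - h (?d (x 0))\<bar> \<partial>\<mu> t)"
        using integral_abs_bound by blast
      also have "\<dots> \<le> (\<integral>x. 2 * e + 2 * C * (1 - I x) \<partial>\<mu> t)"
        using i I(1) by (intro integral_mono pt) auto
      also have "\<dots> = 2 * e + 2 * C * (1 - measure (\<mu> t) G)"
        using I \<mu>t.prob_space by simp
      also have "\<dots> \<le> 2 * e + 2 * C * (2 * e)"
        using GN C0 by (intro add_left_mono mult_left_mono) auto
      finally show ?case .
    qed
  qed
  show "((\<lambda>t. \<integral>x. h x \<partial>\<mu> t) \<longlongrightarrow> (\<integral>x. h x \<partial>diagonal_law n \<nu>)) at_top"
  proof (rule tendstoI)
    fix e :: real assume e: "e > 0"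
    define e' where "e' = e / (4 * (C + 1))"
    have e': "e' > 0" using e C0 by (simp add: e'_def)
    have "2 * e' + 2 * C * (2 * e') < e' * (4 * (C + 1))" using e' by (simp add: algebra_simps)
    also have "\<dots> = e" using C0 by (simp add: e'_def)
    finally have *: "2 * e' + 2 * C * (2 * e') < e" .
    show "\<forall>\<^sub>F t in at_top. dist (\<integral>x. h x \<partial>\<mu> t) (\<integral>x. h x \<partial>diagonal_law n \<nu>) < e"
      using close[OF e'] by eventually_elim (use * in \<open>simp add: dist_real_def\<close>)
  qed
qed

end

section \<open>Recursive tree processes\<close>

locale rtp = rde r \<gamma> \<kappa> \<nu>
  for r :: "'o::polish_space measure"
    and \<gamma> :: "'o \<Rightarrow> (nat \<Rightarrow> 's::polish_space) \<Rightarrow> 's"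
    and \<kappa> :: "'o \<Rightarrow> nat"
    and \<nu> :: "'s measure" +
  fixes d :: enat
    and M :: "'p measure"
    and W :: "nat list \<Rightarrow> 'p \<Rightarrow> 'o"
    and X :: "nat list \<Rightarrow> 'p \<Rightarrow> 's"
  assumes d_nonzero: "d \<noteq> 0" and \<kappa>_le_d: "\<And>\<omega>. enat (\<kappa> \<omega>) \<le> d"
    and rtp: "recursive_tree_process r \<gamma> \<nu> d M W X"
begin

sublocale M: prob_space M
  using rtp by (simp add: recursive_tree_process_def)

definition "below k = {i \<in> tree d. length i < k}"
definition "level k = {i \<in> tree d. length i = k}"
definition "marks_upto k p = (\<lambda>i\<in>below k. W i p)"
definition "values_at k p = (\<lambda>i\<in>level k. X i p)"

lemma below_subset: "below k \<subseteq> tree d" and level_subset: "level k \<subseteq> tree d"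
  by (auto simp: below_def level_def)

lemma Nil_in_below: "k \<ge> 1 \<Longrightarrow> [] \<in> below k"
  by (auto simp: below_def tree_def)

lemma level_nonempty: "level k \<noteq> {}"
proof -
  have "enat 0 < d" using d_nonzero by (simp add: enat_0)
  then have "replicate k 0 \<in> level k" by (auto simp: level_def tree_def)
  then show ?thesis by blast
qed

lemma W_measurable: "i \<in> tree d \<Longrightarrow> W i \<in> borel_measurable M"
  and X_measurable: "i \<in> tree d \<Longrightarrow> X i \<in> borel_measurable M"
  using rtp by (auto simp: recursive_tree_process_def)

lemma tree_take: "i \<in> tree d \<Longrightarrow> take l i \<in> tree d"
  by (auto simp: tree_def dest: in_set_takeD)

text \<open>For infinite d a whole generation is infinite and bounds no finite subtree. The defining
  conditions of the process are therefore used for finitely many words at a time, placed inside or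
  on the boundary of one finite subtree.\<close>

lemma finite_subtree_exists:
  assumes k: "k \<ge> 1" and I: "finite I" "I \<subseteq> below k" and J: "finite J" "J \<subseteq> level k"
  shows "\<exists>U. finite_rooted_subtree d U \<and> I \<subseteq> U \<and> J \<subseteq> tree_boundary d U"
proof -
  \<comment> \<open>Only prefixes shorter than k are taken: these include I itself and the parents
    of the words in J, but no word of length k.\<close>
  define U where "U = (\<lambda>(i, l). take l i) ` ((I \<union> J) \<times> {..<k}) \<union> {[]}"
  have len: "i \<in> U \<Longrightarrow> length i < k" for i using k I J by (auto simp: U_def below_def level_def)
  have "finite_rooted_subtree d U"
    unfolding finite_rooted_subtree_def
  proof (intro conjI allI impI)
    show "finite U" using I J by (auto simp: U_def)
    have "[] \<in> tree d" by (simp add: tree_def)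
    then show "U \<subseteq> tree d" using I J tree_take by (auto simp: U_def below_def level_def)
    show "[] \<in> U" by (simp add: U_def)
    fix i j assume "i @ [j] \<in> U"
    then obtain i' l where i': "i' \<in> I \<union> J" "l < k" "i @ [j] = take l i'" by (auto simp: U_def)
    have "i = take (length i) (i @ [j])" by simp
    also have "\<dots> = take (min (length i) l) i'" by (simp add: i'(3))
    finally have "i = take (min (length i) l) i'" .
    moreover have "min (length i) l < k" using i'(2) by simp
    ultimately show "i \<in> U" using i'(1) unfolding U_def by force
  qed
  moreover have "I \<subseteq> U"
  proof
    fix i assume i: "i \<in> I"
    then have "i = take (length i) i" "length i < k" using I(2) by (auto simp: below_def)
    then show "i \<in> U" using i unfolding U_def by force
  qed
  moreover have "J \<subseteq> tree_boundary d U"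
  proof
    fix i assume i: "i \<in> J"
    then have l: "length i = k" "i \<in> tree d" using J by (auto simp: level_def)
    have "i \<notin> U" using len l by blast
    moreover have "butlast i \<in> U" using l k i unfolding U_def butlast_conv_take by force
    moreover have "i \<noteq> []" using l k by auto
    ultimately show "i \<in> tree_boundary d U" using l by (simp add: tree_boundary_def)
  qed
  ultimately show ?thesis by blast
qed

lemma boundary_values:
  assumes "finite_rooted_subtree d U"
  shows "M.indep_vars (\<lambda>_. borel) X (tree_boundary d U)"
    and "i \<in> tree_boundary d U \<Longrightarrow> distr M borel (X i) = \<nu>"
    and "M.indep_set (sets (generated_by M (tree_boundary d U) X)) (sets (generated_by M U W))"
  using rtp assms by (auto simp: recursive_tree_process_def)

lemma marks_upto_measurable [measurable]: "marks_upto k \<in> measurable M (\<Pi>\<^sub>M i\<in>below k. borel)"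
  unfolding marks_upto_def using W_measurable below_subset by (intro measurable_restrict) auto

lemma values_at_measurable [measurable]: "values_at k \<in> measurable M (\<Pi>\<^sub>M i\<in>level k. borel)"
  unfolding values_at_def using X_measurable level_subset by (intro measurable_restrict) auto

lemma distr_marks_upto:
  assumes "k \<ge> 1"
  shows "distr M (\<Pi>\<^sub>M i\<in>below k. borel) (marks_upto k) = (\<Pi>\<^sub>M i\<in>below k. R)"
proof -
  have "M.indep_vars (\<lambda>_. borel) W (below k)"
    using rtp M.indep_vars_subset[OF _ below_subset] by (auto simp: recursive_tree_process_def)
  moreover have "below k \<noteq> {}" using Nil_in_below[OF assms] by blast
  ultimately have "distr M (\<Pi>\<^sub>M i\<in>below k. borel) (marks_upto k) = (\<Pi>\<^sub>M i\<in>below k. distr M borel (W i))"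
    using W_measurable below_subset unfolding marks_upto_def
    by (subst (asm) M.indep_vars_iff_distr_eq_PiM') auto
  also have "\<dots> = (\<Pi>\<^sub>M i\<in>below k. R)"
    using rtp below_subset by (intro PiM_cong) (auto simp: recursive_tree_process_def)
  finally show ?thesis .
qed

lemma distr_values_at:
  assumes k: "k \<ge> 1"
  shows "distr M (\<Pi>\<^sub>M i\<in>level k. borel) (values_at k) = (\<Pi>\<^sub>M i\<in>level k. \<nu>)"
proof -
  \<comment> \<open>Independence of an infinite family is tested on finite subfamilies, each of
    which lies on the boundary of some finite subtree.\<close>
  have "M.indep_sets (\<lambda>i. {X i -` A \<inter> space M |A. A \<in> sets borel}) (level k)"
  proof (subst M.indep_sets_finite_index_sets, intro allI impI)
    fix J assume J: "J \<subseteq> level k" "finite J"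
    from finite_subtree_exists[OF k finite.emptyI empty_subsetI this(2,1)]
    obtain U where U: "finite_rooted_subtree d U" "J \<subseteq> tree_boundary d U" by blast
    from M.indep_vars_subset[OF boundary_values(1)[OF U(1)] U(2)]
    show "M.indep_sets (\<lambda>i. {X i -` A \<inter> space M |A. A \<in> sets borel}) J"
      by (simp add: M.indep_vars_def2)
  qed
  then have "M.indep_vars (\<lambda>_. borel) X (level k)"
    using X_measurable level_subset by (auto simp: M.indep_vars_def2)
  then have "distr M (\<Pi>\<^sub>M i\<in>level k. borel) (values_at k) = (\<Pi>\<^sub>M i\<in>level k. distr M borel (X i))"
    using X_measurable level_subset level_nonempty unfolding values_at_def
    by (subst (asm) M.indep_vars_iff_distr_eq_PiM') auto
  also have "\<dots> = (\<Pi>\<^sub>M i\<in>level k. \<nu>)"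
  proof (intro PiM_cong refl)
    fix i assume i: "i \<in> level k"
    obtain U where "finite_rooted_subtree d U" "{i} \<subseteq> tree_boundary d U"
      using finite_subtree_exists[OF k finite.emptyI empty_subsetI, of "{i}"] i by blast
    then show "distr M borel (X i) = \<nu>" using boundary_values(2) by blast
  qed
  finally show ?thesis .
qed

text \<open>A cylinder event concerns finitely many words, so a pair of cylinder events is covered
  by the independence condition of a single finite subtree. Cylinders are stable under intersection,
  which extends independence to the generated sigma fields.\<close>

lemma indep_marks_values:
  assumes k: "k \<ge> 1"
  shows "M.indep_set {values_at k -` A \<inter> space M |A. A \<in> sets (\<Pi>\<^sub>M i\<in>level k. borel)}
    {marks_upto k -` A \<inter> space M |A. A \<in> sets (\<Pi>\<^sub>M i\<in>below k. borel)}"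
proof -
  let ?PX = "\<Pi>\<^sub>M i\<in>level k. (borel :: 's measure)" and ?PW = "\<Pi>\<^sub>M i\<in>below k. (borel :: 'o measure)"
  let ?A = "{values_at k -` A \<inter> space M |A. A \<in> prod_algebra (level k) (\<lambda>_. borel :: 's measure)}"
  let ?B = "{marks_upto k -` A \<inter> space M |A. A \<in> prod_algebra (below k) (\<lambda>_. borel :: 'o measure)}"
  have pa: "prod_algebra K (\<lambda>_. borel :: 'x::topological_space measure) \<subseteq> sets (\<Pi>\<^sub>M i\<in>K. borel)" for K :: "nat list set"
    by (auto simp: sets_PiM)
  have stable: "Int_stable {f -` A \<inter> space M |A. A \<in> G}" if "Int_stable G" for G and f :: "'p \<Rightarrow> 'y"
  proof (rule Int_stableI)
    fix a b assume "a \<in> {f -` A \<inter> space M |A. A \<in> G}" "b \<in> {f -` A \<inter> space M |A. A \<in> G}"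
    then obtain A B where "A \<in> G" "B \<in> G" "a = f -` A \<inter> space M" "b = f -` B \<inter> space M" by blast
    then show "a \<inter> b \<in> {f -` A \<inter> space M |A. A \<in> G}"
      using Int_stableD[OF that, of A B] by (intro CollectI exI[of _ "A \<inter> B"]) auto
  qed
  have "M.indep_set ?A ?B"
  proof (rule M.indep_setI)
    show "?A \<subseteq> M.events" using pa by (auto intro!: measurable_sets[OF values_at_measurable])
    show "?B \<subseteq> M.events" using pa by (auto intro!: measurable_sets[OF marks_upto_measurable])
    fix a b assume "a \<in> ?A" "b \<in> ?B"
    then obtain A B where A: "A \<in> prod_algebra (level k) (\<lambda>_. borel)" "a = values_at k -` A \<inter> space M"
      and B: "B \<in> prod_algebra (below k) (\<lambda>_. borel)" "b = marks_upto k -` B \<inter> space M" by blast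
    from A(1) obtain J E where J: "A = prod_emb (level k) (\<lambda>_. borel) J (Pi\<^sub>E J E)" "finite J" "J \<subseteq> level k"
      "\<And>i. i \<in> J \<Longrightarrow> E i \<in> sets (borel :: 's measure)" by (rule prod_algebraE) blast
    from B(1) obtain I F where I: "B = prod_emb (below k) (\<lambda>_. borel) I (Pi\<^sub>E I F)" "finite I" "I \<subseteq> below k"
      "\<And>i. i \<in> I \<Longrightarrow> F i \<in> sets (borel :: 'o measure)" by (rule prod_algebraE) blast
    obtain U where U: "finite_rooted_subtree d U" "I \<subseteq> U" "J \<subseteq> tree_boundary d U"
      using finite_subtree_exists[OF k I(2,3) J(2,3)] by blast
    have "a = {p \<in> space M. \<forall>i\<in>J. X i p \<in> E i}"
      using J(3) by (auto simp: A(2) J(1) values_at_def prod_emb_def PiE_iff subset_eq)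
    also have "\<dots> = (\<lambda>p. \<lambda>i\<in>tree_boundary d U. X i p) -` prod_emb (tree_boundary d U) (\<lambda>_. borel) J (Pi\<^sub>E J E) \<inter> space M"
      using U(3) by (auto simp: prod_emb_def PiE_iff subset_eq)
    also have "\<dots> \<in> sets (generated_by M (tree_boundary d U) X)"
      unfolding generated_by_def using J U by (intro in_vimage_algebra sets_PiM_I) auto
    finally have a: "a \<in> sets (generated_by M (tree_boundary d U) X)" .
    have "b = {p \<in> space M. \<forall>i\<in>I. W i p \<in> F i}"
      using I(3) by (auto simp: B(2) I(1) marks_upto_def prod_emb_def PiE_iff subset_eq)
    also have "\<dots> = (\<lambda>p. \<lambda>i\<in>U. W i p) -` prod_emb U (\<lambda>_. borel) I (Pi\<^sub>E I F) \<inter> space M"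
      using U(2) by (auto simp: prod_emb_def PiE_iff subset_eq)
    also have "\<dots> \<in> sets (generated_by M U W)"
      unfolding generated_by_def using I U by (intro in_vimage_algebra sets_PiM_I) auto
    finally have b: "b \<in> sets (generated_by M U W)" .
    show "M.prob (a \<inter> b) = M.prob a * M.prob b"
      by (rule M.indep_setD[OF boundary_values(3)[OF U(1)] a b])
  qed
  then have "M.indep_set (sigma_sets (space M) ?A) (sigma_sets (space M) ?B)"
    by (rule M.indep_set_sigma_sets) (intro stable Int_stable_prod_algebra)+
  moreover have "sigma_sets (space M) ?A = {values_at k -` A \<inter> space M |A. A \<in> sets ?PX}"
    by (subst sigma_sets_vimage_commute[symmetric, where \<Omega>'="\<Pi>\<^sub>E i\<in>level k. UNIV"])
      (auto simp: sets_PiM values_at_def)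
  moreover have "sigma_sets (space M) ?B = {marks_upto k -` A \<inter> space M |A. A \<in> sets ?PW}"
    by (subst sigma_sets_vimage_commute[symmetric, where \<Omega>'="\<Pi>\<^sub>E i\<in>below k. UNIV"])
      (auto simp: sets_PiM marks_upto_def)
  ultimately show ?thesis by simp
qed

text \<open>This moves computations with the process from M to independent families of leaves and
  marks on all words.\<close>

lemma distr_marks_values:
  assumes k: "k \<ge> 1"
  shows "distr M ((\<Pi>\<^sub>M i\<in>level k. borel) \<Otimes>\<^sub>M (\<Pi>\<^sub>M i\<in>below k. borel)) (\<lambda>p. (values_at k p, marks_upto k p))
    = distr (tree_leaf \<Otimes>\<^sub>M tree_mark) ((\<Pi>\<^sub>M i\<in>level k. borel) \<Otimes>\<^sub>M (\<Pi>\<^sub>M i\<in>below k. borel))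
        (\<lambda>(b, \<theta>). (restrict b (level k), restrict \<theta> (below k)))"
proof -
  let ?PX = "\<Pi>\<^sub>M i\<in>level k. (borel :: 's measure)" and ?PW = "\<Pi>\<^sub>M i\<in>below k. (borel :: 'o measure)"
  interpret PW: prob_space "\<Pi>\<^sub>M i\<in>below k. R" by (intro prob_space_PiM R_prob)
  interpret MX: prob_space "distr M ?PX (values_at k)" by (rule M.prob_space_distr) simp
  interpret MW: prob_space "distr M ?PW (marks_upto k)" by (rule M.prob_space_distr) simp
  have "distr M ?PX (values_at k) \<Otimes>\<^sub>M distr M ?PW (marks_upto k) = distr M (?PX \<Otimes>\<^sub>M ?PW) (\<lambda>p. (values_at k p, marks_upto k p))"
  proof (rule pair_measure_eqI)
    fix A B assume "A \<in> sets (distr M ?PX (values_at k))" "B \<in> sets (distr M ?PW (marks_upto k))"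
    then have AB: "A \<in> sets ?PX" "B \<in> sets ?PW" by auto
    have "M.prob ((values_at k -` A \<inter> space M) \<inter> (marks_upto k -` B \<inter> space M))
        = M.prob (values_at k -` A \<inter> space M) * M.prob (marks_upto k -` B \<inter> space M)"
      using AB by (intro M.indep_setD[OF indep_marks_values[OF k]]) auto
    also have "(values_at k -` A \<inter> space M) \<inter> (marks_upto k -` B \<inter> space M)
        = (\<lambda>p. (values_at k p, marks_upto k p)) -` (A \<times> B) \<inter> space M" by auto
    finally show "emeasure (distr M ?PX (values_at k)) A * emeasure (distr M ?PW (marks_upto k)) B
        = emeasure (distr M (?PX \<Otimes>\<^sub>M ?PW) (\<lambda>p. (values_at k p, marks_upto k p))) (A \<times> B)"
      using AB by (simp add: emeasure_distr M.emeasure_eq_measure ennreal_mult'[symmetric])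
  qed (simp_all add: MX.sigma_finite_measure_axioms MW.sigma_finite_measure_axioms cong: sets_pair_measure_cong)
  then have "distr M (?PX \<Otimes>\<^sub>M ?PW) (\<lambda>p. (values_at k p, marks_upto k p)) = distr M ?PX (values_at k) \<Otimes>\<^sub>M distr M ?PW (marks_upto k)" ..
  also have "\<dots> = distr tree_leaf ?PX (\<lambda>b. restrict b (level k)) \<Otimes>\<^sub>M distr tree_mark ?PW (\<lambda>\<theta>. restrict \<theta> (below k))"
    by (simp add: distr_values_at[OF k] distr_marks_upto[OF k] distr_restrict_PiM R_prob \<nu>_prob)
  also have "\<dots> = distr (tree_leaf \<Otimes>\<^sub>M tree_mark) (?PX \<Otimes>\<^sub>M ?PW) (\<lambda>(b, \<theta>). (restrict b (level k), restrict \<theta> (below k)))"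
  proof (rule pair_measure_distr)
    show "(\<lambda>b. restrict b (level k)) \<in> measurable tree_leaf ?PX"
      by (rule measurable_restrict) (simp add: measurable_cong_sets[OF refl sets_\<nu>[symmetric]] measurable_component_singleton)
    show "(\<lambda>b. restrict b (below k)) \<in> measurable tree_mark ?PW"
      by (rule measurable_restrict) (simp add: measurable_cong_sets[OF refl sets_R[symmetric]] measurable_component_singleton)
    show "sigma_finite_measure (distr tree_mark ?PW (\<lambda>\<theta>. restrict \<theta> (below k)))"
      by (simp add: distr_restrict_PiM R_prob PW.sigma_finite_measure_axioms)
  qed
  finally show ?thesis .
qed

section \<open>The root value as a function of one generation of values and the marks above
  it\<close>

lemma below_Suc_Cons: "i \<in> below k \<Longrightarrow> enat j < d \<Longrightarrow> j # i \<in> below (Suc k)"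
  and level_Suc_Cons: "i \<in> level k \<Longrightarrow> enat j < d \<Longrightarrow> j # i \<in> level (Suc k)"
  by (auto simp: below_def level_def tree_def)

lemma below_mono: "k \<le> l \<Longrightarrow> below k \<subseteq> below l"
  by (auto simp: below_def)

text \<open>\<gamma> reads only children with number below \<kappa> \<le> d, so the recursion never
  leaves \<open>tree d\<close>, nor goes deeper than k.\<close>

lemma tree_eval_cong:
  assumes "\<And>i. i \<in> below k \<Longrightarrow> \<theta> i = \<theta>' i" "\<And>i. i \<in> level k \<Longrightarrow> b i = b' i"
  shows "tree_eval k \<theta> b = tree_eval k \<theta>' b'"
  using assms
proof (induction k arbitrary: \<theta> \<theta>' b b')
  case 0
  then show ?case by (simp add: level_def tree_def)
next
  case (Suc k)
  have "\<theta> [] = \<theta>' []" by (intro Suc.prems Nil_in_below) simp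
  moreover have "tree_eval k (\<lambda>i. \<theta> (j # i)) (\<lambda>i. b (j # i)) = tree_eval k (\<lambda>i. \<theta>' (j # i)) (\<lambda>i. b' (j # i))"
    if "j < \<kappa> (\<theta>' [])" for j
  proof -
    have "enat j < d" using that \<kappa>_le_d[of "\<theta>' []"] by (metis enat_ord_simps(2) order_less_le_trans)
    then show ?thesis by (intro Suc.IH Suc.prems below_Suc_Cons level_Suc_Cons)
  qed
  ultimately show ?case by (simp, intro \<gamma>_cong, auto)
qed

lemma cond_mean_cong:
  "(\<And>i. i \<in> below k \<Longrightarrow> \<theta> i = \<theta>' i) \<Longrightarrow> cond_mean k h \<theta> = cond_mean k h \<theta>'"
  unfolding cond_mean_def by (intro Bochner_Integration.integral_cong refl arg_cong[where f=h] tree_eval_cong)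

lemma root_eq_tree_eval:
  "AE p in M. X [] p = tree_eval k (marks_upto k p) (values_at k p)"
proof -
  have "AE p in M. \<forall>i\<in>tree d. X i p = \<gamma> (W i p) (\<lambda>j. X (i @ [j]) p)"
    using rtp by (simp add: recursive_tree_process_def)
  then show ?thesis
  proof eventually_elim
    case (elim p)
    have "X i p = tree_eval k (\<lambda>u. W (i @ u) p) (\<lambda>u. X (i @ u) p)" if "i \<in> tree d" for i
      using that
    proof (induction k arbitrary: i)
      case (Suc k)
      have "X i p = \<gamma> (W i p) (\<lambda>j. X (i @ [j]) p)" using elim Suc.prems by blast
      also have "\<dots> = \<gamma> (W i p) (\<lambda>j. tree_eval k (\<lambda>u. W (i @ j # u) p) (\<lambda>u. X (i @ j # u) p))"
      proof (rule \<gamma>_cong)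
        fix j assume "j < \<kappa> (W i p)"
        then have "enat j < d" using \<kappa>_le_d[of "W i p"] by (metis enat_ord_simps(2) order_less_le_trans)
        then have "i @ [j] \<in> tree d" using Suc.prems by (auto simp: tree_def)
        from Suc.IH[OF this] show "X (i @ [j]) p = tree_eval k (\<lambda>u. W (i @ j # u) p) (\<lambda>u. X (i @ j # u) p)"
          by simp
      qed
      finally show ?case by simp
    qed simp
    from this[of "[]"] have "X [] p = tree_eval k (\<lambda>u. W u p) (\<lambda>u. X u p)" by (simp add: tree_def)
    also have "\<dots> = tree_eval k (marks_upto k p) (values_at k p)"
      by (rule tree_eval_cong) (simp_all add: marks_upto_def values_at_def)
    finally show ?case .
  qed
qed

lemma tree_eval_measurable_restricted:
  "(\<lambda>(b, \<theta>). tree_eval k \<theta> b) \<in> borel_measurable ((\<Pi>\<^sub>M i\<in>level k. borel) \<Otimes>\<^sub>M (\<Pi>\<^sub>M i\<in>below k. borel))"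
proof -
  have "(\<lambda>z. (snd z, fst z)) \<in> measurable ((\<Pi>\<^sub>M i\<in>level k. borel) \<Otimes>\<^sub>M (\<Pi>\<^sub>M i\<in>below k. borel)) (tree_mark \<Otimes>\<^sub>M tree_leaf)"
    by (intro measurable_Pair measurable_compose[OF measurable_fst measurable_extend]
        measurable_compose[OF measurable_snd measurable_extend]) simp_all
  from measurable_compose[OF this measurable_tree_eval] show ?thesis by (simp add: split_beta')
qed

lemma cond_mean_measurable_restricted:
  assumes "f \<in> borel_measurable borel"
  shows "cond_mean k f \<in> borel_measurable (\<Pi>\<^sub>M i\<in>below l. borel)"
proof -
  have "(\<lambda>\<theta>. \<theta>) \<in> measurable (\<Pi>\<^sub>M i\<in>below l. borel) tree_mark"
    by (intro measurable_extend) simp_all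
  from measurable_compose[OF this measurable_cond_mean[OF assms]] show ?thesis .
qed

lemma restrict_measurable:
  "(\<lambda>b. restrict b I) \<in> measurable tree_leaf (\<Pi>\<^sub>M i\<in>I. borel)"
  "(\<lambda>\<theta>. restrict \<theta> I) \<in> measurable tree_mark (\<Pi>\<^sub>M i\<in>I. borel)"
  by (rule measurable_restrict, simp add: measurable_cong_sets[OF refl sets_\<nu>[symmetric]] measurable_component_singleton)
    (rule measurable_restrict, simp add: measurable_cong_sets[OF refl sets_R[symmetric]] measurable_component_singleton)

text \<open>Almost surely the root value is \<open>tree_eval\<close> of the marks before generation
  k and the values at generation k, which are independent with known laws. The restriction of
  \<theta> reflects that \<open>marks_upto k\<close> is extensional.\<close>

lemma expectation_root:
  assumes k: "k \<ge> 1" and [measurable]: "(\<lambda>(x, \<theta>). \<Phi> x \<theta>) \<in> borel_measurable (borel \<Otimes>\<^sub>M (\<Pi>\<^sub>M i\<in>below k. borel))"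
    and b: "\<And>x \<theta>. \<bar>\<Phi> x \<theta>\<bar> \<le> (C :: real)"
  shows "(\<integral>p. \<Phi> (X [] p) (marks_upto k p) \<partial>M)
    = (\<integral>\<theta>. \<integral>b. \<Phi> (tree_eval k \<theta> b) (restrict \<theta> (below k)) \<partial>tree_leaf \<partial>tree_mark)"
proof -
  let ?PX = "\<Pi>\<^sub>M i\<in>level k. (borel :: 's measure)" and ?PW = "\<Pi>\<^sub>M i\<in>below k. (borel :: 'o measure)"
  let ?F = "\<lambda>(b, \<theta>). \<Phi> (tree_eval k \<theta> b) \<theta>"
  have "(\<lambda>z. (tree_eval k (snd z) (fst z), snd z)) \<in> measurable (?PX \<Otimes>\<^sub>M ?PW) (borel \<Otimes>\<^sub>M ?PW)"
    using tree_eval_measurable_restricted[of k] by (intro measurable_Pair) (simp_all add: split_beta')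
  from measurable_compose[OF this assms(2)] have F: "?F \<in> borel_measurable (?PX \<Otimes>\<^sub>M ?PW)"
    by (simp add: split_beta')
  have Nil: "[] \<in> tree d" by (simp add: tree_def)
  note [measurable] = X_measurable[OF Nil]
  have m1: "(\<lambda>p. (values_at k p, marks_upto k p)) \<in> measurable M (?PX \<Otimes>\<^sub>M ?PW)" by measurable
  have m2: "(\<lambda>(b, \<theta>). (restrict b (level k), restrict \<theta> (below k))) \<in> measurable (tree_leaf \<Otimes>\<^sub>M tree_mark) (?PX \<Otimes>\<^sub>M ?PW)"
    unfolding split_beta'
    by (intro measurable_Pair measurable_compose[OF measurable_fst restrict_measurable(1)]
        measurable_compose[OF measurable_snd restrict_measurable(2)])
  have m3: "(\<lambda>p. \<Phi> (X [] p) (marks_upto k p)) \<in> borel_measurable M" by measurable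
  have "(\<integral>p. \<Phi> (X [] p) (marks_upto k p) \<partial>M) = (\<integral>p. ?F (values_at k p, marks_upto k p) \<partial>M)"
    using m3 measurable_compose[OF m1 F] root_eq_tree_eval[of k] by (intro integral_cong_AE) auto
  also have "\<dots> = (\<integral>z. ?F z \<partial>distr M (?PX \<Otimes>\<^sub>M ?PW) (\<lambda>p. (values_at k p, marks_upto k p)))"
    by (rule integral_distr[OF m1 F, symmetric])
  also have "\<dots> = (\<integral>z. ?F (case z of (b, \<theta>) \<Rightarrow> (restrict b (level k), restrict \<theta> (below k))) \<partial>(tree_leaf \<Otimes>\<^sub>M tree_mark))"
    unfolding distr_marks_values[OF k] by (rule integral_distr[OF m2 F])
  also have "\<dots> = (\<integral>\<theta>. \<integral>b. ?F (restrict b (level k), restrict \<theta> (below k)) \<partial>tree_leaf \<partial>tree_mark)"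
    using b by (subst integral_pair_bounded_snd[OF tree_leaf.prob_space_axioms tree_mark.prob_space_axioms
      measurable_compose[OF m2 F], of C]) auto
  also have "\<dots> = (\<integral>\<theta>. \<integral>b. \<Phi> (tree_eval k \<theta> b) (restrict \<theta> (below k)) \<partial>tree_leaf \<partial>tree_mark)"
  proof (intro Bochner_Integration.integral_cong refl)
    fix \<theta> b
    have "tree_eval k (restrict \<theta> (below k)) (restrict b (level k)) = tree_eval k \<theta> b"
      by (rule tree_eval_cong) auto
    then show "?F (restrict b (level k), restrict \<theta> (below k)) = \<Phi> (tree_eval k \<theta> b) (restrict \<theta> (below k))" by simp
  qed
  finally show ?thesis .
qed

text \<open>The root lies on no boundary, so its law is not among the defining conditions. It is
  recovered from generation 1, whose values are i.i.d. of law \<nu>, together with the fixed point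
  equation.\<close>

lemma expectation_root_\<nu>:
  assumes [measurable]: "f \<in> borel_measurable borel" and b: "\<And>x. \<bar>f x\<bar> \<le> (1 :: real)"
  shows "(\<integral>p. f (X [] p) \<partial>M) = (\<integral>x. f x \<partial>\<nu>)"
proof -
  let ?SN = "iid \<nu>"
  interpret product_prob_space "\<lambda>_. \<nu>" "UNIV :: nat list set" ..
  have c[measurable]: "(\<lambda>b. b []) \<in> borel_measurable tree_leaf"
    using measurable_component_singleton[of "[]" UNIV "\<lambda>_. \<nu>"] measurable_cong_sets[OF refl sets_\<nu>] by blast
  have marg: "(\<integral>x. h x \<partial>\<nu>) = (\<integral>b. h (b []) \<partial>tree_leaf)" if h: "h \<in> borel_measurable borel" for h :: "'s \<Rightarrow> real"
  proof -
    have "(\<integral>x. h x \<partial>\<nu>) = (\<integral>x. h x \<partial>distr tree_leaf \<nu> (\<lambda>x. x []))"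
      by (subst PiM_component) auto
    also have "\<dots> = (\<integral>b. h (b []) \<partial>tree_leaf)"
      using h by (subst integral_distr) auto
    finally show ?thesis .
  qed
  \<comment> \<open>At depth 0 only the root leaf of each subtree is read. The marginal bound with
    \<epsilon> = 0, applied to g and to - g, shows that these leaves integrate like an i.i.d.
    sequence of law \<nu>.\<close>
  have iid: "(\<integral>b. g (\<lambda>i. b i []) \<partial>leaves) = (\<integral>x. g x \<partial>?SN)"
    if g: "g \<in> borel_measurable (iid borel)" "\<And>x. \<bar>g x\<bar> \<le> (1::real)" "depends_on_first j g" for g j
  proof -
    note * = iid_product_marginal_bound[OF \<nu>_prob sets_\<nu> tree_leaf.prob_space_axioms c, where \<epsilon>=0 and j=j]
    have "(\<integral>x. g x \<partial>?SN) - (\<integral>b. g (\<lambda>i. b i []) \<partial>leaves) \<le> real j * 0"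
      using g by (intro *) (simp_all add: marg)
    moreover have "(\<integral>x. - g x \<partial>?SN) - (\<integral>b. - g (\<lambda>i. b i []) \<partial>leaves) \<le> real j * 0"
      using g by (intro *) (simp_all add: marg depends_on_first_def)
    ultimately show ?thesis by simp
  qed
  have "(\<integral>p. f (X [] p) \<partial>M) = (\<integral>\<theta>. cond_mean 1 f \<theta> \<partial>tree_mark)"
    using b by (subst expectation_root[of 1 "\<lambda>x _. f x" 1]) (simp_all add: cond_mean_def[abs_def])
  also have "\<dots> = (\<integral>\<omega>. \<integral>\<Theta>. cond_mean 1 f (tree_join \<omega> \<Theta>) \<partial>marks \<partial>R)"
    by (rule integral_PiM_tree[OF R_prob, of _ 1]) (use b in \<open>auto intro!: cond_mean_bound\<close>)
  also have "\<dots> = (\<integral>\<omega>. \<integral>\<Theta>. (\<integral>b. f (\<gamma> \<omega> (\<lambda>j. b j [])) \<partial>leaves) \<partial>marks \<partial>R)"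
    using cond_mean_Suc[of f 1 _ 0] b by (intro Bochner_Integration.integral_cong refl) simp
  also have "\<dots> = (\<integral>\<omega>. (\<integral>b. f (\<gamma> \<omega> (\<lambda>j. b j [])) \<partial>leaves) \<partial>R)"
    using marks.prob_space by simp
  also have "\<dots> = (\<integral>\<omega>. \<integral>x. f (\<gamma> \<omega> x) \<partial>?SN \<partial>R)"
    using b by (intro Bochner_Integration.integral_cong refl iid[OF _ _ depends_on_first_\<gamma>]) (auto simp: depends_on_first_\<gamma>)
  also have "\<dots> = (\<integral>x. f x \<partial>\<nu>)" using b by (rule integral_\<nu>_eq[symmetric, OF assms(1)])
  finally show ?thesis .
qed

text \<open>Pythagoras: the conditional mean is the orthogonal projection onto functions of the
  first k generations of marks, so the error of a predictor g is the least error plus the squared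
  distance of g from the projection.\<close>

lemma mean_square_error:
  assumes k: "k \<ge> 1" and f[measurable]: "f \<in> borel_measurable borel" "\<And>x. \<bar>f x\<bar> \<le> (1 :: real)"
    and g[measurable]: "g \<in> borel_measurable (\<Pi>\<^sub>M i\<in>below k. borel)" "\<And>\<theta>. \<bar>g \<theta>\<bar> \<le> 1"
  shows "(\<integral>p. (f (X [] p) - g (marks_upto k p))\<^sup>2 \<partial>M)
    = (\<integral>x. (f x)\<^sup>2 \<partial>\<nu>) - explained k f + (\<integral>\<theta>. (cond_mean k f \<theta> - g (restrict \<theta> (below k)))\<^sup>2 \<partial>tree_mark)"
proof -
  note [measurable] = measurable_compose[OF restrict_measurable(2) g(1)]
  define S where "S \<theta> = (\<integral>b. (f (tree_eval k \<theta> b))\<^sup>2 \<partial>tree_leaf)" for \<theta>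
  have [measurable]: "S \<in> borel_measurable tree_mark" unfolding S_def by measurable
  have bS: "\<bar>S \<theta>\<bar> \<le> 1" for \<theta>
    unfolding S_def using f(2) by (intro abs_integral_le_bound tree_leaf.prob_space_axioms) (auto simp: power2_le_1)
  have bc: "\<bar>cond_mean k f \<theta>\<bar> \<le> 1" for \<theta> using f(2) by (rule cond_mean_bound)
  have fX: "(\<integral>x. (f x)\<^sup>2 \<partial>\<nu>) = (\<integral>\<theta>. S \<theta> \<partial>tree_mark)"
  proof -
    have "(\<integral>x. (f x)\<^sup>2 \<partial>\<nu>) = (\<integral>p. (f (X [] p))\<^sup>2 \<partial>M)"
      using f(2) by (subst expectation_root_\<nu>) (auto simp: power2_le_1)
    also have "\<dots> = (\<integral>\<theta>. S \<theta> \<partial>tree_mark)"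
      using f(2) by (subst expectation_root[OF k, of "\<lambda>x _. (f x)\<^sup>2" 1]) (auto simp: power2_le_1 S_def[abs_def])
    finally show ?thesis .
  qed
  have "(\<integral>p. (f (X [] p) - g (marks_upto k p))\<^sup>2 \<partial>M)
    = (\<integral>\<theta>. \<integral>b. (f (tree_eval k \<theta> b) - g (restrict \<theta> (below k)))\<^sup>2 \<partial>tree_leaf \<partial>tree_mark)"
    by (rule expectation_root[OF k, of _ 4]) (use f(2) g(2) in \<open>auto intro!: power2_le_4 abs_diff_le_2\<close>)
  also have "\<dots> = (\<integral>\<theta>. S \<theta> - (cond_mean k f \<theta>)\<^sup>2 + (cond_mean k f \<theta> - g (restrict \<theta> (below k)))\<^sup>2 \<partial>tree_mark)"
  proof (intro Bochner_Integration.integral_cong refl)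
    fix \<theta> assume \<theta>: "\<theta> \<in> space tree_mark"
    from measurable_compose[OF measurable_Pair1'[OF \<theta>] measurable_tree_eval[of k]]
    have [measurable]: "tree_eval k \<theta> \<in> borel_measurable tree_leaf" by (simp only: prod.case)
    let ?c = "g (restrict \<theta> (below k))"
    have i: "integrable tree_leaf (\<lambda>b. (f (tree_eval k \<theta> b))\<^sup>2)" "integrable tree_leaf (\<lambda>b. f (tree_eval k \<theta> b))"
      using f(2) by (auto intro!: integrable_bounded_real[OF tree_leaf.prob_space_axioms, of _ 1] simp: power2_le_1)
    have "(\<integral>b. (f (tree_eval k \<theta> b) - ?c)\<^sup>2 \<partial>tree_leaf)
      = (\<integral>b. (f (tree_eval k \<theta> b))\<^sup>2 - 2 * ?c * f (tree_eval k \<theta> b) + ?c\<^sup>2 \<partial>tree_leaf)"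
      by (intro Bochner_Integration.integral_cong refl) (simp add: power2_diff algebra_simps)
    also have "\<dots> = S \<theta> - 2 * ?c * cond_mean k f \<theta> + ?c\<^sup>2"
      using i by (simp add: S_def cond_mean_def tree_leaf.prob_space)
    also have "\<dots> = S \<theta> - (cond_mean k f \<theta>)\<^sup>2 + (cond_mean k f \<theta> - ?c)\<^sup>2"
      by (simp add: power2_diff algebra_simps)
    finally show "(\<integral>b. (f (tree_eval k \<theta> b) - ?c)\<^sup>2 \<partial>tree_leaf) = \<dots>" .
  qed
  also have "\<dots> = (\<integral>\<theta>. S \<theta> \<partial>tree_mark) - explained k f + (\<integral>\<theta>. (cond_mean k f \<theta> - g (restrict \<theta> (below k)))\<^sup>2 \<partial>tree_mark)"
  proof -
    have "integrable tree_mark S" "integrable tree_mark (\<lambda>\<theta>. (cond_mean k f \<theta>)\<^sup>2)"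
      using bS bc by (auto intro!: integrable_bounded_real[OF tree_mark.prob_space_axioms, of _ 1] simp: power2_le_1)
    moreover have "integrable tree_mark (\<lambda>\<theta>. (cond_mean k f \<theta> - g (restrict \<theta> (below k)))\<^sup>2)"
      using g(2) bc by (intro integrable_bounded_real[OF tree_mark.prob_space_axioms, of _ 4]) (auto intro!: power2_le_4 abs_diff_le_2)
    ultimately show ?thesis by (simp add: explained_def)
  qed
  finally show ?thesis by (simp add: fX)
qed

lemma mean_square_error_cond_mean:
  assumes "k \<ge> 1" and f: "f \<in> borel_measurable borel" "\<And>x. \<bar>f x\<bar> \<le> (1 :: real)"
  shows "(\<integral>p. (f (X [] p) - cond_mean k f (marks_upto k p))\<^sup>2 \<partial>M) = (\<integral>x. (f x)\<^sup>2 \<partial>\<nu>) - explained k f"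
proof -
  have "cond_mean k f (restrict \<theta> (below k)) = cond_mean k f \<theta>" for \<theta> by (rule cond_mean_cong) simp
  then show ?thesis
    using mean_square_error[OF assms cond_mean_measurable_restricted[OF f(1)] cond_mean_bound[OF f(2)]]
    by simp
qed

lemma explained_le_mean_square:
  assumes "k \<ge> 1" and f: "f \<in> borel_measurable borel" "\<And>x. \<bar>f x\<bar> \<le> (1 :: real)"
  shows "explained k f \<le> (\<integral>x. (f x)\<^sup>2 \<partial>\<nu>)"
proof -
  have "0 \<le> (\<integral>p. (f (X [] p) - cond_mean k f (marks_upto k p))\<^sup>2 \<partial>M)" by simp
  then show ?thesis using mean_square_error_cond_mean[OF assms] by simp
qed

text \<open>The best predictor from k generations is one of the predictors from l generations, so
  its error is at least the least error at depth l.\<close>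

lemma explained_mono:
  assumes k: "1 \<le> k" "k \<le> l" and f: "f \<in> borel_measurable borel" "\<And>x. \<bar>f x\<bar> \<le> (1 :: real)"
  shows "explained k f \<le> explained l f"
proof -
  have "cond_mean k f (marks_upto l p) = cond_mean k f (marks_upto k p)" for p
    using below_mono[OF k(2)] by (intro cond_mean_cong) (auto simp: marks_upto_def)
  then have "(\<integral>x. (f x)\<^sup>2 \<partial>\<nu>) - explained k f = (\<integral>p. (f (X [] p) - cond_mean k f (marks_upto l p))\<^sup>2 \<partial>M)"
    using mean_square_error_cond_mean[OF k(1) f] by simp
  also have "\<dots> \<ge> (\<integral>x. (f x)\<^sup>2 \<partial>\<nu>) - explained l f"
    using k by (subst mean_square_error[OF _ f cond_mean_measurable_restricted[OF f(1)] cond_mean_bound[OF f(2)]]) auto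
  finally show ?thesis by simp
qed

section \<open>Finite generations of marks exhaust the sigma field of all marks\<close>

lemma sets_generated_below:
  "sets (generated_by M (below k) W) = {marks_upto k -` B \<inter> space M |B. B \<in> sets (\<Pi>\<^sub>M i\<in>below k. borel)}"
  unfolding generated_by_def marks_upto_def[abs_def]
  by (rule sets_vimage_algebra2) (auto simp: space_PiM)

lemma space_generated_by [simp]: "space (generated_by M I W) = space M"
  by (simp add: generated_by_def)

lemma generated_below_mono:
  assumes "k \<le> l"
  shows "sets (generated_by M (below k) W) \<subseteq> sets (generated_by M (below l) W)"
proof
  fix E assume "E \<in> sets (generated_by M (below k) W)"
  then obtain B where B: "B \<in> sets (\<Pi>\<^sub>M i\<in>below k. borel)" "E = marks_upto k -` B \<inter> space M"
    by (auto simp: sets_generated_below)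
  let ?B = "(\<lambda>\<theta>. restrict \<theta> (below k)) -` B \<inter> space (\<Pi>\<^sub>M i\<in>below l. (borel :: 'o measure))"
  have "restrict (marks_upto l p) (below k) = marks_upto k p" for p
    using below_mono[OF assms] by (simp add: marks_upto_def Int_absorb1)
  moreover have "marks_upto l p \<in> space (\<Pi>\<^sub>M i\<in>below l. borel)" for p by (auto simp: marks_upto_def space_PiM)
  ultimately have "E = marks_upto l -` ?B \<inter> space M" by (auto simp: B(2))
  moreover have "?B \<in> sets (\<Pi>\<^sub>M i\<in>below l. borel)"
    using below_mono[OF assms] B(1) by (intro measurable_sets[OF measurable_restrict_subset]) auto
  ultimately show "E \<in> sets (generated_by M (below l) W)"
    unfolding sets_generated_below by blast
qed

lemma generated_below_events: "sets (generated_by M (below k) W) \<subseteq> M.events"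
  by (auto simp: sets_generated_below)

lemma generated_tree_events: "sets (generated_by M (tree d) W) \<subseteq> M.events"
proof -
  have "(\<lambda>p. \<lambda>i\<in>tree d. W i p) \<in> measurable M (\<Pi>\<^sub>M i\<in>tree d. borel)"
    using W_measurable by (intro measurable_restrict) auto
  then show ?thesis unfolding generated_by_def
    by (subst sets_vimage_algebra2) (auto simp: space_PiM)
qed

lemma W_generated: "i \<in> I \<Longrightarrow> W i \<in> borel_measurable (generated_by M I W)"
proof -
  assume i: "i \<in> I"
  have "(\<lambda>p. \<lambda>i\<in>I. W i p) \<in> measurable (generated_by M I W) (\<Pi>\<^sub>M i\<in>I. borel)"
    unfolding generated_by_def by (rule measurable_vimage_algebra1) (auto simp: space_PiM)
  from measurable_compose[OF this measurable_component_singleton[OF i]] i show ?thesis by simp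
qed

lemma marks_upto_generated: "marks_upto k \<in> measurable (generated_by M (tree d) W) (\<Pi>\<^sub>M i\<in>below k. borel)"
  unfolding marks_upto_def using W_generated below_subset by (intro measurable_restrict) auto

lemma generated_tree_sigma_sets:
  "sets (generated_by M (tree d) W) \<subseteq> sigma_sets (space M) (\<Union>k\<in>{1..}. sets (generated_by M (below k) W))"
proof -
  let ?C = "\<Union>k\<in>{1..}. sets (generated_by M (below k) W)"
  let ?N = "sigma (space M) ?C"
  have C: "?C \<subseteq> Pow (space M)" using generated_below_events sets.sets_into_space by blast
  have "(\<lambda>p. \<lambda>i\<in>tree d. W i p) \<in> measurable ?N (\<Pi>\<^sub>M i\<in>tree d. borel)"
  proof (rule measurable_restrict)
    fix i assume "i \<in> tree d"
    then have "i \<in> below (Suc (length i))" by (simp add: below_def)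
    from W_generated[OF this] have "W i -` A \<inter> space M \<in> ?C" if "A \<in> sets borel" for A
      using measurable_sets[of "W i" _ borel A] that by fastforce
    then show "W i \<in> borel_measurable ?N"
      using C by (intro measurableI) (auto simp: space_measure_of sets_measure_of)
  qed
  then show ?thesis
    unfolding generated_by_def using C measurable_sets[of "\<lambda>p. \<lambda>i\<in>tree d. W i p" ?N "\<Pi>\<^sub>M i\<in>tree d. borel"]
    by (subst sets_vimage_algebra2) (auto simp: space_PiM space_measure_of sets_measure_of generated_by_def)
qed

text \<open>The events that can be approximated in probability from finitely many generations are
  closed under complements and countable unions, and they contain a generator.\<close>

lemma approximate_by_finite_depth:
  assumes "E \<in> sets (generated_by M (tree d) W)" "\<epsilon> > 0"
  shows "\<exists>k\<ge>1. \<exists>E'\<in>sets (generated_by M (below k) W). M.prob (sym_diff E E') < \<epsilon>"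
proof -
  let ?C = "\<Union>k\<in>{1..}. sets (generated_by M (below k) W)"
  have ev: "sigma_sets (space M) ?C \<subseteq> M.events"
    using generated_below_events by (intro sets.sigma_sets_subset) auto
  note bev = subsetD[OF generated_below_events]
  have "E \<in> sigma_sets (space M) ?C" using assms(1) generated_tree_sigma_sets by blast
  then show ?thesis using assms(2)
  proof (induction arbitrary: \<epsilon> rule: sigma_sets.induct)
    case (Basic a)
    then show ?case by (auto intro!: bexI[of _ a])
  next
    case Empty
    then show ?case by (auto intro!: exI[of _ 1] bexI[of _ "{}"])
  next
    case (Compl a)
    from Compl.IH[OF Compl.prems] obtain k E' where k: "k \<ge> 1" "E' \<in> sets (generated_by M (below k) W)" "M.prob (sym_diff a E') < \<epsilon>"
      by blast
    have "a \<subseteq> space M" using ev Compl.hyps sets.sets_into_space by blast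
    moreover have "E' \<subseteq> space M" using bev[OF k(2)] sets.sets_into_space by blast
    ultimately have "sym_diff (space M - a) (space M - E') = sym_diff a E'" by blast
    moreover have "space M - E' \<in> sets (generated_by M (below k) W)"
      using sets.compl_sets[OF k(2)] by simp
    ultimately show ?case using k by metis
  next
    case (Union a)
    have aev: "a i \<in> M.events" for i using Union.hyps ev by blast
    have "(\<lambda>n. M.prob (\<Union>i\<le>n. a i)) \<longlonglongrightarrow> M.prob (\<Union>n. \<Union>i\<le>n. a i)"
      using aev by (intro M.finite_Lim_measure_incseq) (auto simp: incseq_def le_fun_def, meson order_trans atMost_iff)
    moreover have "(\<Union>n. \<Union>i\<le>n. a i) = (\<Union>i. a i)" by auto
    ultimately have "\<forall>\<^sub>F n in sequentially. M.prob (\<Union>i. a i) - \<epsilon> / 2 < M.prob (\<Union>i\<le>n. a i)"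
      using Union.prems by (intro order_tendstoD(1)) auto
    then obtain n where n: "M.prob (\<Union>i. a i) - \<epsilon> / 2 < M.prob (\<Union>i\<le>n. a i)"
      by (auto simp: eventually_sequentially)
    \<comment> \<open>Half of \<epsilon> pays for cutting the union off at n; the other half is
      shared by the n + 1 events kept.\<close>
    define \<delta> where "\<delta> = \<epsilon> / (2 * real (Suc n))"
    have \<delta>: "\<delta> > 0" using Union.prems by (simp add: \<delta>_def)
    have "\<exists>k E'. k \<ge> 1 \<and> E' \<in> sets (generated_by M (below k) W) \<and> M.prob (sym_diff (a i) E') < \<delta>" for i
      using Union.IH[OF \<delta>, of i] by blast
    then obtain k E' where E': "\<And>i. k i \<ge> 1" "\<And>i. E' i \<in> sets (generated_by M (below (k i)) W)"
      "\<And>i. M.prob (sym_diff (a i) (E' i)) < \<delta>" by metis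
    define l where "l = Max (k ` {..n})"
    have l: "i \<le> n \<Longrightarrow> k i \<le> l" for i by (simp add: l_def)
    have l1: "l \<ge> 1" using E'(1)[of 0] l[of 0] by simp
    let ?E = "\<Union>i\<le>n. E' i"
    have E: "?E \<in> sets (generated_by M (below l) W)"
      using E'(2) generated_below_mono[OF l] by (intro sets.finite_UN) auto
    note Eev = bev[OF E'(2)]
    have "M.prob (sym_diff (\<Union>i. a i) ?E) \<le> M.prob (((\<Union>i. a i) - (\<Union>i\<le>n. a i)) \<union> (\<Union>i\<le>n. sym_diff (a i) (E' i)))"
      using aev Eev by (intro M.finite_measure_mono) auto
    also have "\<dots> \<le> M.prob ((\<Union>i. a i) - (\<Union>i\<le>n. a i)) + M.prob (\<Union>i\<le>n. sym_diff (a i) (E' i))"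
      using aev Eev by (intro measure_Un_le) auto
    also have "M.prob ((\<Union>i. a i) - (\<Union>i\<le>n. a i)) < \<epsilon> / 2"
      using n aev by (subst M.finite_measure_Diff) auto
    also have "M.prob (\<Union>i\<le>n. sym_diff (a i) (E' i)) \<le> (\<Sum>i\<le>n. M.prob (sym_diff (a i) (E' i)))"
      using aev Eev by (intro M.finite_measure_subadditive_finite) auto
    also have "\<dots> \<le> (\<Sum>i\<le>n. \<delta>)" using E'(3) by (intro sum_mono) (simp add: less_imp_le)
    also have "\<dots> = \<epsilon> / 2" by (simp add: \<delta>_def field_simps)
    finally have "M.prob (sym_diff (\<Union>i. a i) ?E) < \<epsilon>" by simp
    then show ?case using E l1 by blast
  qed
qed

text \<open>Endogeny turns the event that the root lies in A into an event of the marks, hence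
  nearly into an event of finite depth. The indicator of the latter, used as a predictor, has the
  probability of the symmetric difference as its mean square error; monotonicity carries the bound
  to all larger depths.\<close>

lemma endogenous_imp_explained_tendsto:
  assumes endo: "endogenous d M W X" and A[measurable]: "A \<in> sets borel"
  shows "(\<lambda>k. explained k (indicator A)) \<longlonglongrightarrow> measure \<nu> A"
proof (rule order_tendstoI)
  have f: "indicator A \<in> borel_measurable borel" "\<And>x. \<bar>indicator A x :: real\<bar> \<le> 1"
    by (auto simp: indicator_le_1)
  have sq: "(\<integral>x. (indicator A x)\<^sup>2 \<partial>\<nu>) = measure \<nu> A"
  proof -
    have "(\<lambda>x. (indicator A x)\<^sup>2 :: real) = indicator A" by (auto simp: indicator_def)
    then show ?thesis by simp
  qed
  {
    fix a assume a: "measure \<nu> A < a"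
    have "explained k (indicator A) < a" if "k \<ge> 1" for k
      using explained_le_mean_square[OF that f] a by (simp add: sq)
    then show "\<forall>\<^sub>F k in sequentially. explained k (indicator A) < a"
      unfolding eventually_sequentially by blast
  next
    fix a assume a: "a < measure \<nu> A"
    obtain Z where Z: "Z \<in> borel_measurable (generated_by M (tree d) W)" and XZ: "AE p in M. X [] p = Z p"
      using endo by (auto simp: endogenous_def)
    have Zm[measurable]: "Z \<in> borel_measurable M"
      using measurable_sets[OF Z] generated_tree_events by (intro measurableI) auto
    have Nil: "[] \<in> tree d" by (simp add: tree_def)
    note [measurable] = X_measurable[OF Nil]
    let ?E = "Z -` A \<inter> space M"
    have "?E \<in> sets (generated_by M (tree d) W)" using measurable_sets[OF Z A] by simp
    from approximate_by_finite_depth[OF this, of "measure \<nu> A - a"] a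
    obtain k E' where k: "k \<ge> 1" "E' \<in> sets (generated_by M (below k) W)" "M.prob (sym_diff ?E E') < measure \<nu> A - a"
      by auto
    then obtain B where B[measurable]: "B \<in> sets (\<Pi>\<^sub>M i\<in>below k. borel)" and E': "E' = marks_upto k -` B \<inter> space M"
      by (auto simp: sets_generated_below)
    have [measurable]: "E' \<in> M.events" by (simp add: E')
    have "measure \<nu> A - explained k (indicator A)
      \<le> measure \<nu> A - explained k (indicator A) + (\<integral>\<theta>. (cond_mean k (indicator A) \<theta> - indicator B (restrict \<theta> (below k)))\<^sup>2 \<partial>tree_mark)"
      by simp
    also have "\<dots> = (\<integral>p. (indicator A (X [] p) - indicator B (marks_upto k p))\<^sup>2 \<partial>M)"
      by (subst mean_square_error[OF k(1) f, of "indicator B"]) (auto simp: indicator_le_1 sq)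
    also have "\<dots> = (\<integral>p. indicator (sym_diff ?E E') p \<partial>M)"
      using XZ by (intro integral_cong_AE) (auto simp: E' indicator_def)
    also have "\<dots> = M.prob (sym_diff ?E E')"
      by (simp add: sets.Int_space_eq2)
    finally have "a < explained k (indicator A)" using k(3) by simp
    then have "a < explained l (indicator A)" if "l \<ge> k" for l
      using explained_mono[OF k(1) that f] by simp
    then show "\<forall>\<^sub>F k in sequentially. a < explained k (indicator A)"
      unfolding eventually_sequentially by blast
  }
qed

text \<open>Along depths whose least errors are below \<open>(1 / 2) ^ n\<close>, the conditional
  means rounded at 1 / 2 are wrong with summable probabilities. By Borel-Cantelli they are almost
  surely right from some n on.\<close>

lemma root_event_determined:
  assumes lim: "(\<lambda>k. explained k (indicator A)) \<longlonglongrightarrow> measure \<nu> A" and A[measurable]: "A \<in> sets borel"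
  shows "\<exists>B\<in>sets (generated_by M (tree d) W). AE p in M. X [] p \<in> A \<longleftrightarrow> p \<in> B"
proof -
  let ?f = "indicator A :: 's \<Rightarrow> real"
  have f: "?f \<in> borel_measurable borel" "\<And>x. \<bar>?f x\<bar> \<le> 1"
    by (auto simp: indicator_le_1)
  have sq: "(\<integral>x. (?f x)\<^sup>2 \<partial>\<nu>) = measure \<nu> A"
  proof -
    have "(\<lambda>x. (?f x)\<^sup>2) = ?f" by (auto simp: indicator_def)
    then show ?thesis by simp
  qed
  have Nil: "[] \<in> tree d" by (simp add: tree_def)
  note [measurable] = X_measurable[OF Nil]
  have "\<exists>k\<ge>1. measure \<nu> A - explained k ?f < (1 / 2) ^ n" for n
  proof -
    have "\<forall>\<^sub>F k in sequentially. measure \<nu> A - (1 / 2) ^ n < explained k ?f"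
      by (rule order_tendstoD(1)[OF lim]) simp
    then obtain k0 where "\<And>k. k \<ge> k0 \<Longrightarrow> measure \<nu> A - (1 / 2) ^ n < explained k ?f"
      by (auto simp: eventually_sequentially)
    from this[of "max k0 1"] show ?thesis by (intro exI[of _ "max k0 1"]) simp
  qed
  then obtain k where k: "\<And>n. k n \<ge> 1" "\<And>n. measure \<nu> A - explained (k n) ?f < (1 / 2) ^ n" by metis
  define Y where "Y n p = cond_mean (k n) ?f (marks_upto (k n) p)" for n p
  have YG: "Y n \<in> borel_measurable (generated_by M (tree d) W)" for n
    unfolding Y_def by (rule measurable_compose[OF marks_upto_generated cond_mean_measurable_restricted[OF f(1)]])
  have Ym[measurable]: "Y n \<in> borel_measurable M" for n
    unfolding Y_def by (rule measurable_compose[OF marks_upto_measurable cond_mean_measurable_restricted[OF f(1)]])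
  define D where "D n = {p \<in> space M. \<not> (X [] p \<in> A \<longleftrightarrow> Y n p > 1 / 2)}" for n
  have D[measurable]: "D n \<in> M.events" for n unfolding D_def by measurable
  have PD: "M.prob (D n) \<le> 4 * (1 / 2) ^ n" for n
  proof -
    have bY: "\<bar>Y n p\<bar> \<le> 1" for p unfolding Y_def by (rule cond_mean_bound[OF f(2)])
    have "M.prob (D n) = (\<integral>p. indicator (D n) p \<partial>M)" by (simp add: sets.Int_space_eq2)
    \<comment> \<open>Wrong rounding means that the prediction is off by at least 1 / 2, hence the
      factor 4.\<close>
    also have "\<dots> \<le> (\<integral>p. 4 * (?f (X [] p) - Y n p)\<^sup>2 \<partial>M)"
    proof (rule integral_mono)
      show "integrable M (indicator (D n) :: 'p \<Rightarrow> real)"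
        using D by (rule integrable_real_indicator) (simp add: M.emeasure_finite less_top[symmetric])
      show "integrable M (\<lambda>p. 4 * (?f (X [] p) - Y n p)\<^sup>2)"
        using bY f(2) by (intro integrable_mult_right integrable_bounded_real[OF M.prob_space_axioms, of _ 4])
          (auto intro!: power2_le_4 abs_diff_le_2)
      fix p assume "p \<in> space M"
      show "indicator (D n) p \<le> 4 * (?f (X [] p) - Y n p)\<^sup>2"
      proof (cases "p \<in> D n")
        case True
        then have "1 / 2 \<le> \<bar>?f (X [] p) - Y n p\<bar>" by (auto simp: D_def indicator_def)
        then have "(1 / 2)\<^sup>2 \<le> (?f (X [] p) - Y n p)\<^sup>2"
          by (metis abs_le_square_iff abs_of_nonneg half_gt_zero_iff less_eq_real_def zero_less_one)
        then show ?thesis using True by (simp add: power2_eq_square)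
      qed simp
    qed
    also have "\<dots> = 4 * (measure \<nu> A - explained (k n) ?f)"
      using mean_square_error_cond_mean[OF k(1) f, of n] by (simp add: sq Y_def)
    also have "\<dots> \<le> 4 * (1 / 2) ^ n" using k(2)[of n] by simp
    finally show ?thesis .
  qed
  have "summable (\<lambda>n. 4 * (1 / 2 :: real) ^ n)" by (intro summable_mult summable_geometric) simp
  then have "summable (\<lambda>n. M.prob (D n))"
    by (rule summable_comparison_test') (use PD in auto)
  then have AE: "AE p in M. eventually (\<lambda>n. p \<in> space M - D n) sequentially"
    by (intro borel_cantelli_AE1) (auto simp: M.emeasure_finite less_top[symmetric])
  define B where "B = {p \<in> space M. eventually (\<lambda>n. Y n p > 1 / 2) sequentially}"
  have "B = {p \<in> space (generated_by M (tree d) W). \<exists>N. \<forall>n\<ge>N. Y n p > 1 / 2}"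
    by (simp add: B_def eventually_sequentially)
  also have "\<dots> \<in> sets (generated_by M (tree d) W)" using YG by measurable
  finally have B: "B \<in> sets (generated_by M (tree d) W)" .
  have "AE p in M. X [] p \<in> A \<longleftrightarrow> p \<in> B"
    using AE
  proof eventually_elim
    case (elim p)
    then obtain N where N: "\<And>n. n \<ge> N \<Longrightarrow> p \<in> space M - D n" by (auto simp: eventually_sequentially)
    then have p: "p \<in> space M" and e: "\<And>n. n \<ge> N \<Longrightarrow> X [] p \<in> A \<longleftrightarrow> Y n p > 1 / 2" by (auto simp: D_def)
    show ?case
    proof
      assume "X [] p \<in> A"
      then show "p \<in> B" using p e by (auto simp: B_def eventually_sequentially)
    next
      assume "p \<in> B"
      then obtain N' where "\<And>n. n \<ge> N' \<Longrightarrow> Y n p > 1 / 2" by (auto simp: B_def eventually_sequentially)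
      from this[of "max N N'"] show "X [] p \<in> A" using e[of "max N N'"] by simp
    qed
  qed
  with B show ?thesis by blast
qed

text \<open>Countably many events determine a point of a separable metric space: those of lying in
  the balls of radius \<open>(1 / 2) ^ i\<close> around a dense sequence. Each has a version
  measurable in the marks, and completeness assembles the root value from them.\<close>

lemma explained_tendsto_imp_endogenous:
  assumes lim: "\<And>A. A \<in> sets borel \<Longrightarrow> (\<lambda>k. explained k (indicator A)) \<longlonglongrightarrow> measure \<nu> A"
  shows "endogenous d M W X"
proof -
  let ?N = "generated_by M (tree d) W"
  obtain D :: "'s set" where D: "countable D" "\<And>U. open U \<Longrightarrow> U \<noteq> {} \<Longrightarrow> \<exists>s\<in>D. s \<in> U"
    using countable_dense_exists by metis
  have "D \<noteq> {}" using D(2)[of UNIV] by auto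
  define s where "s = from_nat_into D"
  have s: "\<exists>n. dist x (s n) < e" if "e > 0" for x :: 's and e
  proof -
    have "\<exists>y\<in>D. y \<in> ball x e" using D(2)[of "ball x e"] that by auto
    then obtain y where "y \<in> D" "y \<in> ball x e" by blast
    moreover have "range s = D" using D(1) \<open>D \<noteq> {}\<close> by (simp add: s_def range_from_nat_into)
    ultimately show ?thesis by (metis mem_ball rangeE)
  qed
  let ?A = "\<lambda>i n. {x. dist x (s n) < (1 / 2 :: real) ^ i}"
  have A: "?A i n \<in> sets borel" for i n by measurable
  define good where "good i n B \<longleftrightarrow> B \<in> sets ?N \<and> (AE p in M. X [] p \<in> ?A i n \<longleftrightarrow> p \<in> B)" for i n B
  have "\<exists>B. good i n B" for i n
    using root_event_determined[OF lim[OF A[of n i]] A[of n i]] unfolding good_def by blast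
  then obtain B where "\<And>i n. good i n (B i n)" by metis
  then have B: "\<And>i n. B i n \<in> sets ?N" "\<And>i n. AE p in M. X [] p \<in> ?A i n \<longleftrightarrow> p \<in> B i n"
    unfolding good_def by blast+
  \<comment> \<open>If p lies in no \<open>B i n\<close> the least index is unspecified; almost
    surely this does not happen, by density.\<close>
  define Y where "Y i p = s (LEAST n. p \<in> B i n)" for i p
  have Y[measurable]: "Y i \<in> borel_measurable ?N" for i
  proof -
    have "(\<lambda>p. LEAST n. p \<in> B i n) \<in> measurable ?N (count_space UNIV)"
      using B(1) by (intro measurable_Least) auto
    from measurable_compose[OF this, of s borel] show ?thesis unfolding Y_def by simp
  qed
  define c where "c p \<longleftrightarrow> Cauchy (\<lambda>i. Y i p)" for p
  have c[measurable]: "Measurable.pred ?N c"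
    using sets_Collect_Cauchy[of Y ?N] Y by (simp add: pred_def c_def)
  \<comment> \<open>Replacing the sequence by a constant where it is not Cauchy makes it converge
    everywhere, so Z is measurable without exceptional points.\<close>
  define Z where "Z p = lim (\<lambda>i. if c p then Y i p else s 0)" for p
  have "Z \<in> borel_measurable ?N"
  proof (rule borel_measurable_LIMSEQ_metric)
    show "(\<lambda>p. if c p then Y i p else s 0) \<in> borel_measurable ?N" for i by measurable
    fix p
    have "convergent (\<lambda>i. if c p then Y i p else s 0)"
      by (cases "c p") (simp_all add: c_def Cauchy_convergent_iff convergent_const)
    then show "(\<lambda>i. if c p then Y i p else s 0) \<longlonglongrightarrow> Z p"
      unfolding Z_def by (simp add: convergent_LIMSEQ_iff)
  qed
  moreover have "AE p in M. X [] p = Z p"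
  proof -
    have "AE p in M. \<forall>i n. X [] p \<in> ?A i n \<longleftrightarrow> p \<in> B i n" using B(2) by (simp add: AE_all_countable)
    then show ?thesis
    proof eventually_elim
      case (elim p)
      have "dist (Y i p) (X [] p) < (1 / 2 :: real) ^ i" for i
      proof -
        obtain n where "dist (X [] p) (s n) < (1 / 2) ^ i" using s[of "(1 / 2) ^ i" "X [] p"] by auto
        then have "p \<in> B i n" using elim by blast
        then have "p \<in> B i (LEAST n. p \<in> B i n)" by (rule LeastI)
        then have "X [] p \<in> ?A i (LEAST n. p \<in> B i n)" by (rule elim[THEN spec, THEN spec, THEN iffD2])
        then show ?thesis by (simp add: Y_def dist_commute)
      qed
      note close = this
      have "(\<lambda>i. dist (Y i p) (X [] p)) \<longlonglongrightarrow> 0"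
      proof (rule tendsto_sandwich[where f="\<lambda>_. 0" and h="\<lambda>i. (1 / 2 :: real) ^ i"])
        show "\<forall>\<^sub>F i in sequentially. dist (Y i p) (X [] p) \<le> (1 / 2) ^ i"
          by (rule always_eventually) (use close in \<open>simp add: less_imp_le\<close>)
        show "(\<lambda>i. (1 / 2 :: real) ^ i) \<longlonglongrightarrow> 0" by (rule LIMSEQ_power_zero) simp
      qed simp_all
      then have *: "(\<lambda>i. Y i p) \<longlonglongrightarrow> X [] p" by (rule tendsto_dist_iff[THEN iffD2])
      then have "c p" unfolding c_def by (rule LIMSEQ_imp_Cauchy)
      then show "X [] p = Z p" using limI[OF *] by (simp add: Z_def)
    qed
  qed
  ultimately show ?thesis unfolding endogenous_def by blast
qed

end

section \<open>Limits of bivariate laws with fixed marginals\<close>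

lemma integral_PiM_nat_prod:
  fixes h :: "nat \<Rightarrow> 'a \<Rightarrow> real"
  assumes N: "prob_space N"
    and h: "\<And>i. h i \<in> borel_measurable N" "\<And>i x. x \<in> space N \<Longrightarrow> \<bar>h i x\<bar> \<le> 1"
  shows "(\<integral>x. (\<Prod>i<j. h i (x i)) \<partial>(iid N)) = (\<Prod>i<j. \<integral>x. h i x \<partial>N)"
  using h
proof (induction j arbitrary: h)
  case 0
  interpret prob_space "iid N" using N by (intro prob_space_PiM)
  show ?case by (simp add: prob_space)
next
  case (Suc j)
  let ?S = "iid N"
  note [measurable] = Suc.prems(1)
  have b: "\<bar>\<Prod>i<Suc j. h i (x i)\<bar> \<le> 1" if "x \<in> space ?S" for x
    unfolding abs_prod using Suc.prems(2) that by (intro prod_le_1) (auto simp: space_PiM PiE_iff)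
  have "(\<integral>x. (\<Prod>i<Suc j. h i (x i)) \<partial>?S) = (\<integral>s. \<integral>w. (\<Prod>i<Suc j. h i (case_nat s w i)) \<partial>?S \<partial>N)"
    by (rule integral_PiM_nat_fst[OF N _ b]) measurable
  also have "\<dots> = (\<integral>s. h 0 s * (\<integral>w. (\<Prod>i<j. h (Suc i) (w i)) \<partial>?S) \<partial>N)"
    by (simp add: prod.lessThan_Suc_shift del: prod.lessThan_Suc)
  also have "\<dots> = (\<integral>s. h 0 s \<partial>N) * (\<Prod>i<j. \<integral>x. h (Suc i) x \<partial>N)"
    using Suc.IH[of "\<lambda>i. h (Suc i)"] Suc.prems by simp
  finally show ?case by (simp add: prod.lessThan_Suc_shift del: prod.lessThan_Suc)
qed

lemma compact_inner_approximation:
  fixes \<nu> :: "'s::polish_space measure"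
  assumes "prob_space \<nu>" "sets \<nu> = sets borel" "B \<in> sets borel" "\<epsilon> > 0"
  shows "\<exists>K. compact K \<and> K \<subseteq> B \<and> measure \<nu> (B - K) < \<epsilon>"
proof -
  interpret prob_space \<nu> by fact
  have "emeasure \<nu> B = (SUP K \<in> {K. K \<subseteq> B \<and> compact K}. emeasure \<nu> K)"
    using assms by (intro inner_regular) (auto simp: emeasure_finite)
  \<comment> \<open>Going strictly below the supremum requires positive measure; for a null set the
    empty set serves as K.\<close>
  moreover have "emeasure \<nu> B - ennreal \<epsilon> < emeasure \<nu> B \<or> emeasure \<nu> B = 0"
  proof (cases "measure \<nu> B = 0")
    case False
    then have "0 < measure \<nu> B" by (simp add: order_less_le)
    then show ?thesis using assms(4) by (auto simp: emeasure_eq_measure ennreal_minus_if ennreal_less_iff)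
  qed (simp add: emeasure_eq_measure)
  ultimately have "emeasure \<nu> B = 0 \<or> (\<exists>K. K \<subseteq> B \<and> compact K \<and> emeasure \<nu> B - ennreal \<epsilon> < emeasure \<nu> K)"
    by (auto simp: less_SUP_iff)
  then show ?thesis
  proof
    assume "emeasure \<nu> B = 0"
    then show ?thesis using assms by (intro exI[of _ "{}"]) (simp add: measure_def)
  next
    assume "\<exists>K. K \<subseteq> B \<and> compact K \<and> emeasure \<nu> B - ennreal \<epsilon> < emeasure \<nu> K"
    then obtain K where K: "K \<subseteq> B" "compact K" "emeasure \<nu> B - ennreal \<epsilon> < emeasure \<nu> K" by blast
    have Ks: "K \<in> sets \<nu>" using K(2) assms(2) by (simp add: borel_closed compact_imp_closed)
    have "measure \<nu> B - \<epsilon> < measure \<nu> K"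
    proof (cases "\<epsilon> \<le> measure \<nu> B")
      case True
      then show ?thesis using K(3) assms(4)
        by (simp add: emeasure_eq_measure ennreal_minus ennreal_less_iff[of "measure \<nu> B - \<epsilon>"])
    next
      case False
      then show ?thesis using measure_nonneg[of \<nu> K] by linarith
    qed
    then have "measure \<nu> (B - K) < \<epsilon>"
      using K Ks assms by (subst finite_measure_Diff) auto
    then show ?thesis using K by blast
  qed
qed

lemma open_outer_approximation:
  fixes \<nu> :: "'s::polish_space measure"
  assumes "prob_space \<nu>" "sets \<nu> = sets borel" "B \<in> sets borel" "\<epsilon> > 0"
  shows "\<exists>U. open U \<and> B \<subseteq> U \<and> measure \<nu> (U - B) < \<epsilon>"
proof -
  interpret prob_space \<nu> by fact
  obtain K where K: "compact K" "K \<subseteq> - B" "measure \<nu> (- B - K) < \<epsilon>"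
    using compact_inner_approximation[of \<nu> "- B" \<epsilon>] assms by auto
  have "open (- K)" "B \<subseteq> - K" "- K - B = - B - K" using K by (auto simp: compact_imp_closed)
  then show ?thesis using K by metis
qed

lemma rectangle_diff_bound:
  fixes P :: "('a \<times> 'b) measure"
  assumes "prob_space P" "sets P = sets (N1 \<Otimes>\<^sub>M N2)"
    and A: "A \<in> sets N1" "C \<in> sets N1" and B: "B \<in> sets N2" "D \<in> sets N2"
  shows "measure P (A \<times> B) \<le> measure P (C \<times> D) + measure (distr P N1 fst) (A - C) + measure (distr P N2 snd) (B - D)"
proof -
  interpret prob_space P by fact
  note [measurable_cong] = assms(2)
  have sp: "space P = space N1 \<times> space N2" using sets_eq_imp_space_eq[OF assms(2)] by (simp add: space_pair_measure)
  have AC: "A - C \<in> sets N1" "B - D \<in> sets N2" using A B by auto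
  have f: "fst \<in> measurable P N1" "snd \<in> measurable P N2" by simp_all
  have s: "C \<times> D \<in> sets P" "fst -` (A - C) \<inter> space P \<in> sets P" "snd -` (B - D) \<inter> space P \<in> sets P"
    using A B measurable_sets[OF f(1) AC(1)] measurable_sets[OF f(2) AC(2)] by (auto simp: assms(2))
  have "measure P (A \<times> B) \<le> measure P ((C \<times> D \<union> (fst -` (A - C) \<inter> space P)) \<union> (snd -` (B - D) \<inter> space P))"
    using s sets.sets_into_space[OF A(1)] sets.sets_into_space[OF B(1)]
    by (intro finite_measure_mono) (auto simp: sp)
  also have "\<dots> \<le> measure P (C \<times> D \<union> (fst -` (A - C) \<inter> space P)) + measure P (snd -` (B - D) \<inter> space P)"
    using s by (intro measure_Un_le) auto
  also have "measure P (C \<times> D \<union> (fst -` (A - C) \<inter> space P)) \<le> measure P (C \<times> D) + measure P (fst -` (A - C) \<inter> space P)"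
    using s by (intro measure_Un_le) auto
  finally show ?thesis using AC f by (simp add: measure_distr)
qed

text \<open>
  With fixed marginals on a Polish space, a limit on rectangles is automatically countably additive:
  the marginals provide uniform approximation by compact and open rectangles.
\<close>

lemma setwise_limit_measure:
  fixes P :: "nat \<Rightarrow> ('s::polish_space \<times> 's) measure"
  assumes \<nu>: "prob_space \<nu>" "sets \<nu> = sets borel"
    and P: "\<And>k. prob_space (P k)" and s: "\<And>k. sets (P k) = sets (borel \<Otimes>\<^sub>M borel)"
    and marg: "\<And>k. distr (P k) borel fst = \<nu>" "\<And>k. distr (P k) borel snd = \<nu>"
    and conv: "\<And>A B. A \<in> sets borel \<Longrightarrow> B \<in> sets borel \<Longrightarrow> convergent (\<lambda>k. measure (P k) (A \<times> B))"
  shows "\<exists>Q. prob_space Q \<and> sets Q = sets (borel \<Otimes>\<^sub>M borel) \<and>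
    (\<forall>A\<in>sets borel. \<forall>B\<in>sets borel. (\<lambda>k. measure (P k) (A \<times> B)) \<longlonglongrightarrow> measure Q (A \<times> B))"
proof -
  interpret \<nu>: prob_space \<nu> by fact
  define Rc where "Rc = {A \<times> B |A B. A \<in> sets (borel :: 's measure) \<and> B \<in> sets (borel :: 's measure)}"
  define l where "l E = lim (\<lambda>k. measure (P k) E)" for E
  have RcI: "A \<in> sets borel \<Longrightarrow> B \<in> sets borel \<Longrightarrow> A \<times> B \<in> Rc" for A B by (auto simp: Rc_def)
  have Rs: "E \<in> sets (P k)" if "E \<in> Rc" for E k using that by (auto simp: Rc_def s)
  have lim: "(\<lambda>k. measure (P k) E) \<longlonglongrightarrow> l E" if "E \<in> Rc" for E
    using that conv unfolding l_def Rc_def by (auto simp: convergent_LIMSEQ_iff)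
  have l0: "0 \<le> l E" if "E \<in> Rc" for E
    by (rule LIMSEQ_le_const[OF lim[OF that]]) simp
  \<comment> \<open>Rectangles form a semiring, so Caratheodory's theorem asks for countable
    additivity only where the disjoint union is itself a rectangle.\<close>
  interpret semiring_of_sets UNIV Rc
  proof
    show "Rc \<subseteq> Pow UNIV" by simp
    show "{} \<in> Rc" using RcI[of "{}" "{}"] by simp
    fix a b assume "a \<in> Rc" "b \<in> Rc"
    then obtain A B C D where ab: "a = A \<times> B" "b = C \<times> D" "A \<in> sets borel" "B \<in> sets borel" "C \<in> sets borel" "D \<in> sets borel"
      by (auto simp: Rc_def)
    show "a \<inter> b \<in> Rc" unfolding ab(1,2) Times_Int_Times by (intro RcI sets.Int ab)
    have "a - b = \<Union>{(A - C) \<times> B, (A \<inter> C) \<times> (B - D)}" by (auto simp: ab)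
    moreover have "disjoint {(A - C) \<times> B, (A \<inter> C) \<times> (B - D)}" by (auto simp: disjoint_def)
    moreover have "{(A - C) \<times> B, (A \<inter> C) \<times> (B - D)} \<subseteq> Rc" using ab by (auto intro!: RcI)
    ultimately show "\<exists>C\<subseteq>Rc. finite C \<and> disjoint C \<and> a - b = \<Union> C" by blast
  qed
  have sums: "(\<lambda>i. l (E i)) sums l (\<Union>i. E i)"
    if E: "range E \<subseteq> Rc" "disjoint_family E" "(\<Union>i. E i) \<in> Rc" for E
  proof -
    have Ei: "E i \<in> Rc" for i using E(1) by blast
    have upper: "(\<Sum>i<n. l (E i)) \<le> l (\<Union>i. E i)" for n
    proof (rule LIMSEQ_le)
      show "(\<lambda>k. \<Sum>i<n. measure (P k) (E i)) \<longlonglongrightarrow> (\<Sum>i<n. l (E i))" by (intro tendsto_sum lim Ei)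
      show "(\<lambda>k. measure (P k) (\<Union>i. E i)) \<longlonglongrightarrow> l (\<Union>i. E i)" by (intro lim E)
      have "(\<Sum>i<n. measure (P k) (E i)) \<le> measure (P k) (\<Union>i. E i)" for k
      proof -
        interpret Pk: prob_space "P k" by (rule P)
        have "(\<Sum>i<n. measure (P k) (E i)) = measure (P k) (\<Union>i<n. E i)"
          using E(2) Rs[OF Ei] by (intro Pk.finite_measure_finite_Union[symmetric]) (auto simp: disjoint_family_on_def)
        also have "\<dots> \<le> measure (P k) (\<Union>i. E i)"
          using Rs[OF E(3)] by (intro Pk.finite_measure_mono) auto
        finally show ?thesis .
      qed
      then show "\<exists>N. \<forall>k\<ge>N. (\<Sum>i<n. measure (P k) (E i)) \<le> measure (P k) (\<Union>i. E i)" by blast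
    qed
    have sm: "summable (\<lambda>i. l (E i))"
      using upper l0[OF Ei] by (intro summableI_nonneg_bounded) auto
    have "\<exists>C D. E i = C \<times> D \<and> C \<in> sets borel \<and> D \<in> sets borel" for i using Ei[of i] by (auto simp: Rc_def)
    then obtain C D where CD: "\<And>i. E i = C i \<times> D i" "\<And>i. C i \<in> sets borel" "\<And>i. D i \<in> sets borel" by metis
    obtain A B where AB: "(\<Union>i. E i) = A \<times> B" "A \<in> sets borel" "B \<in> sets borel" using E(3) by (auto simp: Rc_def)
    \<comment> \<open>A compact rectangle inside and open rectangles outside reduce the countable
      cover to a finite one. The errors depend on the marginals alone, so they are uniform in k and
      survive the limit.\<close>
    have lower: "l (A \<times> B) \<le> suminf (\<lambda>i. l (E i)) + e" if e: "e > 0" for e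
    proof -
      \<comment> \<open>Shrinking A and B costs 2 \<delta>; enlarging both sides of every
        \<open>E i\<close> costs at most the geometric sum 4 \<delta>.\<close>
      define \<delta> where "\<delta> = e / 6"
      have \<delta>: "\<delta> > 0" using e by (simp add: \<delta>_def)
      obtain K L where K: "compact K" "K \<subseteq> A" "measure \<nu> (A - K) < \<delta>" and L: "compact L" "L \<subseteq> B" "measure \<nu> (B - L) < \<delta>"
        using compact_inner_approximation[OF \<nu> AB(2) \<delta>] compact_inner_approximation[OF \<nu> AB(3) \<delta>] by blast
      have "\<exists>U. open U \<and> C i \<subseteq> U \<and> measure \<nu> (U - C i) < \<delta> * (1 / 2) ^ i" for i
        using \<delta> CD by (intro open_outer_approximation[OF \<nu>]) auto
      then obtain U where U: "\<And>i. open (U i)" "\<And>i. C i \<subseteq> U i" "\<And>i. measure \<nu> (U i - C i) < \<delta> * (1 / 2) ^ i" by metis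
      have "\<exists>U. open U \<and> D i \<subseteq> U \<and> measure \<nu> (U - D i) < \<delta> * (1 / 2) ^ i" for i
        using \<delta> CD by (intro open_outer_approximation[OF \<nu>]) auto
      then obtain V where V: "\<And>i. open (V i)" "\<And>i. D i \<subseteq> V i" "\<And>i. measure \<nu> (V i - D i) < \<delta> * (1 / 2) ^ i" by metis
      have "K \<times> L \<subseteq> (\<Union>i. U i \<times> V i)"
      proof -
        have "K \<times> L \<subseteq> A \<times> B" using K L by auto
        also have "\<dots> = (\<Union>i. C i \<times> D i)" using AB(1) CD(1) by simp
        also have "\<dots> \<subseteq> (\<Union>i. U i \<times> V i)" using U(2) V(2) by blast
        finally show ?thesis .
      qed
      note cover = this
      have op: "open (U i \<times> V i)" if "i \<in> UNIV" for i using U(1) V(1) by (rule open_Times)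
      obtain F where F: "finite F" "K \<times> L \<subseteq> (\<Union>i\<in>F. U i \<times> V i)"
        by (rule compactE_image[OF compact_Times[OF K(1) L(1)] op cover]) blast
      have Kb: "K \<in> sets borel" "L \<in> sets borel" and Ub: "U i \<in> sets borel" "V i \<in> sets borel" for i
        using K L U V by (auto simp: compact_imp_closed)
      have geo: "(\<Sum>i\<in>F. 2 * (\<delta> * (1 / 2) ^ i)) \<le> 4 * \<delta>"
      proof -
        have "(\<lambda>i. 2 * (\<delta> * (1 / 2) ^ i)) sums (2 * (\<delta> * 2))"
          using geometric_sums[of "1 / 2 :: real"] by (intro sums_mult) simp
        then show ?thesis
          using sum_le_suminf[of "\<lambda>i. 2 * (\<delta> * (1 / 2) ^ i)" F] F(1) \<delta> by (auto simp: sums_iff)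
      qed
      have "measure (P k) (A \<times> B) \<le> (\<Sum>i\<in>F. measure (P k) (E i)) + e" for k
      proof -
        interpret Pk: prob_space "P k" by (rule P)
        have UVs: "U i \<times> V i \<in> sets (P k)" for i using Ub by (auto simp: s)
        have "measure (P k) (A \<times> B) \<le> measure (P k) (K \<times> L) + measure \<nu> (A - K) + measure \<nu> (B - L)"
          using rectangle_diff_bound[OF P s AB(2) Kb(1) AB(3) Kb(2)] by (simp add: marg)
        also have "measure (P k) (K \<times> L) \<le> measure (P k) (\<Union>i\<in>F. U i \<times> V i)"
          using F UVs by (intro Pk.finite_measure_mono) auto
        also have "\<dots> \<le> (\<Sum>i\<in>F. measure (P k) (U i \<times> V i))"
          using F UVs by (intro Pk.finite_measure_subadditive_finite) auto
        also have "\<dots> \<le> (\<Sum>i\<in>F. measure (P k) (E i) + 2 * (\<delta> * (1 / 2) ^ i))"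
        proof (rule sum_mono)
          fix i
          show "measure (P k) (U i \<times> V i) \<le> measure (P k) (E i) + 2 * (\<delta> * (1 / 2) ^ i)"
            using rectangle_diff_bound[OF P s Ub(1) CD(2) Ub(2) CD(3), of k i i i i] U(3)[of i] V(3)[of i]
            by (simp add: marg CD(1))
        qed
        also have "\<dots> \<le> (\<Sum>i\<in>F. measure (P k) (E i)) + 4 * \<delta>" using geo by (simp add: sum.distrib)
        finally show ?thesis using K(3) L(3) by (simp add: \<delta>_def)
      qed
      then have "l (A \<times> B) \<le> (\<Sum>i\<in>F. l (E i)) + e"
        using lim[OF RcI[OF AB(2,3)]] by (intro LIMSEQ_le[OF _ tendsto_add[OF tendsto_sum[OF lim[OF Ei]] tendsto_const]]) auto
      also have "(\<Sum>i\<in>F. l (E i)) \<le> suminf (\<lambda>i. l (E i))"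
        using sm F(1) l0[OF Ei] by (intro sum_le_suminf) auto
      finally show ?thesis by simp
    qed
    have "suminf (\<lambda>i. l (E i)) \<le> l (\<Union>i. E i)" using sm upper by (intro suminf_le_const) auto
    moreover have "l (\<Union>i. E i) \<le> suminf (\<lambda>i. l (E i))" unfolding AB(1) by (rule field_le_epsilon) (rule lower)
    ultimately show ?thesis using sm by (simp add: sums_iff)
  qed
  have "\<exists>\<mu>'. (\<forall>E\<in>Rc. \<mu>' E = ennreal (l E)) \<and> measure_space UNIV (sigma_sets UNIV Rc) \<mu>'"
  proof (rule caratheodory)
    have "l {} = 0" by (simp add: l_def)
    then show "positive Rc (\<lambda>E. ennreal (l E))" by (simp add: positive_def)
    show "countably_additive Rc (\<lambda>E. ennreal (l E))"
    proof (rule countably_additiveI)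
      fix E :: "nat \<Rightarrow> ('s \<times> 's) set" assume E: "range E \<subseteq> Rc" "disjoint_family E" "(\<Union>i. E i) \<in> Rc"
      have "0 \<le> l (E i)" for i using E(1) by (intro l0) auto
      with sums[OF E] show "(\<Sum>i. ennreal (l (E i))) = ennreal (l (\<Union>i. E i))"
        by (simp add: suminf_ennreal2 sums_iff)
    qed
  qed
  then obtain \<mu>' where \<mu>': "\<And>E. E \<in> Rc \<Longrightarrow> \<mu>' E = ennreal (l E)" "measure_space UNIV (sigma_sets UNIV Rc) \<mu>'" by blast
  define Q where "Q = measure_of UNIV Rc \<mu>'"
  have sQ: "sets Q = sets (borel \<Otimes>\<^sub>M borel)"
  proof -
    have "sets Q = sigma_sets UNIV Rc" unfolding Q_def by (rule sets_measure_of) simp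
    also have "\<dots> = sets (borel \<Otimes>\<^sub>M borel)"
      unfolding sets_pair_measure Rc_def space_borel UNIV_Times_UNIV ..
    finally show ?thesis .
  qed
  have eQ: "emeasure Q E = ennreal (l E)" if "E \<in> Rc" for E
  proof -
    have "emeasure Q E = \<mu>' E"
      by (rule emeasure_measure_of[OF Q_def])
        (use that \<mu>'(2) sets_measure_of[of Rc UNIV \<mu>'] in \<open>auto simp: measure_space_def Q_def\<close>)
    then show ?thesis using \<mu>'(1)[OF that] by simp
  qed
  have U: "UNIV \<in> Rc" using RcI[of UNIV UNIV] by simp
  have "l UNIV = 1"
  proof (rule LIMSEQ_unique[OF lim[OF U]])
    have "measure (P k) UNIV = 1" for k
      using prob_space.prob_space[OF P[of k]] sets_eq_imp_space_eq[OF s[of k]] by (simp add: space_pair_measure)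
    then show "(\<lambda>k. measure (P k) UNIV) \<longlonglongrightarrow> 1" by simp
  qed
  then have "prob_space Q"
    using eQ[OF U] sets_eq_imp_space_eq[OF sQ] by (intro prob_spaceI) (simp add: space_pair_measure)
  moreover have "(\<lambda>k. measure (P k) (A \<times> B)) \<longlonglongrightarrow> measure Q (A \<times> B)" if "A \<in> sets borel" "B \<in> sets borel" for A B
  proof -
    have "measure Q (A \<times> B) = l (A \<times> B)"
      using eQ[OF RcI[OF that]] l0[OF RcI[OF that]] by (simp add: measure_def)
    then show ?thesis using lim[OF RcI[OF that]] by simp
  qed
  ultimately show ?thesis using sQ by blast
qed

text \<open>Setwise limits pass to complements, but along a countable disjoint union mass may
  escape. Here u has the same law under every \<open>P k\<close> and Q, so its masses on the pieces
  form a summable bound uniform in k and Tannery's theorem applies. The fixed set F allows one side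
  of a rectangle to vary while the other is held.\<close>

lemma measure_tendsto_from_generator:
  assumes P: "\<And>k. prob_space (P k)" "\<And>k. sets (P k) = sets Q" and Q: "prob_space Q"
    and u: "u \<in> measurable Q N" and marg: "\<And>k. distr (P k) N u = distr Q N u"
    and F: "F \<in> sets Q"
    and G: "Int_stable G" "space N \<in> G" "sets N = sigma_sets (space N) G" "G \<subseteq> Pow (space N)"
    and conv: "\<And>C. C \<in> G \<Longrightarrow> (\<lambda>k. measure (P k) (u -` C \<inter> F)) \<longlonglongrightarrow> measure Q (u -` C \<inter> F)"
    and C: "C \<in> sets N"
  shows "(\<lambda>k. measure (P k) (u -` C \<inter> F)) \<longlonglongrightarrow> measure Q (u -` C \<inter> F)"
proof -
  interpret Q: prob_space Q by fact
  have spP: "space (P k) = space Q" for k using sets_eq_imp_space_eq[OF P(2)] .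
  have up: "u \<in> measurable (P k) N" for k using u by (subst measurable_cong_sets[OF P(2) refl])
  have Fs: "F \<subseteq> space Q" using sets.sets_into_space[OF F] .
  have us: "u -` C \<inter> F \<in> sets Q" if "C \<in> sets N" for C
  proof -
    have "u -` C \<inter> F = (u -` C \<inter> space Q) \<inter> F" using Fs by auto
    then show ?thesis using measurable_sets[OF u that] F by auto
  qed
  have C': "C \<in> sigma_sets (space N) G" using C G(3) by simp
  show ?thesis
    using G(1,4) C'
  proof (induction rule: sigma_sets_induct_disjoint)
    case (basic A)
    then show ?case by (rule conv)
  next
    case empty
    show ?case by simp
  next
    case (compl A)
    then have A: "A \<in> sets N" using G(3) by simp
    have eq: "u -` (space N - A) \<inter> F = u -` space N \<inter> F - u -` A \<inter> F" by auto
    have N: "space N \<in> sets N" by simp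
    have "measure (P k) (u -` (space N - A) \<inter> F) = measure (P k) (u -` space N \<inter> F) - measure (P k) (u -` A \<inter> F)" for k
    proof -
      interpret Pk: prob_space "P k" by (rule P)
      show ?thesis unfolding eq
        using us[OF A] us[OF N] sets.sets_into_space[OF A] by (intro Pk.finite_measure_Diff) (auto simp: P(2))
    qed
    moreover have "measure Q (u -` (space N - A) \<inter> F) = measure Q (u -` space N \<inter> F) - measure Q (u -` A \<inter> F)"
      unfolding eq using us[OF A] us[OF N] sets.sets_into_space[OF A] by (intro Q.finite_measure_Diff) auto
    ultimately show ?case using tendsto_diff[OF conv[OF G(2)] compl(2)] by simp
  next
    case (union A)
    then have A: "A i \<in> sets N" for i using G(3) by auto
    have eq: "u -` (\<Union>i. A i) \<inter> F = (\<Union>i. u -` A i \<inter> F)" by auto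
    have dis: "disjoint_family (\<lambda>i. u -` A i \<inter> F)" using union(1) by (auto simp: disjoint_family_on_def)
    have sumQ: "(\<lambda>i. measure Q (u -` A i \<inter> F)) sums measure Q (u -` (\<Union>i. A i) \<inter> F)"
      unfolding eq using us[OF A] dis by (intro Q.finite_measure_UNION) auto
    have sumP: "(\<lambda>i. measure (P k) (u -` A i \<inter> F)) sums measure (P k) (u -` (\<Union>i. A i) \<inter> F)" for k
    proof -
      interpret Pk: prob_space "P k" by (rule P)
      show ?thesis unfolding eq using us[OF A] dis by (intro Pk.finite_measure_UNION) (auto simp: P(2))
    qed
    define a where "a i = measure (distr Q N u) (A i)" for i
    have "summable a"
    proof -
      interpret D: prob_space "distr Q N u" using u by (rule Q.prob_space_distr)
      have "(\<lambda>i. measure (distr Q N u) (A i)) sums measure (distr Q N u) (\<Union>i. A i)"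
        using A union(1) by (intro D.finite_measure_UNION) auto
      then show ?thesis unfolding a_def by (rule sums_summable)
    qed
    have bound: "measure (P k) (u -` A i \<inter> F) \<le> a i" for k i
    proof -
      interpret Pk: prob_space "P k" by (rule P)
      have "measure (P k) (u -` A i \<inter> F) \<le> measure (P k) (u -` A i \<inter> space (P k))"
        using Fs measurable_sets[OF up A] by (intro Pk.finite_measure_mono) (auto simp: spP)
      also have "\<dots> = a i" using A up by (simp add: a_def marg[of k, symmetric] measure_distr)
      finally show ?thesis .
    qed
    have "(\<lambda>k. suminf (\<lambda>i. measure (P k) (u -` A i \<inter> F))) \<longlonglongrightarrow> suminf (\<lambda>i. measure Q (u -` A i \<inter> F))"
    proof (rule tannerys_theorem[THEN conjunct2, THEN conjunct2])
      show "\<forall>\<^sub>F (i, k) in sequentially \<times>\<^sub>F sequentially. norm (measure (P k) (u -` A i \<inter> F)) \<le> a i"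
        by (rule always_eventually) (auto simp: bound)
    qed (use \<open>summable a\<close> union(3) in simp_all)
    then show ?case
      unfolding sums_unique[OF sumP, symmetric] sums_unique[OF sumQ, symmetric] .
  qed
qed

section \<open>Cylinders and the laws of two copies with shared marks\<close>

definition cylinder :: "nat \<Rightarrow> (nat \<Rightarrow> 'a set) \<Rightarrow> (nat \<Rightarrow> 'a) set"
  where "cylinder j C = {x. \<forall>i<j. x i \<in> C i}"

abbreviation "borel_cylinders \<equiv> {cylinder j C |j C. \<forall>i. C i \<in> sets borel}"

lemma indicator_cylinder: "indicator (cylinder j C) x = (\<Prod>i<j. indicator (C i) (x i) :: real)"
  by (induction j) (auto simp: cylinder_def indicator_def less_Suc_eq)

lemma cylinder_extend:
  "j \<le> n \<Longrightarrow> cylinder j C = cylinder n (\<lambda>i. if i < j then C i else UNIV)"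
  by (auto simp: cylinder_def)

lemma cylinder_UNIV [simp]: "cylinder j (\<lambda>_. UNIV) = UNIV"
  by (simp add: cylinder_def)

lemma cylinder_sets [measurable]:
  "(\<And>i. C i \<in> sets borel) \<Longrightarrow> cylinder j C \<in> sets (iid borel)"
proof -
  assume [measurable]: "\<And>i. C i \<in> sets borel"
  have "{x \<in> space (iid borel). \<forall>i<j. x i \<in> C i} \<in> sets (iid borel)"
    by measurable
  then show ?thesis by (simp add: cylinder_def space_PiM)
qed

lemma Int_stable_cylinders: "Int_stable borel_cylinders"
proof (rule Int_stableI)
  fix a b :: "(nat \<Rightarrow> 'a::topological_space) set"
  assume "a \<in> borel_cylinders" "b \<in> borel_cylinders"
  then obtain j C j' D where a: "a = cylinder j C" "\<And>i. C i \<in> sets borel" and b: "b = cylinder j' D" "\<And>i. D i \<in> sets borel"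
    by blast
  define C' where "C' i = (if i < j then C i else UNIV)" for i
  define D' where "D' i = (if i < j' then D i else UNIV)" for i
  have "a = cylinder (max j j') C'" "b = cylinder (max j j') D'"
    unfolding a(1) b(1) C'_def D'_def by (intro cylinder_extend; simp)+
  then have "a \<inter> b = cylinder (max j j') (\<lambda>i. C' i \<inter> D' i)" by (simp add: cylinder_def Int_def set_eq_iff) blast
  moreover have "C' i \<inter> D' i \<in> sets borel" for i using a(2) b(2) by (simp add: C'_def D'_def)
  ultimately show "a \<inter> b \<in> borel_cylinders" by blast
qed

lemma sets_PiM_cylinders:
  "sets (iid borel) = sigma_sets UNIV (borel_cylinders :: (nat \<Rightarrow> 'a::topological_space) set set)"
proof
  let ?S = "iid (borel :: 'a measure)"
  have "sigma_sets (space ?S) borel_cylinders \<subseteq> sets ?S"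
    by (rule sets.sigma_sets_subset) auto
  then show "sigma_sets UNIV borel_cylinders \<subseteq> sets ?S" by (simp add: space_PiM)
  show "sets ?S \<subseteq> sigma_sets UNIV borel_cylinders"
    unfolding sets_PiM space_borel PiE_UNIV_domain
  proof (simp, rule sigma_sets_mono')
    show "prod_algebra UNIV (\<lambda>_. borel :: 'a measure) \<subseteq> borel_cylinders"
    proof
      fix A assume "A \<in> prod_algebra UNIV (\<lambda>_ :: nat. borel :: 'a measure)"
      then obtain J E where J: "A = prod_emb UNIV (\<lambda>_. borel) J (Pi\<^sub>E J E)" "finite J" "\<And>i. i \<in> J \<Longrightarrow> E i \<in> sets borel"
        by (rule prod_algebraE) blast
      obtain n where n: "J \<subseteq> {..<n}" using J(2) finite_nat_iff_bounded by blast
      have "A = cylinder n (\<lambda>i. if i \<in> J then E i else UNIV)"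
        using n by (auto simp: J(1) prod_emb_def PiE_iff cylinder_def subset_eq)
      then show "A \<in> borel_cylinders" using J(3) by (intro CollectI exI conjI) auto
    qed
  qed
qed

lemma measure_eq_cylinders:
  fixes P Q :: "(nat \<Rightarrow> 'a::topological_space) measure"
  assumes P: "prob_space P" "sets P = sets (iid borel)"
    and Q: "prob_space Q" "sets Q = sets (iid borel)"
    and eq: "\<And>j C. (\<And>i. C i \<in> sets borel) \<Longrightarrow> measure P (cylinder j C) = measure Q (cylinder j C)"
  shows "P = Q"
proof -
  interpret P: prob_space P by fact
  interpret Q: prob_space Q by fact
  show ?thesis
  proof (rule measure_eqI_generator_eq[OF Int_stable_cylinders, where \<Omega>=UNIV and A="\<lambda>_. UNIV"])
    show "emeasure P A = emeasure Q A" if "A \<in> borel_cylinders" for A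
      using that eq by (auto simp: P.emeasure_eq_measure Q.emeasure_eq_measure)
    show "range (\<lambda>_. UNIV) \<subseteq> borel_cylinders"
      using cylinder_UNIV[of 0] by (auto intro!: exI[of _ 0] exI[of _ "\<lambda>_. UNIV"])
  qed (auto simp: P(2) Q(2) sets_PiM_cylinders P.emeasure_finite)
qed

text \<open>Kept generic because it is used twice: for a single tree in \<open>pair_law\<close> and
  for the sequence of subtrees below the root in \<open>seq_law\<close>.\<close>

definition shared_copies :: "'l measure \<Rightarrow> 'b measure \<Rightarrow> 'e measure \<Rightarrow> ('l \<times> 'b \<Rightarrow> 'e) \<Rightarrow> ('e \<times> 'e) measure"
  where "shared_copies L B E V = distr (L \<Otimes>\<^sub>M (B \<Otimes>\<^sub>M B)) (E \<Otimes>\<^sub>M E) (\<lambda>z. (V (fst z, fst (snd z)), V (fst z, snd (snd z))))"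

lemma sets_shared_copies [simp]: "sets (shared_copies L B E V) = sets (E \<Otimes>\<^sub>M E)"
  by (simp add: shared_copies_def)

context
  fixes L :: "'l measure" and B :: "'b measure" and E :: "'e measure" and V :: "'l \<times> 'b \<Rightarrow> 'e"
  assumes L: "prob_space L" and B: "prob_space B" and V [measurable]: "V \<in> measurable (L \<Otimes>\<^sub>M B) E"
begin

lemma prob_space_shared_copies: "prob_space (shared_copies L B E V)"
proof -
  interpret L: prob_space L by fact
  interpret B: prob_space B by fact
  interpret BB: pair_prob_space B B ..
  interpret LBB: pair_prob_space L "B \<Otimes>\<^sub>M B" ..
  show ?thesis unfolding shared_copies_def by (rule LBB.prob_space_distr) measurable
qed

text \<open>Given the shared part the two copies are independent, so the probability factorizes
  under the integral over L.\<close>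

lemma measure_shared_copies:
  assumes [measurable]: "C \<in> sets E" "D \<in> sets E"
  shows "measure (shared_copies L B E V) (C \<times> D)
    = (\<integral>l. (\<integral>b. indicator C (V (l, b)) \<partial>B) * (\<integral>b. indicator D (V (l, b)) \<partial>B) \<partial>L)"
proof -
  interpret L: prob_space L by fact
  interpret B: prob_space B by fact
  interpret BB: pair_prob_space B B ..
  interpret LBB: pair_prob_space L "B \<Otimes>\<^sub>M B" ..
  interpret SC: prob_space "shared_copies L B E V" by (rule prob_space_shared_copies)
  let ?c = "\<lambda>z. indicator C (fst z) * indicator D (snd z) :: real"
  have m: "(\<lambda>z. (V (fst z, fst (snd z)), V (fst z, snd (snd z)))) \<in> measurable (L \<Otimes>\<^sub>M (B \<Otimes>\<^sub>M B)) (E \<Otimes>\<^sub>M E)"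
    by measurable
  have "C \<times> D \<in> sets (shared_copies L B E V)" by simp
  then have "measure (shared_copies L B E V) (C \<times> D) = (\<integral>z. indicator (C \<times> D) z \<partial>shared_copies L B E V)"
    by (simp add: sets.Int_space_eq2)
  also have "\<dots> = (\<integral>z. ?c z \<partial>shared_copies L B E V)"
    by (intro Bochner_Integration.integral_cong refl) (auto simp: indicator_def)
  also have "\<dots> = (\<integral>z. ?c (V (fst z, fst (snd z)), V (fst z, snd (snd z))) \<partial>(L \<Otimes>\<^sub>M (B \<Otimes>\<^sub>M B)))"
    unfolding shared_copies_def by (rule integral_distr[OF m]) measurable
  also have "\<dots> = (\<integral>l. \<integral>z. ?c (V (l, fst z), V (l, snd z)) \<partial>(B \<Otimes>\<^sub>M B) \<partial>L)"
    by (subst integral_pair_bounded_fst[OF L BB.prob_space_axioms, of _ 1]) (auto simp: indicator_def)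
  also have "\<dots> = (\<integral>l. \<integral>b. \<integral>b'. ?c (V (l, b), V (l, b')) \<partial>B \<partial>B \<partial>L)"
  proof (intro Bochner_Integration.integral_cong refl)
    fix l assume l[measurable]: "l \<in> space L"
    have [measurable]: "(\<lambda>b. V (l, b)) \<in> measurable B E"
      using measurable_compose[OF measurable_Pair1'[OF l] V] .
    show "(\<integral>z. ?c (V (l, fst z), V (l, snd z)) \<partial>(B \<Otimes>\<^sub>M B)) = (\<integral>b. \<integral>b'. ?c (V (l, b), V (l, b')) \<partial>B \<partial>B)"
      by (subst integral_pair_bounded_fst[OF B B, of _ 1]) (auto simp: indicator_def)
  qed
  finally show ?thesis by simp
qed

end

context rtp
begin

text \<open>The depth is \<open>Suc k\<close> because the law of the root and the monotonicity of
  \<open>explained\<close> are established from depth 1 on.\<close>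

definition pair_prob :: "nat \<Rightarrow> 's set \<Rightarrow> 's set \<Rightarrow> real"
  where "pair_prob k A B = (\<integral>\<theta>. cond_mean (Suc k) (indicator A) \<theta> * cond_mean (Suc k) (indicator B) \<theta> \<partial>tree_mark)"

definition "pair_law k = shared_copies tree_mark tree_leaf borel (\<lambda>(\<theta>, b). tree_eval (Suc k) \<theta> b)"
definition "seq_law k = shared_copies marks leaves (iid borel)
  (\<lambda>(\<Theta>, b) j. tree_eval (Suc k) (\<Theta> j) (b j))"

lemma prob_space_pair_law: "prob_space (pair_law k)" and prob_space_seq_law: "prob_space (seq_law k)"
  unfolding pair_law_def seq_law_def
  by (intro prob_space_shared_copies tree_mark.prob_space_axioms tree_leaf.prob_space_axioms measurable_tree_eval
      marks.prob_space_axioms leaves.prob_space_axioms measurable_tree_evals)+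

lemma measure_pair_law:
  "A \<in> sets borel \<Longrightarrow> B \<in> sets borel \<Longrightarrow> measure (pair_law k) (A \<times> B) = pair_prob k A B"
  unfolding pair_law_def pair_prob_def cond_mean_def
  by (subst measure_shared_copies[OF tree_mark.prob_space_axioms tree_leaf.prob_space_axioms measurable_tree_eval]) simp_all

lemma measure_seq_law:
  assumes "C \<in> sets (iid borel)" "D \<in> sets (iid borel)"
  shows "measure (seq_law k) (C \<times> D) = (\<integral>\<Theta>. (\<integral>b. indicator C (\<lambda>j. tree_eval (Suc k) (\<Theta> j) (b j)) \<partial>leaves)
      * (\<integral>b. indicator D (\<lambda>j. tree_eval (Suc k) (\<Theta> j) (b j)) \<partial>leaves) \<partial>marks)"
  unfolding seq_law_def
  using assms by (subst measure_shared_copies[OF marks.prob_space_axioms leaves.prob_space_axioms measurable_tree_evals]) simp_all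

lemma measure_seq_law_cylinder:
  assumes [measurable]: "\<And>i. C i \<in> sets borel" "\<And>i. D i \<in> sets borel"
  shows "measure (seq_law k) (cylinder j C \<times> cylinder j D) = (\<Prod>i<j. pair_prob k (C i) (D i))"
proof -
  have inner: "(\<integral>b. indicator (cylinder j F) (\<lambda>j. tree_eval (Suc k) (\<Theta> j) (b j)) \<partial>leaves) = (\<Prod>i<j. cond_mean (Suc k) (indicator (F i)) (\<Theta> i))"
    if F[measurable]: "\<And>i. F i \<in> sets borel" and \<Theta>: "\<Theta> \<in> space marks" for F \<Theta>
  proof -
    have "tree_eval (Suc k) (\<Theta> i) \<in> borel_measurable tree_leaf" for i
    proof -
      have "\<Theta> i \<in> space tree_mark" using \<Theta> by (auto simp: space_PiM PiE_iff)
      from measurable_compose[OF measurable_Pair1'[OF this] measurable_tree_eval[of "Suc k"]]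
      show ?thesis by (simp only: prod.case)
    qed
    note [measurable] = this
    show ?thesis
      unfolding indicator_cylinder cond_mean_def
      by (rule integral_PiM_nat_prod[OF tree_leaf.prob_space_axioms]) (simp_all add: indicator_le_1 del: tree_eval.simps)
  qed
  have "measure (seq_law k) (cylinder j C \<times> cylinder j D)
    = (\<integral>\<Theta>. (\<Prod>i<j. cond_mean (Suc k) (indicator (C i)) (\<Theta> i)) * (\<Prod>i<j. cond_mean (Suc k) (indicator (D i)) (\<Theta> i)) \<partial>marks)"
    using assms inner by (subst measure_seq_law) (auto intro!: Bochner_Integration.integral_cong)
  also have "\<dots> = (\<integral>\<Theta>. (\<Prod>i<j. cond_mean (Suc k) (indicator (C i)) (\<Theta> i) * cond_mean (Suc k) (indicator (D i)) (\<Theta> i)) \<partial>marks)"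
    by (simp add: prod.distrib)
  also have "\<dots> = (\<Prod>i<j. pair_prob k (C i) (D i))"
    unfolding pair_prob_def
    by (rule integral_PiM_nat_prod[OF tree_mark.prob_space_axioms])
      (auto simp: abs_mult indicator_le_1 intro!: mult_le_one cond_mean_bound)
  finally show ?thesis .
qed

lemma integral_cond_mean:
  assumes f: "f \<in> borel_measurable borel" "\<And>x. \<bar>f x\<bar> \<le> (1::real)"
  shows "(\<integral>\<theta>. cond_mean (Suc k) f \<theta> \<partial>tree_mark) = (\<integral>x. f x \<partial>\<nu>)"
proof -
  have "(\<integral>x. f x \<partial>\<nu>) = (\<integral>p. f (X [] p) \<partial>M)" using expectation_root_\<nu>[OF f] by simp
  also have "\<dots> = (\<integral>\<theta>. cond_mean (Suc k) f \<theta> \<partial>tree_mark)"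
    using f by (subst expectation_root[of "Suc k" "\<lambda>x _. f x" 1]) (simp_all add: cond_mean_def[abs_def])
  finally show ?thesis by simp
qed

lemma cond_mean_one [simp]: "cond_mean k (\<lambda>_. 1) \<theta> = 1"
  by (simp add: cond_mean_def tree_leaf.prob_space)

lemma pair_prob_UNIV:
  assumes "A \<in> sets borel"
  shows "pair_prob k A UNIV = measure \<nu> A" "pair_prob k UNIV A = measure \<nu> A"
  using integral_cond_mean[of "indicator A" k] assms
  by (simp_all add: pair_prob_def indicator_le_1)

lemma pair_prob_diagonal: "pair_prob k A A = explained (Suc k) (indicator A)"
  by (simp add: pair_prob_def explained_def power2_eq_square)

lemma convergent_explained:
  assumes f: "f \<in> borel_measurable borel" "\<And>x. \<bar>f x\<bar> \<le> (1::real)"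
  shows "convergent (\<lambda>k. explained (Suc k) f)"
proof (rule Bseq_mono_convergent)
  have "explained (Suc k) f \<le> (\<integral>x. (f x)\<^sup>2 \<partial>\<nu>)" for k
    by (rule explained_le_mean_square[OF _ f]) simp
  moreover have "0 \<le> explained (Suc k) f" for k by (simp add: explained_def)
  ultimately show "Bseq (\<lambda>k. explained (Suc k) f)"
    by (intro BseqI'[of _ "\<integral>x. (f x)\<^sup>2 \<partial>\<nu>"]) simp
  show "\<forall>m. \<forall>n\<ge>m. explained (Suc m) f \<le> explained (Suc n) f"
    by (auto intro!: explained_mono f)
qed

text \<open>Polarization: the product of two conditional means is a difference of squares, and both
  second moments are monotone and bounded. The halves keep the functions between -1 and 1.\<close>

lemma convergent_pair_prob:
  assumes [measurable]: "A \<in> sets borel" "B \<in> sets borel"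
  shows "convergent (\<lambda>k. pair_prob k A B)"
proof -
  let ?a = "indicator A :: 's \<Rightarrow> real" and ?b = "indicator B :: 's \<Rightarrow> real"
  let ?f = "\<lambda>x. (?a x + ?b x) / 2" and ?g = "\<lambda>x. (?a x - ?b x) / 2"
  have b: "\<bar>?f x\<bar> \<le> 1" "\<bar>?g x\<bar> \<le> 1" for x by (auto simp: indicator_def)
  have "pair_prob k A B = explained (Suc k) ?f - explained (Suc k) ?g" for k
  proof -
    have c: "cond_mean (Suc k) ?f \<theta> = (cond_mean (Suc k) ?a \<theta> + cond_mean (Suc k) ?b \<theta>) / 2"
      "cond_mean (Suc k) ?g \<theta> = (cond_mean (Suc k) ?a \<theta> - cond_mean (Suc k) ?b \<theta>) / 2"
      if \<theta>: "\<theta> \<in> space tree_mark" for \<theta>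
    proof -
      from measurable_compose[OF measurable_Pair1'[OF \<theta>] measurable_tree_eval[of "Suc k"]]
      have [measurable]: "tree_eval (Suc k) \<theta> \<in> borel_measurable tree_leaf" by (simp only: prod.case)
      have "integrable tree_leaf (\<lambda>b. ?a (tree_eval (Suc k) \<theta> b))" "integrable tree_leaf (\<lambda>b. ?b (tree_eval (Suc k) \<theta> b))"
        by (rule integrable_bounded_real[OF tree_leaf.prob_space_axioms, of _ 1]; simp add: indicator_le_1 del: tree_eval.simps)+
      then show "cond_mean (Suc k) ?f \<theta> = (cond_mean (Suc k) ?a \<theta> + cond_mean (Suc k) ?b \<theta>) / 2"
        "cond_mean (Suc k) ?g \<theta> = (cond_mean (Suc k) ?a \<theta> - cond_mean (Suc k) ?b \<theta>) / 2"
        by (simp_all add: cond_mean_def del: tree_eval.simps)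
    qed
    have "explained (Suc k) ?f - explained (Suc k) ?g = (\<integral>\<theta>. (cond_mean (Suc k) ?f \<theta>)\<^sup>2 - (cond_mean (Suc k) ?g \<theta>)\<^sup>2 \<partial>tree_mark)"
      unfolding explained_def using cond_mean_bound[OF b(1)] cond_mean_bound[OF b(2)]
      by (intro Bochner_Integration.integral_diff[symmetric] integrable_bounded_real[OF tree_mark.prob_space_axioms, of _ 1])
        (auto simp: power2_le_1)
    also have "\<dots> = pair_prob k A B"
      unfolding pair_prob_def by (intro Bochner_Integration.integral_cong refl) (simp add: c power2_eq_square field_simps)
    finally show ?thesis by simp
  qed
  moreover have "convergent (\<lambda>k. explained (Suc k) ?f - explained (Suc k) ?g)"
    using b by (intro convergent_diff convergent_explained) auto
  ultimately show ?thesis by simp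
qed

text \<open>Given the root mark, each copy of the root value is \<gamma> of its own sequence of
  child values, and the two sequences have joint law \<open>seq_law k\<close>.\<close>

lemma pair_prob_Suc:
  assumes [measurable]: "A \<in> sets borel" "B \<in> sets borel"
  shows "pair_prob (Suc k) A B = (\<integral>\<omega>. measure (seq_law k) ((\<gamma> \<omega> -` A) \<times> (\<gamma> \<omega> -` B)) \<partial>R)"
proof -
  let ?K = "\<lambda>F. cond_mean (Suc (Suc k)) (indicator F)"
  have pre: "\<gamma> \<omega> -` F \<in> sets (iid borel)" if "F \<in> sets borel" for F \<omega>
    using measurable_sets[OF \<gamma>_measurable_snd that, of \<omega>] by (simp add: space_PiM)
  have "pair_prob (Suc k) A B = (\<integral>\<omega>. \<integral>\<Theta>. ?K A (tree_join \<omega> \<Theta>) * ?K B (tree_join \<omega> \<Theta>) \<partial>marks \<partial>R)"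
    unfolding pair_prob_def
    by (rule integral_PiM_tree[OF R_prob, of _ 1])
      (auto simp: abs_mult indicator_le_1 intro!: mult_le_one cond_mean_bound)
  also have "\<dots> = (\<integral>\<omega>. measure (seq_law k) ((\<gamma> \<omega> -` A) \<times> (\<gamma> \<omega> -` B)) \<partial>R)"
  proof (intro Bochner_Integration.integral_cong refl)
    fix \<omega>
    have ind: "indicator (\<gamma> \<omega> -` F) x = (indicator F (\<gamma> \<omega> x) :: real)" for F x by (simp add: indicator_def)
    show "(\<integral>\<Theta>. ?K A (tree_join \<omega> \<Theta>) * ?K B (tree_join \<omega> \<Theta>) \<partial>marks) = measure (seq_law k) ((\<gamma> \<omega> -` A) \<times> (\<gamma> \<omega> -` B))"
      unfolding measure_seq_law[OF pre[OF assms(1)] pre[OF assms(2)]] ind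
      by (intro Bochner_Integration.integral_cong refl arg_cong2[where f="(*)"] cond_mean_Suc[where C=1])
        (simp_all add: indicator_le_1)
  qed
  finally show ?thesis .
qed

end

section \<open>The bivariate fixed point\<close>

context rtp
begin

lemma pair_law_marginals: "distr (pair_law k) borel fst = \<nu>" "distr (pair_law k) borel snd = \<nu>"
proof -
  interpret P: prob_space "pair_law k" by (rule prob_space_pair_law)
  have s[measurable_cong]: "sets (pair_law k) = sets (borel \<Otimes>\<^sub>M borel)" by (simp add: pair_law_def)
  have sp: "space (pair_law k) = UNIV" using sets_eq_imp_space_eq[OF s] by (simp add: space_pair_measure)
  have "fst -` A = A \<times> (UNIV :: 's set)" "snd -` A = (UNIV :: 's set) \<times> A" for A :: "'s set" by auto
  then show "distr (pair_law k) borel fst = \<nu>" "distr (pair_law k) borel snd = \<nu>"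
    by (auto intro!: measure_eqI simp: emeasure_distr sp P.emeasure_eq_measure \<nu>.emeasure_eq_measure measure_pair_law pair_prob_UNIV)
qed

text \<open>The limit on S x S is moved to functions on two indices. Its marginals are \<nu> because
  the probabilities of rectangles with one full side do not depend on k.\<close>

lemma bivariate_limit_exists:
  "\<exists>\<mu>\<in>probs_with_marginals 2 \<nu>. \<forall>A\<in>sets borel. \<forall>B\<in>sets borel.
    (\<lambda>k. pair_prob k A B) \<longlonglongrightarrow> measure \<mu> {x \<in> space (power_space 2). x 0 \<in> A \<and> x 1 \<in> B}"
proof -
  have "\<exists>Q. prob_space Q \<and> sets Q = sets (borel \<Otimes>\<^sub>M borel) \<and>
    (\<forall>A\<in>sets borel. \<forall>B\<in>sets borel. (\<lambda>k. measure (pair_law k) (A \<times> B)) \<longlonglongrightarrow> measure Q (A \<times> B))"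
    by (rule setwise_limit_measure[OF \<nu>_prob sets_\<nu> prob_space_pair_law _ pair_law_marginals])
      (simp_all add: measure_pair_law convergent_pair_prob, simp add: pair_law_def)
  then obtain Q where Q: "prob_space Q" and s[measurable_cong]: "sets Q = sets (borel \<Otimes>\<^sub>M borel)"
    and lim: "\<And>A B. A \<in> sets borel \<Longrightarrow> B \<in> sets borel \<Longrightarrow> (\<lambda>k. pair_prob k A B) \<longlonglongrightarrow> measure Q (A \<times> B)"
    by (auto simp: measure_pair_law)
  interpret Q: prob_space Q by fact
  have sp: "space Q = UNIV" using sets_eq_imp_space_eq[OF s] by (simp add: space_pair_measure)
  define u where "u z = (\<lambda>m\<in>{..<2::nat}. if m = 0 then fst z else snd z :: 's)" for z
  have u[measurable]: "u \<in> measurable Q (power_space 2)"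
    unfolding u_def by (rule measurable_restrict) simp
  define \<mu> where "\<mu> = distr Q (power_space 2) u"
  have m: "(\<lambda>x. x 0) \<in> borel_measurable (power_space 2)" "(\<lambda>x. x 1) \<in> borel_measurable (power_space 2)"
    by (auto intro!: coordinate_measurable)
  have u01: "u z 0 = fst z" "u z 1 = snd z" for z by (simp_all add: u_def)
  have usp: "u z \<in> space (power_space 2)" for z by (auto simp: u_def space_PiM)
  have \<mu>: "measure \<mu> {x \<in> space (power_space 2). x 0 \<in> A \<and> x 1 \<in> B} = measure Q (A \<times> B)"
    if [measurable]: "A \<in> sets borel" "B \<in> sets borel" for A B
  proof -
    have "u -` {x \<in> space (power_space 2). x 0 \<in> A \<and> x 1 \<in> B} \<inter> space Q = A \<times> B"
      using usp u01 by (auto simp: sp)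
    moreover have "{x \<in> space (power_space 2). x 0 \<in> A \<and> x 1 \<in> B} \<in> sets (power_space 2)" using m by measurable
    ultimately show ?thesis unfolding \<mu>_def by (subst measure_distr[OF u]) auto
  qed
  have marg: "distr Q borel fst = \<nu>" "distr Q borel snd = \<nu>"
  proof -
    have "fst -` A = A \<times> (UNIV :: 's set)" "snd -` A = (UNIV :: 's set) \<times> A" for A :: "'s set" by auto
    moreover have "measure Q (A \<times> UNIV) = measure \<nu> A" "measure Q (UNIV \<times> A) = measure \<nu> A" if "A \<in> sets borel" for A
      using LIMSEQ_unique[OF lim[OF that, of UNIV]] LIMSEQ_unique[OF lim[OF _ that, of UNIV]] that
      by (auto simp: pair_prob_UNIV)
    ultimately show "distr Q borel fst = \<nu>" "distr Q borel snd = \<nu>"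
      by (auto intro!: measure_eqI simp: emeasure_distr sp Q.emeasure_eq_measure \<nu>.emeasure_eq_measure)
  qed
  have "\<mu> \<in> space (prob_algebra (power_space 2))"
    using Q.prob_space_distr[OF u] by (simp add: space_prob_algebra \<mu>_def)
  moreover have "distr \<mu> borel (\<lambda>x. x i) = \<nu>" if "i < 2" for i
  proof -
    have "distr \<mu> borel (\<lambda>x. x i) = distr Q borel (\<lambda>z. u z i)"
      using that u unfolding \<mu>_def by (subst distr_distr) (auto intro!: coordinate_measurable simp: comp_def)
    moreover have "(\<lambda>z. u z 0) = fst" "(\<lambda>z. u z 1) = snd" using u01 by auto
    moreover have "i = 0 \<or> i = 1" using that by auto
    ultimately show ?thesis using marg by metis
  qed
  ultimately have "\<mu> \<in> probs_with_marginals 2 \<nu>" by (simp add: probs_with_marginals_def)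
  with \<mu> lim show ?thesis by (intro bexI[of _ \<mu>]) simp_all
qed

context
  fixes \<mu> :: "(nat \<Rightarrow> 's) measure"
  assumes \<mu>: "\<mu> \<in> probs_with_marginals 2 \<nu>"
    and \<mu>_lim: "\<And>A B. A \<in> sets borel \<Longrightarrow> B \<in> sets borel \<Longrightarrow>
      (\<lambda>k. pair_prob k A B) \<longlonglongrightarrow> measure \<mu> {x \<in> space (power_space 2). x 0 \<in> A \<and> x 1 \<in> B}"
begin

lemma \<mu>_prob: "prob_space \<mu>" and sets_\<mu> [measurable_cong]: "sets \<mu> = sets (power_space 2)"
  and \<mu>_alg: "\<mu> \<in> space (prob_algebra (power_space 2))"
  using \<mu> by (auto simp: probs_with_marginals_def space_prob_algebra)

lemma \<mu>_coordinates [measurable]: "(\<lambda>x. x 0) \<in> borel_measurable \<mu>" "(\<lambda>x. x (Suc 0)) \<in> borel_measurable \<mu>"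
  by (auto intro!: coordinate_measurable sets_\<mu>)

text \<open>\<gamma> acts on the sequence of first coordinates and on that of second coordinates, so
  a sequence of i.i.d. pairs has to be transposed.\<close>

definition "coordinate_sequences x = (\<lambda>i::nat. x i (0::nat), \<lambda>i::nat. x i (Suc 0))"

lemma coordinate_sequences_measurable [measurable]:
  "coordinate_sequences \<in> measurable (iid \<mu>) ((iid borel) \<Otimes>\<^sub>M (iid borel))"
proof -
  have *: "(\<lambda>x. \<lambda>i. x i l) \<in> measurable (iid \<mu>) (iid borel)"
    if l: "(\<lambda>x. x l) \<in> borel_measurable \<mu>" for l
  proof (rule measurable_PiM_single')
    show "(\<lambda>x. x i l) \<in> borel_measurable (iid \<mu>)" for i
      by (rule measurable_compose[where f="\<lambda>x. x i", OF _ l]) (rule measurable_component_singleton, simp)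
  qed simp
  show ?thesis unfolding coordinate_sequences_def[abs_def]
    by (rule measurable_Pair[OF *[OF \<mu>_coordinates(1)] *[OF \<mu>_coordinates(2)]])
qed

definition "limit_seq_law = distr (iid \<mu>) ((iid borel) \<Otimes>\<^sub>M (iid borel)) coordinate_sequences"

lemma prob_space_limit_seq_law: "prob_space limit_seq_law"
  unfolding limit_seq_law_def
  by (intro prob_space.prob_space_distr prob_space_PiM \<mu>_prob coordinate_sequences_measurable)

lemma sets_limit_seq_law: "sets limit_seq_law = sets ((iid borel) \<Otimes>\<^sub>M (iid borel))"
  by (simp add: limit_seq_law_def)

lemma measure_limit_seq_law:
  assumes [measurable]: "C \<in> sets (iid borel)" "D \<in> sets (iid borel)"
  shows "measure limit_seq_law (C \<times> D)
    = (\<integral>x. indicator C (\<lambda>i. x i 0) * indicator D (\<lambda>i. x i (Suc 0)) \<partial>(iid \<mu>))"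
proof -
  interpret L: prob_space limit_seq_law by (rule prob_space_limit_seq_law)
  have "C \<times> D \<in> sets limit_seq_law" by (simp add: sets_limit_seq_law)
  then have "measure limit_seq_law (C \<times> D) = (\<integral>z. indicator (C \<times> D) z \<partial>limit_seq_law)"
    by (simp add: sets.Int_space_eq2)
  also have "\<dots> = (\<integral>x. indicator (C \<times> D) (coordinate_sequences x) \<partial>(iid \<mu>))"
    unfolding limit_seq_law_def by (rule integral_distr[OF coordinate_sequences_measurable]) simp
  also have "\<dots> = (\<integral>x. indicator C (\<lambda>i. x i 0) * indicator D (\<lambda>i. x i (Suc 0)) \<partial>(iid \<mu>))"
    by (intro Bochner_Integration.integral_cong refl) (auto simp: coordinate_sequences_def indicator_def)
  finally show ?thesis .
qed

lemma measure_limit_seq_law_cylinder: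
  assumes [measurable]: "\<And>i. C i \<in> sets borel" "\<And>i. D i \<in> sets borel"
  shows "measure limit_seq_law (cylinder j C \<times> cylinder j D)
    = (\<Prod>i<j. measure \<mu> {x \<in> space (power_space 2). x 0 \<in> C i \<and> x 1 \<in> D i})"
proof -
  interpret \<mu>: prob_space \<mu> by (rule \<mu>_prob)
  have sp: "space \<mu> = space (power_space 2)" using sets_eq_imp_space_eq[OF sets_\<mu>] .
  have "measure limit_seq_law (cylinder j C \<times> cylinder j D)
    = (\<integral>x. (\<Prod>i<j. indicator (C i) (x i 0) * indicator (D i) (x i (Suc 0))) \<partial>(iid \<mu>))"
    using assms by (subst measure_limit_seq_law) (auto simp: indicator_cylinder prod.distrib)
  also have "\<dots> = (\<Prod>i<j. \<integral>x. indicator (C i) (x 0) * indicator (D i) (x (Suc 0)) \<partial>\<mu>)"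
    by (rule integral_PiM_nat_prod[OF \<mu>_prob]) (auto simp: indicator_def)
  also have "\<dots> = (\<Prod>i<j. measure \<mu> {x \<in> space (power_space 2). x 0 \<in> C i \<and> x 1 \<in> D i})"
  proof (intro prod.cong refl)
    fix i
    let ?E = "{x \<in> space \<mu>. x 0 \<in> C i \<and> x (Suc 0) \<in> D i}"
    have "?E \<in> sets \<mu>" by measurable
    then have "measure \<mu> ?E = (\<integral>x. indicator ?E x \<partial>\<mu>)" by (simp add: sets.Int_space_eq2)
    also have "\<dots> = (\<integral>x. indicator (C i) (x 0) * indicator (D i) (x (Suc 0)) \<partial>\<mu>)"
      by (intro Bochner_Integration.integral_cong refl) (auto simp: indicator_def)
    finally show "(\<integral>x. indicator (C i) (x 0) * indicator (D i) (x (Suc 0)) \<partial>\<mu>)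
      = measure \<mu> {x \<in> space (power_space 2). x 0 \<in> C i \<and> x 1 \<in> D i}" by (simp add: sp)
  qed
  finally show ?thesis .
qed

lemma pair_limit_UNIV:
  assumes "A \<in> sets borel"
  shows "measure \<mu> {x \<in> space (power_space 2). x 0 \<in> A \<and> x 1 \<in> UNIV} = measure \<nu> A"
    "measure \<mu> {x \<in> space (power_space 2). x 0 \<in> UNIV \<and> x 1 \<in> A} = measure \<nu> A"
  using LIMSEQ_unique[OF \<mu>_lim[OF assms, of UNIV]] LIMSEQ_unique[OF \<mu>_lim[OF _ assms, of UNIV]] assms
  by (auto simp: pair_prob_UNIV)

text \<open>A single copy does not notice the sharing: its child values are i.i.d. of law \<nu> for
  every k. This is the common law that \<open>measure_tendsto_from_generator\<close>
  requires.\<close>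

lemma seq_law_marginals:
  "distr (seq_law k) (iid borel) fst = distr limit_seq_law (iid borel) fst"
  "distr (seq_law k) (iid borel) snd = distr limit_seq_law (iid borel) snd"
proof -
  let ?S = "iid (borel :: 's measure)"
  interpret L: prob_space limit_seq_law by (rule prob_space_limit_seq_law)
  interpret P: prob_space "seq_law k" by (rule prob_space_seq_law)
  note [measurable_cong] = sets_limit_seq_law
  have sP[measurable_cong]: "sets (seq_law k) = sets (?S \<Otimes>\<^sub>M ?S)" by (simp add: seq_law_def)
  have sp: "space (seq_law k) = UNIV" "space limit_seq_law = UNIV"
    using sets_eq_imp_space_eq[OF sP] sets_eq_imp_space_eq[OF sets_limit_seq_law] by (simp_all add: space_pair_measure space_PiM)
  have pre: "fst -` A = A \<times> (UNIV :: (nat \<Rightarrow> 's) set)" "snd -` A = (UNIV :: (nat \<Rightarrow> 's) set) \<times> A" for A :: "(nat \<Rightarrow> 's) set" by auto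
  have U: "measure (seq_law k) (cylinder j C \<times> UNIV) = measure limit_seq_law (cylinder j C \<times> UNIV)"
    "measure (seq_law k) (UNIV \<times> cylinder j C) = measure limit_seq_law (UNIV \<times> cylinder j C)"
    if "\<And>i. C i \<in> sets borel" for j C
    using measure_seq_law_cylinder[of C "\<lambda>_. UNIV" k j] measure_limit_seq_law_cylinder[of C "\<lambda>_. UNIV" j]
      measure_seq_law_cylinder[of "\<lambda>_. UNIV" C k j] measure_limit_seq_law_cylinder[of "\<lambda>_. UNIV" C j]
      pair_limit_UNIV[OF that] pair_prob_UNIV[OF that] that
    by simp_all
  show "distr (seq_law k) ?S fst = distr limit_seq_law ?S fst"
    by (rule measure_eq_cylinders)
      (auto intro!: P.prob_space_distr L.prob_space_distr simp: measure_distr cylinder_sets sp pre U)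
  show "distr (seq_law k) ?S snd = distr limit_seq_law ?S snd"
    by (rule measure_eq_cylinders)
      (auto intro!: P.prob_space_distr L.prob_space_distr simp: measure_distr cylinder_sets sp pre U)
qed

text \<open>On products of cylinders both sides are finite products and converge factor by factor.
  Preimages under \<open>\<gamma> \<omega>\<close> need not be cylinders, so the two sides of the
  rectangle are extended to arbitrary measurable sets, first C and then D.\<close>

lemma seq_law_tendsto:
  assumes C: "C \<in> sets (iid borel)" and D: "D \<in> sets (iid borel)"
  shows "(\<lambda>k. measure (seq_law k) (C \<times> D)) \<longlonglongrightarrow> measure limit_seq_law (C \<times> D)"
proof -
  let ?S = "iid (borel :: 's measure)"
  have spS: "space ?S = UNIV" by (simp add: space_PiM)
  note [measurable_cong] = sets_limit_seq_law
  have sP: "sets (seq_law k) = sets limit_seq_law" for k by (simp add: seq_law_def sets_limit_seq_law)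
  have gen: "Int_stable borel_cylinders" "space ?S \<in> borel_cylinders" "sets ?S = sigma_sets (space ?S) borel_cylinders"
    "borel_cylinders \<subseteq> Pow (space ?S)"
    using cylinder_UNIV[of 0]
    by (auto simp: Int_stable_cylinders sets_PiM_cylinders spS intro!: exI[of _ 0] exI[of _ "\<lambda>_. UNIV"])
  note base = measure_tendsto_from_generator[OF prob_space_seq_law sP prob_space_limit_seq_law _ _ _ gen]
  have cyl: "(\<lambda>k. measure (seq_law k) (C \<times> D)) \<longlonglongrightarrow> measure limit_seq_law (C \<times> D)"
    if C: "C \<in> borel_cylinders" and D: "D \<in> borel_cylinders" for C D
  proof -
    obtain j F where F: "C = cylinder j F" "\<And>i. F i \<in> sets borel" using C by blast
    obtain j' F' where F': "D = cylinder j' F'" "\<And>i. F' i \<in> sets borel" using D by blast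
    define n where "n = max j j'"
    define E where "E i = (if i < j then F i else UNIV)" for i
    define E' where "E' i = (if i < j' then F' i else UNIV)" for i
    have CD: "C = cylinder n E" "D = cylinder n E'"
      unfolding F F' E_def E'_def n_def by (intro cylinder_extend; simp)+
    have E: "E i \<in> sets borel" "E' i \<in> sets borel" for i using F(2) F'(2) by (simp_all add: E_def E'_def)
    show ?thesis
      unfolding CD measure_seq_law_cylinder[OF E] measure_limit_seq_law_cylinder[OF E]
      by (intro tendsto_prod \<mu>_lim E)
  qed
  have first: "(\<lambda>k. measure (seq_law k) (C \<times> D)) \<longlonglongrightarrow> measure limit_seq_law (C \<times> D)"
    if C: "C \<in> sets ?S" and D: "D \<in> borel_cylinders" for C D
  proof -
    have D': "D \<in> sets ?S" using D by auto
    have e: "fst -` A \<inter> (UNIV :: (nat \<Rightarrow> 's) set) \<times> D = A \<times> D" for A :: "(nat \<Rightarrow> 's) set" by auto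
    have "UNIV \<times> D \<in> sets limit_seq_law" using D' sets.top[of ?S] by (auto simp: sets_limit_seq_law spS)
    from base[OF _ seq_law_marginals(1) this _ C, unfolded e, OF _ cyl[OF _ D]] show ?thesis by simp
  qed
  have e: "snd -` A \<inter> C \<times> (UNIV :: (nat \<Rightarrow> 's) set) = C \<times> A" for A :: "(nat \<Rightarrow> 's) set" by auto
  have "C \<times> UNIV \<in> sets limit_seq_law" using C sets.top[of ?S] by (auto simp: sets_limit_seq_law spS)
  from base[OF _ seq_law_marginals(2) this _ D, unfolded e, OF _ first[OF C]] show ?thesis by simp
qed

text \<open>Both sides of \<open>pair_prob_Suc\<close> converge: the left, a shifted sequence, to
  \<mu> of the rectangle, and the right, by dominated convergence over \<omega>, to the image of
  \<mu> on it. Rectangles determine the law.\<close>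

lemma bivariate_fixed_point: "Tn_map r \<gamma> 2 \<mu> = \<mu>"
proof -
  interpret \<mu>: prob_space \<mu> by (rule \<mu>_prob)
  have sp: "space \<mu> = space (power_space 2)" using sets_eq_imp_space_eq[OF sets_\<mu>] .
  have sT: "sets (Tn_map r \<gamma> 2 \<mu>) = sets (power_space 2)" by (simp add: Tn_map_def T_map_def)
  have m: "(\<lambda>x. x 0) \<in> borel_measurable (power_space 2)" "(\<lambda>x. x 1) \<in> borel_measurable (power_space 2)"
    by (auto intro!: coordinate_measurable)
  interpret RS: prob_space "R \<Otimes>\<^sub>M (iid \<mu>)"
  proof -
    interpret S: prob_space "iid \<mu>" by (intro prob_space_PiM \<mu>_prob)
    interpret pair_prob_space R "iid \<mu>" ..
    show "prob_space (R \<Otimes>\<^sub>M (iid \<mu>))" by (rule prob_space_axioms)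
  qed
  interpret T: prob_space "Tn_map r \<gamma> 2 \<mu>"
    unfolding Tn_map_def T_map_def by (rule RS.prob_space_distr[OF nvariate_measurable[OF sets_\<mu>]])
  have eq: "measure (Tn_map r \<gamma> 2 \<mu>) {x \<in> space (power_space 2). x 0 \<in> A \<and> x 1 \<in> B}
      = measure \<mu> {x \<in> space (power_space 2). x 0 \<in> A \<and> x 1 \<in> B}"
    if A[measurable]: "A \<in> sets borel" and B[measurable]: "B \<in> sets borel" for A B
  proof -
    let ?E = "{x \<in> space (power_space 2). x 0 \<in> A \<and> x 1 \<in> B}"
    let ?\<phi> = "\<lambda>x. indicator A (x 0) * indicator B (x 1) :: real"
    have E: "?E \<in> sets (power_space 2)" using m by measurable
    have pre: "\<gamma> \<omega> -` F \<in> sets (iid borel)" if "F \<in> sets borel" for F \<omega>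
      using measurable_sets[OF \<gamma>_measurable_snd that, of \<omega>] by (simp add: space_PiM)
    have ind: "indicator (\<gamma> \<omega> -` F) x = (indicator F (\<gamma> \<omega> x) :: real)" for F x \<omega> by (simp add: indicator_def)
    have "measure (Tn_map r \<gamma> 2 \<mu>) ?E = (\<integral>x. indicator ?E x \<partial>Tn_map r \<gamma> 2 \<mu>)"
      using E by (simp add: sT sets.Int_space_eq2)
    also have "\<dots> = (\<integral>x. ?\<phi> x \<partial>Tn_map r \<gamma> 2 \<mu>)"
      by (intro Bochner_Integration.integral_cong refl) (auto simp: indicator_def sets_eq_imp_space_eq[OF sT])
    also have "\<dots> = (\<integral>\<omega>. \<integral>x. ?\<phi> (nvariate 2 \<gamma> \<omega> x) \<partial>(iid \<mu>) \<partial>R)"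
      using m by (intro integral_Tn_map[OF \<mu>_alg, of _ 1]) (auto simp: indicator_def)
    also have "\<dots> = (\<integral>\<omega>. measure limit_seq_law ((\<gamma> \<omega> -` A) \<times> (\<gamma> \<omega> -` B)) \<partial>R)"
      unfolding measure_limit_seq_law[OF pre[OF A] pre[OF B]] ind by (simp add: nvariate_def)
    finally have T: "measure (Tn_map r \<gamma> 2 \<mu>) ?E = (\<integral>\<omega>. measure limit_seq_law ((\<gamma> \<omega> -` A) \<times> (\<gamma> \<omega> -` B)) \<partial>R)" .
    have meas: "(\<lambda>\<omega>. measure (seq_law k) ((\<gamma> \<omega> -` A) \<times> (\<gamma> \<omega> -` B))) \<in> borel_measurable R" for k
      unfolding measure_seq_law[OF pre[OF A] pre[OF B]] ind by measurable
    have tend: "(\<lambda>k. measure (seq_law k) ((\<gamma> \<omega> -` A) \<times> (\<gamma> \<omega> -` B))) \<longlonglongrightarrow> measure limit_seq_law ((\<gamma> \<omega> -` A) \<times> (\<gamma> \<omega> -` B))" for \<omega>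
      by (intro seq_law_tendsto pre A B)
    have "(\<lambda>k. \<integral>\<omega>. measure (seq_law k) ((\<gamma> \<omega> -` A) \<times> (\<gamma> \<omega> -` B)) \<partial>R) \<longlonglongrightarrow> (\<integral>\<omega>. measure limit_seq_law ((\<gamma> \<omega> -` A) \<times> (\<gamma> \<omega> -` B)) \<partial>R)"
    proof (rule integral_dominated_convergence[where w="\<lambda>_. 1"])
      show "(\<lambda>\<omega>. measure limit_seq_law ((\<gamma> \<omega> -` A) \<times> (\<gamma> \<omega> -` B))) \<in> borel_measurable R"
        using meas tend by (rule borel_measurable_LIMSEQ_real[rotated])
      show "AE \<omega> in R. norm (measure (seq_law k) ((\<gamma> \<omega> -` A) \<times> (\<gamma> \<omega> -` B))) \<le> 1" for k
        using prob_space.prob_le_1[OF prob_space_seq_law[of k]] by simp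
    qed (use meas tend in simp_all)
    then have "(\<lambda>k. pair_prob (Suc k) A B) \<longlonglongrightarrow> measure (Tn_map r \<gamma> 2 \<mu>) ?E"
      unfolding pair_prob_Suc[OF A B] T .
    with LIMSEQ_Suc[OF \<mu>_lim[OF A B]] show ?thesis by (rule LIMSEQ_unique[symmetric])
  qed
  show ?thesis
  proof (rule measure_eqI_PiM_finite[of "{..<2}"])
    fix A :: "nat \<Rightarrow> 's set" assume A: "\<And>i. i \<in> {..<2} \<Longrightarrow> A i \<in> sets borel"
    have "Pi\<^sub>E {..<2} A = {x \<in> space (power_space 2). x 0 \<in> A 0 \<and> x 1 \<in> A 1}"
      by (rule set_eqI) (simp add: space_PiM PiE_iff lessThan_2_ball conj_commute)
    moreover have "A 0 \<in> sets borel" "A 1 \<in> sets borel" by (auto intro: A)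
    ultimately show "emeasure (Tn_map r \<gamma> 2 \<mu>) (Pi\<^sub>E {..<2} A) = emeasure \<mu> (Pi\<^sub>E {..<2} A)"
      unfolding T.emeasure_eq_measure \<mu>.emeasure_eq_measure by (simp only: eq)
  next
    show "range (\<lambda>_. space (power_space 2)) \<subseteq> prod_algebra {..<2} (\<lambda>_. borel :: 's measure)"
      using prod_algebraI_finite[of "{..<2::nat}" "\<lambda>_. UNIV :: 's set" "\<lambda>_. borel"] by (auto simp: space_PiM)
  qed (auto simp: sT sets_\<mu> T.emeasure_finite)
qed

lemma bivariate_uniqueness_imp_explained_tendsto:
  assumes conv: "\<And>\<mu>'. mean_field_solution r \<gamma> 2 \<mu>' \<Longrightarrow> \<mu>' 0 \<in> probs_with_marginals 2 \<nu> \<Longrightarrow>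
      weakly_converges 2 \<mu>' (diagonal_law 2 \<nu>)"
    and A[measurable]: "A \<in> sets borel"
  shows "(\<lambda>k. explained k (indicator A)) \<longlonglongrightarrow> measure \<nu> A"
proof -
  interpret \<mu>: prob_space \<mu> by (rule \<mu>_prob)
  have sp: "space \<mu> = space (power_space 2)" using sets_eq_imp_space_eq[OF sets_\<mu>] .
  \<comment> \<open>Bounded, continuous and zero exactly on the diagonal, so that a vanishing mean
    puts \<mu> on the diagonal.\<close>
  let ?h = "\<lambda>x :: nat \<Rightarrow> 's. min 1 (dist (x 0) (x 1))"
  let ?T = "product_topology (\<lambda>_. euclidean :: 's topology) {..<2::nat}"
  \<comment> \<open>A fixed point is a stationary solution: the derivative is 0 for every test
    function.\<close>
  have "mean_field_solution r \<gamma> 2 (\<lambda>_. \<mu>)"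
    unfolding mean_field_solution_def
    using \<mu>_alg by (auto simp: bivariate_fixed_point intro!: exI[of _ "\<lambda>_. 0"])
  then have weak: "weakly_converges 2 (\<lambda>_. \<mu>) (diagonal_law 2 \<nu>)" using \<mu> by (intro conv) auto
  have h: "continuous_map ?T euclideanreal ?h"
  proof -
    have "continuous_map ?T (prod_topology euclidean euclidean) (\<lambda>x. (x 0, x 1))"
      by (intro continuous_map_pairedI continuous_map_product_projection) auto
    then have 1: "continuous_map ?T euclidean (\<lambda>x. (x 0, x 1))" by simp
    have 2: "continuous_map euclidean euclideanreal (\<lambda>z :: 's \<times> 's. min 1 (dist (fst z) (snd z)))"
      by (simp add: continuous_intros)
    show ?thesis using continuous_map_compose[OF 1 2] by (simp add: comp_def)
  qed
  have "bounded (?h ` space (power_space 2))"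
    by (auto simp: bounded_iff intro!: exI[of _ 1])
  then have "((\<lambda>t. \<integral>x. ?h x \<partial>\<mu>) \<longlongrightarrow> (\<integral>x. ?h x \<partial>diagonal_law 2 \<nu>)) (at_top :: real filter)"
    using weak h unfolding weakly_converges_def by blast
  then have "(\<integral>x. ?h x \<partial>\<mu>) = (\<integral>x. ?h x \<partial>diagonal_law 2 \<nu>)" by (simp add: tendsto_const_iff)
  also have "\<dots> = (\<integral>s. ?h (\<lambda>m\<in>{..<2}. s) \<partial>\<nu>)"
    unfolding diagonal_law_def
    by (rule integral_distr) (auto intro!: measurable_restrict continuous_map_power_space_measurable[OF h])
  also have "\<dots> = 0" by simp
  finally have int0: "(\<integral>x. ?h x \<partial>\<mu>) = 0" .
  have hm: "?h \<in> borel_measurable \<mu>"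
    using continuous_map_power_space_measurable[OF h] measurable_cong_sets[OF sets_\<mu> refl] by blast
  have "integrable \<mu> ?h" using hm by (intro integrable_bounded_real[OF \<mu>_prob, of _ 1]) auto
  then have "AE x in \<mu>. ?h x = 0" using int0 by (subst (asm) integral_nonneg_eq_0_iff_AE) auto
  then have diag: "AE x in \<mu>. x 0 = x 1" by eventually_elim (auto simp: min_def split: if_splits)
  have m[measurable]: "(\<lambda>x. x 0) \<in> borel_measurable (power_space 2)" "(\<lambda>x. x 1) \<in> borel_measurable (power_space 2)"
    by (auto intro!: coordinate_measurable)
  have E: "{x \<in> space (power_space 2). x 0 \<in> A \<and> x 1 \<in> B} \<in> sets \<mu>" if [measurable]: "B \<in> sets borel" for B
    unfolding sets_\<mu> by measurable
  \<comment> \<open>On the diagonal the second coordinate lies in A as soon as the first does, which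
    leaves the marginal mass \<nu> A as the limit of \<open>pair_prob k A A\<close>.\<close>
  have "measure \<mu> {x \<in> space (power_space 2). x 0 \<in> A \<and> x 1 \<in> A} = measure \<mu> {x \<in> space (power_space 2). x 0 \<in> A \<and> x 1 \<in> UNIV}"
    using diag by (intro \<mu>.finite_measure_eq_AE E) auto
  then have "(\<lambda>k. explained (Suc k) (indicator A)) \<longlonglongrightarrow> measure \<nu> A"
    using \<mu>_lim[OF A A] pair_limit_UNIV(1)[OF A] by (simp add: pair_prob_diagonal)
  then show ?thesis by (rule LIMSEQ_imp_Suc)
qed

end

text \<open>The converse takes n = 2 only: the bivariate equation has a stationary solution with
  marginals \<nu>, which convergence forces onto the diagonal.\<close>

lemma endogenous_iff_mean_field_convergence:
  "endogenous d M W X \<longleftrightarrow>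
    (\<forall>n\<ge>1. \<forall>\<mu>\<^sub>0 \<in> probs_with_marginals n \<nu>. \<forall>\<mu>.
      mean_field_solution r \<gamma> n \<mu> \<and> \<mu> 0 = \<mu>\<^sub>0 \<longrightarrow>
      weakly_converges n \<mu> (diagonal_law n \<nu>))"
proof
  assume "endogenous d M W X"
  then show "\<forall>n\<ge>1. \<forall>\<mu>\<^sub>0 \<in> probs_with_marginals n \<nu>. \<forall>\<mu>.
      mean_field_solution r \<gamma> n \<mu> \<and> \<mu> 0 = \<mu>\<^sub>0 \<longrightarrow>
      weakly_converges n \<mu> (diagonal_law n \<nu>)"
    using mean_field_converges_to_diagonal endogenous_imp_explained_tendsto by blast
next
  assume conv: "\<forall>n\<ge>1. \<forall>\<mu>\<^sub>0 \<in> probs_with_marginals n \<nu>. \<forall>\<mu>.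
      mean_field_solution r \<gamma> n \<mu> \<and> \<mu> 0 = \<mu>\<^sub>0 \<longrightarrow>
      weakly_converges n \<mu> (diagonal_law n \<nu>)"
  obtain \<mu> where \<mu>: "\<mu> \<in> probs_with_marginals 2 \<nu>"
    and lim: "\<And>A B. A \<in> sets borel \<Longrightarrow> B \<in> sets borel \<Longrightarrow>
      (\<lambda>k. pair_prob k A B) \<longlonglongrightarrow> measure \<mu> {x \<in> space (power_space 2). x 0 \<in> A \<and> x 1 \<in> B}"
    using bivariate_limit_exists by blast
  show "endogenous d M W X"
  proof (rule explained_tendsto_imp_endogenous, rule bivariate_uniqueness_imp_explained_tendsto[OF \<mu> lim])
    show "weakly_converges 2 \<mu>' (diagonal_law 2 \<nu>)"
      if "mean_field_solution r \<gamma> 2 \<mu>'" "\<mu>' 0 \<in> probs_with_marginals 2 \<nu>" for \<mu>'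
      using conv that by auto
  qed
qed

end

theorem theorem11:
  fixes r :: "'o::polish_space measure"
    and \<gamma> :: "'o \<Rightarrow> (nat \<Rightarrow> 's::polish_space) \<Rightarrow> 's"
    and \<kappa> :: "'o \<Rightarrow> nat"
    and \<nu> :: "'s measure"
    and d :: enat
    and M :: "'p measure"
    and W :: "nat list \<Rightarrow> 'p \<Rightarrow> 'o"
    and X :: "nat list \<Rightarrow> 'p \<Rightarrow> 's"
  assumes "sets r = sets borel" and "finite_measure r" and "emeasure r (space r) \<noteq> 0"
    and "(\<lambda>(\<omega>, x). \<gamma> \<omega> x) \<in> borel_measurable (borel \<Otimes>\<^sub>M (\<Pi>\<^sub>M i\<in>(UNIV::nat set). borel))"
    and "\<kappa> \<in> measurable borel (count_space UNIV)"
    and "\<And>\<omega> x y. (\<And>i. i < \<kappa> \<omega> \<Longrightarrow> x i = y i) \<Longrightarrow> \<gamma> \<omega> x = \<gamma> \<omega> y"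
    and "(\<integral>\<^sup>+\<omega>. of_nat (\<kappa> \<omega>) \<partial>r) < \<infinity>"
    and "\<nu> \<in> space (prob_algebra borel)"
    and "T_map r borel \<gamma> \<nu> = \<nu>"
    and "d \<noteq> 0" and "\<And>\<omega>. enat (\<kappa> \<omega>) \<le> d"
    and "recursive_tree_process r \<gamma> \<nu> d M W X"
  shows "endogenous d M W X \<longleftrightarrow>
    (\<forall>n\<ge>1. \<forall>\<mu>\<^sub>0 \<in> probs_with_marginals n \<nu>. \<forall>\<mu>.
      mean_field_solution r \<gamma> n \<mu> \<and> \<mu> 0 = \<mu>\<^sub>0 \<longrightarrow>
      weakly_converges n \<mu> (diagonal_law n \<nu>))"
proof -
  interpret rtp r \<gamma> \<kappa> \<nu> d M W X
    by (intro rtp.intro rde.intro rtp_axioms.intro) (fact assms)+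
  show ?thesis by (rule endogenous_iff_mean_field_convergence)
qed

end
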